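(* Let $\mathcal{C}$ be a modular tensor category such that $\dim(\mathcal{C}_\mathrm{pt})=\mathrm{rank}(\mathcal{C}_\mathrm{pt})=\prod_{j\in J}p_j^{a_j}$, where $J$ is a finite set, the $p_j$ are distinct primes and $a_j\in\mathbb{Z}_{\geq1}$. Then $|\mathrm{Orb}(\mathcal{C})|\geq1+\sum_{j\in J}a_j$.
   Context: All categories are over $\mathbb{C}$. A modular tensor category is a fusion category equipped with a nondegenerate braiding and a spherical structure; $\mathcal{O}(\mathcal{C})$ is the set of isomorphism classes of simple objects, $\mathbf{1}$ the tensor unit, $s_{X,Y}$ the trace of the double braiding of $X,Y\in\mathcal{O}(\mathcal{C})$, and $\dim(X)=s_{\mathbf{1},X}$. $\mathcal{C}_\mathrm{pt}$ is the fusion subcategory generated by the invertible simple objects (those of Frobenius-Perron dimension 1), and its rank is its number of simple objects up to isomorphism. Galois action: for each $\sigma\in\mathrm{Gal}(\overline{\mathbb{Q}}/\mathbb{Q})$ there is a unique permutation $\hat{\sigma}$ of $\mathcal{O}(\mathcal{C})$ with $\sigma(s_{X,Y}/s_{\mathbf{1},Y})=s_{X,\hat{\sigma}(Y)}/s_{\mathbf{1},\hat{\sigma}(Y)}$ for all $X,Y\in\mathcal{O}(\mathcal{C})$. $\mathrm{Orb}(\mathcal{C})$ is the set of orbits of $\mathcal{O}(\mathcal{C})$ under this action. *)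

theory Defs
  imports Complex_Main
    "HOL-Computational_Algebra.Primes"
    "HOL-Computational_Algebra.Polynomial"
    "HOL-Combinatorics.Permutations"
begin

text \<open>
  Tensor categories over the complex numbers, following the conventions of Etingof, Gelaki,
  Nikshych, Ostrik, \<^emph>\<open>Tensor Categories\<close>. Nothing is assumed to be strict or skeletal.

  The morphism spaces are linear subspaces of one ambient complex vector space (the type
  \<open>'m\<close> with scalar multiplication \<open>Scl\<close>). This is no restriction: embed all
  morphism spaces into their direct sum. They then meet only in \<open>0\<close>, so that
  composition and tensor product need not carry objects as arguments. The fields below are only
  meaningful on the objects in \<open>Ob\<close> and on morphisms between them.
\<close>

record ('o, 'm) lin_cat =
  Ob :: "'o set"
  Hom :: "'o \<Rightarrow> 'o \<Rightarrow> 'm set"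
  Idt :: "'o \<Rightarrow> 'm"
  Cmp :: "'m \<Rightarrow> 'm \<Rightarrow> 'm"  (infixr \<open>\<cdot>\<index>\<close> 55)
  Scl :: "complex \<Rightarrow> 'm \<Rightarrow> 'm"

record ('o, 'm) mon_cat = "('o, 'm) lin_cat" +
  Unit :: "'o"
  TensOb :: "'o \<Rightarrow> 'o \<Rightarrow> 'o"  (infixl \<open>\<boxtimes>\<index>\<close> 75)
  TensMor :: "'m \<Rightarrow> 'm \<Rightarrow> 'm"  (infixl \<open>\<star>\<index>\<close> 70)
  Assoc :: "'o \<Rightarrow> 'o \<Rightarrow> 'o \<Rightarrow> 'm"
  LUnit :: "'o \<Rightarrow> 'm"
  RUnit :: "'o \<Rightarrow> 'm"

record ('o, 'm) rigid_cat = "('o, 'm) mon_cat" +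
  Dual :: "'o \<Rightarrow> 'o"
  Ev :: "'o \<Rightarrow> 'm"
  Coev :: "'o \<Rightarrow> 'm"

record ('o, 'm) modular_cat = "('o, 'm) rigid_cat" +
  Braid :: "'o \<Rightarrow> 'o \<Rightarrow> 'm"
  Piv :: "'o \<Rightarrow> 'm"


section \<open>Linear and abelian categories\<close>

locale linear_category = vector_space "Scl C"
  for C :: "('o, 'm::ab_group_add, 'z) lin_cat_scheme" (structure) +
  assumes subspace_Hom: "\<lbrakk>X \<in> Ob C; Y \<in> Ob C\<rbrakk> \<Longrightarrow> subspace (Hom C X Y)"
    and Idt_in_Hom: "X \<in> Ob C \<Longrightarrow> Idt C X \<in> Hom C X X"
    and Cmp_in_Hom: "\<lbrakk>X \<in> Ob C; Y \<in> Ob C; Z \<in> Ob C; f \<in> Hom C X Y; g \<in> Hom C Y Z\<rbrakk>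
      \<Longrightarrow> g \<cdot> f \<in> Hom C X Z"
    and Cmp_Idt: "\<lbrakk>X \<in> Ob C; Y \<in> Ob C; f \<in> Hom C X Y\<rbrakk> \<Longrightarrow> f \<cdot> Idt C X = f"
    and Idt_Cmp: "\<lbrakk>X \<in> Ob C; Y \<in> Ob C; f \<in> Hom C X Y\<rbrakk> \<Longrightarrow> Idt C Y \<cdot> f = f"
    and Cmp_assoc: "\<lbrakk>W \<in> Ob C; X \<in> Ob C; Y \<in> Ob C; Z \<in> Ob C;
        f \<in> Hom C W X; g \<in> Hom C X Y; h \<in> Hom C Y Z\<rbrakk>
      \<Longrightarrow> (h \<cdot> g) \<cdot> f = h \<cdot> (g \<cdot> f)"
    and Cmp_add_right: "\<lbrakk>X \<in> Ob C; Y \<in> Ob C; Z \<in> Ob C;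
        f \<in> Hom C X Y; f' \<in> Hom C X Y; g \<in> Hom C Y Z\<rbrakk>
      \<Longrightarrow> g \<cdot> (f + f') = (g \<cdot> f) + (g \<cdot> f')"
    and Cmp_add_left: "\<lbrakk>X \<in> Ob C; Y \<in> Ob C; Z \<in> Ob C;
        f \<in> Hom C X Y; g \<in> Hom C Y Z; g' \<in> Hom C Y Z\<rbrakk>
      \<Longrightarrow> (g + g') \<cdot> f = (g \<cdot> f) + (g' \<cdot> f)"
    and Cmp_Scl_right: "\<lbrakk>X \<in> Ob C; Y \<in> Ob C; Z \<in> Ob C; f \<in> Hom C X Y; g \<in> Hom C Y Z\<rbrakk>
      \<Longrightarrow> g \<cdot> Scl C a f = Scl C a (g \<cdot> f)"
    and Cmp_Scl_left: "\<lbrakk>X \<in> Ob C; Y \<in> Ob C; Z \<in> Ob C; f \<in> Hom C X Y; g \<in> Hom C Y Z\<rbrakk>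
      \<Longrightarrow> Scl C a g \<cdot> f = Scl C a (g \<cdot> f)"
begin

definition is_iso :: "'o \<Rightarrow> 'o \<Rightarrow> 'm \<Rightarrow> bool" where
  "is_iso X Y f \<longleftrightarrow> f \<in> Hom C X Y \<and>
     (\<exists>g \<in> Hom C Y X. g \<cdot> f = Idt C X \<and> f \<cdot> g = Idt C Y)"

definition inv_mor :: "'o \<Rightarrow> 'o \<Rightarrow> 'm \<Rightarrow> 'm" where
  "inv_mor X Y f = (THE g. g \<in> Hom C Y X \<and> g \<cdot> f = Idt C X \<and> f \<cdot> g = Idt C Y)"

definition isomorphic :: "'o \<Rightarrow> 'o \<Rightarrow> bool" where
  "isomorphic X Y \<longleftrightarrow> (\<exists>f. is_iso X Y f)"

definition iso_class :: "'o \<Rightarrow> 'o set" where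
  "iso_class X = {Y \<in> Ob C. isomorphic X Y}"

definition is_zero_object :: "'o \<Rightarrow> bool" where
  "is_zero_object Z \<longleftrightarrow> Z \<in> Ob C \<and> (\<forall>X \<in> Ob C. Hom C X Z = {0} \<and> Hom C Z X = {0})"

definition is_mono :: "'o \<Rightarrow> 'o \<Rightarrow> 'm \<Rightarrow> bool" where
  "is_mono X Y f \<longleftrightarrow> f \<in> Hom C X Y \<and>
     (\<forall>W \<in> Ob C. \<forall>g \<in> Hom C W X. \<forall>h \<in> Hom C W X. f \<cdot> g = f \<cdot> h \<longrightarrow> g = h)"

definition is_epi :: "'o \<Rightarrow> 'o \<Rightarrow> 'm \<Rightarrow> bool" where
  "is_epi X Y f \<longleftrightarrow> f \<in> Hom C X Y \<and>
     (\<forall>Z \<in> Ob C. \<forall>g \<in> Hom C Y Z. \<forall>h \<in> Hom C Y Z. g \<cdot> f = h \<cdot> f \<longrightarrow> g = h)"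

definition is_kernel :: "'o \<Rightarrow> 'o \<Rightarrow> 'o \<Rightarrow> 'm \<Rightarrow> 'm \<Rightarrow> bool" where
  "is_kernel K X Y k f \<longleftrightarrow> k \<in> Hom C K X \<and> f \<cdot> k = 0 \<and>
     (\<forall>W \<in> Ob C. \<forall>g \<in> Hom C W X. f \<cdot> g = 0 \<longrightarrow> (\<exists>!h. h \<in> Hom C W K \<and> k \<cdot> h = g))"

definition is_cokernel :: "'o \<Rightarrow> 'o \<Rightarrow> 'o \<Rightarrow> 'm \<Rightarrow> 'm \<Rightarrow> bool" where
  "is_cokernel X Y Q f q \<longleftrightarrow> q \<in> Hom C Y Q \<and> q \<cdot> f = 0 \<and>
     (\<forall>Z \<in> Ob C. \<forall>g \<in> Hom C Y Z. g \<cdot> f = 0 \<longrightarrow> (\<exists>!h. h \<in> Hom C Q Z \<and> h \<cdot> q = g))"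

text \<open>The empty list of summands is allowed; its direct sums are the zero objects.\<close>

definition is_direct_sum :: "'o \<Rightarrow> 'o list \<Rightarrow> bool" where
  "is_direct_sum X Ys \<longleftrightarrow> (\<exists>\<iota> \<pi>.
     (\<forall>k < length Ys. \<iota> k \<in> Hom C (Ys ! k) X \<and> \<pi> k \<in> Hom C X (Ys ! k)) \<and>
     (\<forall>k < length Ys. \<forall>l < length Ys.
        \<pi> k \<cdot> \<iota> l = (if k = l then Idt C (Ys ! k) else 0)) \<and>
     (\<Sum>k < length Ys. \<iota> k \<cdot> \<pi> k) = Idt C X)"

definition simple :: "'o \<Rightarrow> bool" where
  "simple X \<longleftrightarrow> X \<in> Ob C \<and> \<not> is_zero_object X \<and>
     (\<forall>Y \<in> Ob C. \<forall>i. is_mono Y X i \<longrightarrow> is_zero_object Y \<or> is_iso Y X i)"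

text \<open>The set of isomorphism classes of simple objects lying in a set \<open>D\<close> of objects.\<close>

definition simple_classes_in :: "'o set \<Rightarrow> 'o set set" where
  "simple_classes_in D = {iso_class X | X. X \<in> D \<and> simple X}"

definition simple_classes :: "'o set set" where
  "simple_classes = simple_classes_in (Ob C)"

end

locale abelian_category = linear_category C
  for C :: "('o, 'm::ab_group_add, 'z) lin_cat_scheme" (structure) +
  assumes zero_object_ex: "\<exists>Z. is_zero_object Z"
    and biproduct_ex: "\<lbrakk>X \<in> Ob C; Y \<in> Ob C\<rbrakk> \<Longrightarrow> \<exists>Z \<in> Ob C. is_direct_sum Z [X, Y]"
    and kernel_ex: "\<lbrakk>X \<in> Ob C; Y \<in> Ob C; f \<in> Hom C X Y\<rbrakk>
      \<Longrightarrow> \<exists>K \<in> Ob C. \<exists>k. is_kernel K X Y k f"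
    and cokernel_ex: "\<lbrakk>X \<in> Ob C; Y \<in> Ob C; f \<in> Hom C X Y\<rbrakk>
      \<Longrightarrow> \<exists>Q \<in> Ob C. \<exists>q. is_cokernel X Y Q f q"
    and mono_is_kernel: "\<lbrakk>K \<in> Ob C; X \<in> Ob C; is_mono K X k\<rbrakk>
      \<Longrightarrow> \<exists>Y \<in> Ob C. \<exists>f \<in> Hom C X Y. is_kernel K X Y k f"
    and epi_is_cokernel: "\<lbrakk>Y \<in> Ob C; Q \<in> Ob C; is_epi Y Q q\<rbrakk>
      \<Longrightarrow> \<exists>X \<in> Ob C. \<exists>f \<in> Hom C X Y. is_cokernel X Y Q f q"


section \<open>Monoidal, rigid and fusion categories\<close>

locale monoidal_linear_category = linear_category C
  for C :: "('o, 'm::ab_group_add, 'z) mon_cat_scheme" (structure) +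
  assumes Unit_in_Ob: "Unit C \<in> Ob C"
    and TensOb_in_Ob: "\<lbrakk>X \<in> Ob C; Y \<in> Ob C\<rbrakk> \<Longrightarrow> X \<boxtimes> Y \<in> Ob C"
    and TensMor_in_Hom: "\<lbrakk>X \<in> Ob C; X' \<in> Ob C; Y \<in> Ob C; Y' \<in> Ob C;
        f \<in> Hom C X X'; g \<in> Hom C Y Y'\<rbrakk> \<Longrightarrow> f \<star> g \<in> Hom C (X \<boxtimes> Y) (X' \<boxtimes> Y')"
    and TensMor_Idt: "\<lbrakk>X \<in> Ob C; Y \<in> Ob C\<rbrakk> \<Longrightarrow> Idt C X \<star> Idt C Y = Idt C (X \<boxtimes> Y)"
    and TensMor_Cmp: "\<lbrakk>X \<in> Ob C; X' \<in> Ob C; X'' \<in> Ob C; Y \<in> Ob C; Y' \<in> Ob C; Y'' \<in> Ob C;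
        f \<in> Hom C X X'; f' \<in> Hom C X' X''; g \<in> Hom C Y Y'; g' \<in> Hom C Y' Y''\<rbrakk>
      \<Longrightarrow> (f' \<cdot> f) \<star> (g' \<cdot> g) = (f' \<star> g') \<cdot> (f \<star> g)"
    and TensMor_add_left: "\<lbrakk>X \<in> Ob C; X' \<in> Ob C; Y \<in> Ob C; Y' \<in> Ob C;
        f \<in> Hom C X X'; f' \<in> Hom C X X'; g \<in> Hom C Y Y'\<rbrakk>
      \<Longrightarrow> (f + f') \<star> g = f \<star> g + f' \<star> g"
    and TensMor_add_right: "\<lbrakk>X \<in> Ob C; X' \<in> Ob C; Y \<in> Ob C; Y' \<in> Ob C;
        f \<in> Hom C X X'; g \<in> Hom C Y Y'; g' \<in> Hom C Y Y'\<rbrakk>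
      \<Longrightarrow> f \<star> (g + g') = f \<star> g + f \<star> g'"
    and TensMor_Scl_left: "\<lbrakk>X \<in> Ob C; X' \<in> Ob C; Y \<in> Ob C; Y' \<in> Ob C;
        f \<in> Hom C X X'; g \<in> Hom C Y Y'\<rbrakk> \<Longrightarrow> Scl C a f \<star> g = Scl C a (f \<star> g)"
    and TensMor_Scl_right: "\<lbrakk>X \<in> Ob C; X' \<in> Ob C; Y \<in> Ob C; Y' \<in> Ob C;
        f \<in> Hom C X X'; g \<in> Hom C Y Y'\<rbrakk> \<Longrightarrow> f \<star> Scl C a g = Scl C a (f \<star> g)"
    and Assoc_iso: "\<lbrakk>X \<in> Ob C; Y \<in> Ob C; Z \<in> Ob C\<rbrakk>
      \<Longrightarrow> is_iso (X \<boxtimes> Y \<boxtimes> Z) (X \<boxtimes> (Y \<boxtimes> Z)) (Assoc C X Y Z)"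
    and LUnit_iso: "X \<in> Ob C \<Longrightarrow> is_iso (Unit C \<boxtimes> X) X (LUnit C X)"
    and RUnit_iso: "X \<in> Ob C \<Longrightarrow> is_iso (X \<boxtimes> Unit C) X (RUnit C X)"
    and Assoc_natural: "\<lbrakk>X \<in> Ob C; X' \<in> Ob C; Y \<in> Ob C; Y' \<in> Ob C; Z \<in> Ob C; Z' \<in> Ob C;
        f \<in> Hom C X X'; g \<in> Hom C Y Y'; h \<in> Hom C Z Z'\<rbrakk>
      \<Longrightarrow> Assoc C X' Y' Z' \<cdot> (f \<star> g \<star> h) = (f \<star> (g \<star> h)) \<cdot> Assoc C X Y Z"
    and LUnit_natural: "\<lbrakk>X \<in> Ob C; X' \<in> Ob C; f \<in> Hom C X X'\<rbrakk>
      \<Longrightarrow> LUnit C X' \<cdot> (Idt C (Unit C) \<star> f) = f \<cdot> LUnit C X"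
    and RUnit_natural: "\<lbrakk>X \<in> Ob C; X' \<in> Ob C; f \<in> Hom C X X'\<rbrakk>
      \<Longrightarrow> RUnit C X' \<cdot> (f \<star> Idt C (Unit C)) = f \<cdot> RUnit C X"
    and pentagon: "\<lbrakk>W \<in> Ob C; X \<in> Ob C; Y \<in> Ob C; Z \<in> Ob C\<rbrakk>
      \<Longrightarrow> Assoc C W X (Y \<boxtimes> Z) \<cdot> Assoc C (W \<boxtimes> X) Y Z =
        (Idt C W \<star> Assoc C X Y Z) \<cdot> Assoc C W (X \<boxtimes> Y) Z \<cdot> (Assoc C W X Y \<star> Idt C Z)"
    and triangle: "\<lbrakk>X \<in> Ob C; Y \<in> Ob C\<rbrakk>
      \<Longrightarrow> (Idt C X \<star> LUnit C Y) \<cdot> Assoc C X (Unit C) Y = RUnit C X \<star> Idt C Y"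
begin

definition Assoc_inv :: "'o \<Rightarrow> 'o \<Rightarrow> 'o \<Rightarrow> 'm" where
  "Assoc_inv X Y Z = inv_mor (X \<boxtimes> Y \<boxtimes> Z) (X \<boxtimes> (Y \<boxtimes> Z)) (Assoc C X Y Z)"

definition LUnit_inv :: "'o \<Rightarrow> 'm" where
  "LUnit_inv X = inv_mor (Unit C \<boxtimes> X) X (LUnit C X)"

definition RUnit_inv :: "'o \<Rightarrow> 'm" where
  "RUnit_inv X = inv_mor (X \<boxtimes> Unit C) X (RUnit C X)"

text \<open>\<open>D\<close> is a left dual of \<open>X\<close> (equivalently \<open>X\<close> is a right dual
  of \<open>D\<close>) with evaluation \<open>e\<close> and coevaluation \<open>c\<close>.\<close>

definition is_left_dual :: "'o \<Rightarrow> 'o \<Rightarrow> 'm \<Rightarrow> 'm \<Rightarrow> bool" where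
  "is_left_dual X D e c \<longleftrightarrow>
     e \<in> Hom C (D \<boxtimes> X) (Unit C) \<and> c \<in> Hom C (Unit C) (X \<boxtimes> D) \<and>
     RUnit C X \<cdot> (Idt C X \<star> e) \<cdot> Assoc C X D X \<cdot> (c \<star> Idt C X) \<cdot> LUnit_inv X = Idt C X \<and>
     LUnit C D \<cdot> (e \<star> Idt C D) \<cdot> Assoc_inv D X D \<cdot> (Idt C D \<star> c) \<cdot> RUnit_inv D = Idt C D"

text \<open>For \<open>e : A \<otimes> Z \<rightarrow> 1\<close> and \<open>c : 1 \<rightarrow> Z \<otimes> B\<close>, this is the morphism
  \<open>A \<rightarrow> A \<otimes> (Z \<otimes> B) \<rightarrow> (A \<otimes> Z) \<otimes> B \<rightarrow> B\<close>.\<close>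

definition mate :: "'o \<Rightarrow> 'o \<Rightarrow> 'o \<Rightarrow> 'm \<Rightarrow> 'm \<Rightarrow> 'm" where
  "mate A Z B e c =
     LUnit C B \<cdot> (e \<star> Idt C B) \<cdot> Assoc_inv A Z B \<cdot> (Idt C A \<star> c) \<cdot> RUnit_inv A"

text \<open>Invertible objects, that is, those of Frobenius--Perron dimension 1; in a fusion category
  they are simple.\<close>

definition invertible :: "'o \<Rightarrow> bool" where
  "invertible X \<longleftrightarrow> X \<in> Ob C \<and>
     (\<exists>Y \<in> Ob C. isomorphic (X \<boxtimes> Y) (Unit C) \<and> isomorphic (Y \<boxtimes> X) (Unit C))"

end

text \<open>Left duals are chosen once and for all, being needed to form the functor
  \<open>X \<mapsto> X\<^sup>*\<^sup>*\<close>. They are unique up to unique isomorphism; right duals are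
  only required to exist.\<close>

locale rigid_monoidal_category = monoidal_linear_category C
  for C :: "('o, 'm::ab_group_add, 'z) rigid_cat_scheme" (structure) +
  assumes Dual_in_Ob: "X \<in> Ob C \<Longrightarrow> Dual C X \<in> Ob C"
    and left_dual: "X \<in> Ob C \<Longrightarrow> is_left_dual X (Dual C X) (Ev C X) (Coev C X)"
    and right_dual_ex: "X \<in> Ob C \<Longrightarrow> \<exists>D \<in> Ob C. \<exists>e c. is_left_dual D X e c"
begin

text \<open>\<open>f\<^sup>* : Y\<^sup>* \<rightarrow> X\<^sup>*\<close> for \<open>f : X \<rightarrow> Y\<close>\<close>

definition dual_mor :: "'o \<Rightarrow> 'o \<Rightarrow> 'm \<Rightarrow> 'm" where
  "dual_mor X Y f =
     mate (Dual C Y) X (Dual C X) (Ev C Y \<cdot> (Idt C (Dual C Y) \<star> f)) (Coev C X)"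

text \<open>Evaluation \<open>(Y\<^sup>* \<otimes> X\<^sup>*) \<otimes> (X \<otimes> Y) \<rightarrow> 1\<close> and coevaluation
  \<open>1 \<rightarrow> (X \<otimes> Y) \<otimes> (Y\<^sup>* \<otimes> X\<^sup>*)\<close> exhibiting \<open>Y\<^sup>* \<otimes> X\<^sup>*\<close> as a left
  dual of \<open>X \<otimes> Y\<close>.\<close>

definition Ev_tensor :: "'o \<Rightarrow> 'o \<Rightarrow> 'm" where
  "Ev_tensor X Y = (let X' = Dual C X; Y' = Dual C Y in
     Ev C Y \<cdot> (Idt C Y' \<star> LUnit C Y) \<cdot> (Idt C Y' \<star> (Ev C X \<star> Idt C Y)) \<cdot>
     (Idt C Y' \<star> Assoc_inv X' X Y) \<cdot> Assoc C Y' X' (X \<boxtimes> Y))"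

definition Coev_tensor :: "'o \<Rightarrow> 'o \<Rightarrow> 'm" where
  "Coev_tensor X Y = (let X' = Dual C X; Y' = Dual C Y in
     Assoc_inv X Y (Y' \<boxtimes> X') \<cdot> (Idt C X \<star> Assoc C Y Y' X') \<cdot>
     (Idt C X \<star> (Coev C Y \<star> Idt C X')) \<cdot> (Idt C X \<star> LUnit_inv X') \<cdot> Coev C X)"

text \<open>The canonical isomorphisms \<open>Y\<^sup>* \<otimes> X\<^sup>* \<rightarrow> (X \<otimes> Y)\<^sup>*\<close>, their inverses, and
  the resulting tensor structure \<open>X\<^sup>*\<^sup>* \<otimes> Y\<^sup>*\<^sup>* \<rightarrow> (X \<otimes> Y)\<^sup>*\<^sup>*\<close>
  of the double dual functor.\<close>

definition dual_tensor :: "'o \<Rightarrow> 'o \<Rightarrow> 'm" where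
  "dual_tensor X Y =
     mate (Dual C Y \<boxtimes> Dual C X) (X \<boxtimes> Y) (Dual C (X \<boxtimes> Y)) (Ev_tensor X Y) (Coev C (X \<boxtimes> Y))"

definition dual_tensor_inv :: "'o \<Rightarrow> 'o \<Rightarrow> 'm" where
  "dual_tensor_inv X Y =
     mate (Dual C (X \<boxtimes> Y)) (X \<boxtimes> Y) (Dual C Y \<boxtimes> Dual C X) (Ev C (X \<boxtimes> Y)) (Coev_tensor X Y)"

definition ddual_tensor :: "'o \<Rightarrow> 'o \<Rightarrow> 'm" where
  "ddual_tensor X Y =
     dual_mor (Dual C (X \<boxtimes> Y)) (Dual C Y \<boxtimes> Dual C X) (dual_tensor_inv X Y) \<cdot>
     dual_tensor (Dual C Y) (Dual C X)"

end

locale fusion_category = rigid_monoidal_category C + abelian_category C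
  for C :: "('o, 'm::ab_group_add, 'z) rigid_cat_scheme" (structure) +
  assumes Hom_finite_dim: "\<lbrakk>X \<in> Ob C; Y \<in> Ob C\<rbrakk> \<Longrightarrow> \<exists>B. finite B \<and> span B = Hom C X Y"
    and semisimple: "X \<in> Ob C \<Longrightarrow> \<exists>Ys. (\<forall>Y \<in> set Ys. simple Y) \<and> is_direct_sum X Ys"
    and finite_simple_classes: "finite simple_classes"
    and End_Unit: "Hom C (Unit C) (Unit C) = span {Idt C (Unit C)}"
    and Idt_Unit_nonzero: "Idt C (Unit C) \<noteq> 0"
begin

text \<open>A full subcategory, given by its set of objects. In a semisimple category closure under
  subobjects is the same as closure under direct summands, and under subquotients.\<close>

definition fusion_subcategory :: "'o set \<Rightarrow> bool" where
  "fusion_subcategory D \<longleftrightarrow> D \<subseteq> Ob C \<and> Unit C \<in> D \<and>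
     (\<forall>X \<in> D. \<forall>Y \<in> Ob C. \<forall>i. is_mono Y X i \<longrightarrow> Y \<in> D) \<and>
     (\<forall>X \<in> D. \<forall>Y \<in> D. \<forall>Z \<in> Ob C. is_direct_sum Z [X, Y] \<longrightarrow> Z \<in> D) \<and>
     (\<forall>X \<in> D. \<forall>Y \<in> D. X \<boxtimes> Y \<in> D) \<and>
     (\<forall>X \<in> D. Dual C X \<in> D)"

definition generated_subcategory :: "'o set \<Rightarrow> 'o set" where
  "generated_subcategory S = \<Inter>{D. fusion_subcategory D \<and> S \<subseteq> D}"

definition pointed_part :: "'o set" where
  "pointed_part = generated_subcategory {X. simple X \<and> invertible X}"

definition rank_of :: "'o set \<Rightarrow> nat" where
  "rank_of D = card (simple_classes_in D)"

text \<open>The scalar by which an endomorphism of the unit object acts.\<close>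

definition scalar :: "'m \<Rightarrow> complex" where
  "scalar f = (THE z. f = Scl C z (Idt C (Unit C)))"

end


section \<open>Modular tensor categories\<close>

locale modular_tensor_category = fusion_category C
  for C :: "('o, 'm::ab_group_add, 'z) modular_cat_scheme" (structure) +
  assumes Braid_iso: "\<lbrakk>X \<in> Ob C; Y \<in> Ob C\<rbrakk> \<Longrightarrow> is_iso (X \<boxtimes> Y) (Y \<boxtimes> X) (Braid C X Y)"
    and Braid_natural: "\<lbrakk>X \<in> Ob C; X' \<in> Ob C; Y \<in> Ob C; Y' \<in> Ob C;
        f \<in> Hom C X X'; g \<in> Hom C Y Y'\<rbrakk>
      \<Longrightarrow> Braid C X' Y' \<cdot> (f \<star> g) = (g \<star> f) \<cdot> Braid C X Y"
    and hexagon: "\<lbrakk>X \<in> Ob C; Y \<in> Ob C; Z \<in> Ob C\<rbrakk>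
      \<Longrightarrow> Assoc C Y Z X \<cdot> Braid C X (Y \<boxtimes> Z) \<cdot> Assoc C X Y Z =
        (Idt C Y \<star> Braid C X Z) \<cdot> Assoc C Y X Z \<cdot> (Braid C X Y \<star> Idt C Z)"
    and hexagon_inv: "\<lbrakk>X \<in> Ob C; Y \<in> Ob C; Z \<in> Ob C\<rbrakk>
      \<Longrightarrow> Assoc_inv Z X Y \<cdot> Braid C (X \<boxtimes> Y) Z \<cdot> Assoc_inv X Y Z =
        (Braid C X Z \<star> Idt C Y) \<cdot> Assoc_inv X Z Y \<cdot> (Idt C X \<star> Braid C Y Z)"
    \<comment> \<open>nondegeneracy: the symmetric centre is trivial\<close>
    and nondegenerate: "\<lbrakk>X \<in> Ob C; \<And>Y. Y \<in> Ob C \<Longrightarrow> Braid C Y X \<cdot> Braid C X Y = Idt C (X \<boxtimes> Y)\<rbrakk>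
      \<Longrightarrow> \<exists>n. is_direct_sum X (replicate n (Unit C))"
    \<comment> \<open>pivotal structure: a monoidal natural isomorphism from the identity to the double dual\<close>
    and Piv_iso: "X \<in> Ob C \<Longrightarrow> is_iso X (Dual C (Dual C X)) (Piv C X)"
    and Piv_natural: "\<lbrakk>X \<in> Ob C; Y \<in> Ob C; f \<in> Hom C X Y\<rbrakk>
      \<Longrightarrow> Piv C Y \<cdot> f = dual_mor (Dual C Y) (Dual C X) (dual_mor X Y f) \<cdot> Piv C X"
    and Piv_monoidal: "\<lbrakk>X \<in> Ob C; Y \<in> Ob C\<rbrakk>
      \<Longrightarrow> Piv C (X \<boxtimes> Y) = ddual_tensor X Y \<cdot> (Piv C X \<star> Piv C Y)"
    \<comment> \<open>sphericality: every object has the same dimension as its dual\<close>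
    and spherical: "X \<in> Ob C \<Longrightarrow>
      scalar (Ev C (Dual C X) \<cdot> (Piv C X \<star> Idt C (Dual C X)) \<cdot> Coev C X) =
      scalar (Ev C (Dual C (Dual C X)) \<cdot>
        (Piv C (Dual C X) \<star> Idt C (Dual C (Dual C X))) \<cdot> Coev C (Dual C X))"
begin

text \<open>The categorical trace of an endomorphism of \<open>X\<close>.\<close>

definition qtrace :: "'o \<Rightarrow> 'm \<Rightarrow> complex" where
  "qtrace X f = scalar (Ev C (Dual C X) \<cdot> ((Piv C X \<cdot> f) \<star> Idt C (Dual C X)) \<cdot> Coev C X)"

text \<open>The S-matrix, indexed by isomorphism classes through chosen representatives.\<close>

definition rep :: "'o set \<Rightarrow> 'o" where
  "rep A = (SOME X. X \<in> A)"

definition s_mat :: "'o set \<Rightarrow> 'o set \<Rightarrow> complex" where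
  "s_mat A B = qtrace (rep A \<boxtimes> rep B) (Braid C (rep B) (rep A) \<cdot> Braid C (rep A) (rep B))"

definition unit_class :: "'o set" where
  "unit_class = iso_class (Unit C)"

definition qdim :: "'o set \<Rightarrow> complex" where
  "qdim A = s_mat unit_class A"

definition global_dim :: "'o set \<Rightarrow> complex" where
  "global_dim D = (\<Sum>A \<in> simple_classes_in D. (qdim A)\<^sup>2)"

end

text \<open>Elements of the absolute Galois group of the rationals are represented by maps on the complex
  numbers of which only the restriction to the algebraic numbers matters. The ratios
  \<open>s\<^sub>X\<^sub>Y / s\<^sub>1\<^sub>Y\<close> to which they are applied below are algebraic.\<close>

definition gal_Qbar :: "(complex \<Rightarrow> complex) set" where
  "gal_Qbar = {\<sigma>. bij_betw \<sigma> {z. algebraic z} {z. algebraic z} \<and>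
     (\<forall>x y. algebraic x \<longrightarrow> algebraic y \<longrightarrow> \<sigma> (x + y) = \<sigma> x + \<sigma> y \<and> \<sigma> (x * y) = \<sigma> x * \<sigma> y) \<and>
     (\<forall>q \<in> \<rat>. \<sigma> q = q)}"

context modular_tensor_category
begin

text \<open>The permutation of the simple classes attached to \<open>\<sigma>\<close>, as a relation.\<close>

definition is_galois_perm :: "(complex \<Rightarrow> complex) \<Rightarrow> ('o set \<Rightarrow> 'o set) \<Rightarrow> bool" where
  "is_galois_perm \<sigma> \<pi> \<longleftrightarrow> \<pi> permutes simple_classes \<and>
     (\<forall>A \<in> simple_classes. \<forall>B \<in> simple_classes.
        \<sigma> (s_mat A B / s_mat unit_class B) = s_mat A (\<pi> B) / s_mat unit_class (\<pi> B))"

definition galois_orbit :: "'o set \<Rightarrow> 'o set set" where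
  "galois_orbit B = {\<pi> B | \<sigma> \<pi>. \<sigma> \<in> gal_Qbar \<and> is_galois_perm \<sigma> \<pi>}"

definition Orb :: "'o set set set" where
  "Orb = galois_orbit ` simple_classes"

end

end

theory Submission
  imports Defs
    "HOL-Library.Function_Algebras"
    "HOL-Computational_Algebra.Fundamental_Theorem_Algebra"
begin

text \<open>
  The double braiding of an invertible object \<open>g\<close> with a simple object \<open>B\<close> is a scalar
  \<open>\<chi>\<^sub>B(g)\<close>. By the hexagons, \<open>\<chi>\<^sub>B\<close> is a character of the group \<open>G\<close> of invertible classes, and the
  set \<open>X\<close> of all \<open>\<chi>\<^sub>B\<close> is closed under multiplication (decompose \<open>B \<otimes> B'\<close> into simples). By
  nondegeneracy of the braiding \<open>X\<close> separates the points of \<open>G\<close>, so that \<open>|X| = |G|\<close> by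
  orthogonality.

  Since dimensions are multiplicative and \<open>dim g = \<plusminus>1\<close> by sphericality, \<open>s\<^sub>g\<^sub>B / s\<^sub>1\<^sub>B = dim(g) \<chi>\<^sub>B(g)\<close>.
  An element of the Galois group raises roots of unity to a fixed power, hence it sends \<open>\<chi>\<^sub>B\<close> to a
  power of \<open>\<chi>\<^sub>B\<close>. A chain of subgroups of \<open>X\<close> with prime indices therefore yields one orbit
  for each of its steps and one more for the trivial character.
\<close>

section \<open>Finite abelian groups and characters\<close>

lemma finite_cancel_power_eq_1:
  fixes X :: "'a::comm_monoid_mult set"
  assumes fin: "finite X" and cl: "\<forall>x\<in>X. \<forall>y\<in>X. x * y \<in> X" and one: "1 \<in> X"
    and canc: "\<forall>x\<in>X. \<forall>y\<in>X. \<forall>z\<in>X. x * y = x * z \<longrightarrow> y = z"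
    and x: "x \<in> X"
  shows "\<exists>n>0. x ^ n = 1"
proof -
  have pow: "x ^ k \<in> X" for k
    by (induction k) (auto simp: one x cl)
  have "\<not> inj_on (\<lambda>k. x ^ k) (UNIV :: nat set)"
    using fin pow by (metis finite_imageD finite_subset image_subsetI infinite_UNIV_nat)
  then obtain i j :: nat where ij: "i < j" "x ^ i = x ^ j"
    by (metis inj_onI linorder_neqE_nat)
  have "x ^ i * 1 = x ^ i * x ^ (j - i)"
    using ij(2) power_add[of x i "j - i"] ij(1) by simp
  then have "1 = x ^ (j - i)"
    using canc pow one by blast
  then show ?thesis
    using ij(1) by (intro exI[of _ "j - i"]) auto
qed

lemma prime_extension_of_submonoid:
  fixes X :: "'a::comm_monoid_mult set"
  assumes fin: "finite X" and cl: "\<forall>x\<in>X. \<forall>y\<in>X. x * y \<in> X" and one: "1 \<in> X"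
    and canc: "\<forall>x\<in>X. \<forall>y\<in>X. \<forall>z\<in>X. x * y = x * z \<longrightarrow> y = z"
    and HX: "H \<subset> X" and oneH: "1 \<in> H"
    and clH: "\<forall>x\<in>H. \<forall>y\<in>H. x * y \<in> H"
  shows "\<exists>H' p. prime p \<and> H \<subset> H' \<and> H' \<subseteq> X \<and> card H' = p * card H \<and>
    (\<forall>x\<in>H'. \<forall>y\<in>H'. x * y \<in> H')"
proof -
  obtain x where x: "x \<in> X" "x \<notin> H" using HX by blast
  have pow: "z ^ k \<in> X" if "z \<in> X" for z k
    using that by (induction k) (auto simp: one cl)
  have powH: "z ^ k \<in> H" if "z \<in> H" for z k
    using that by (induction k) (auto simp: oneH clH)
  define m where "m = (LEAST m. m > 0 \<and> x ^ m \<in> H)"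
  have "\<exists>m. m > 0 \<and> x ^ m \<in> H"
    using finite_cancel_power_eq_1[OF fin cl one canc x(1)] oneH by metis
  then have m: "m > 0" "x ^ m \<in> H"
    unfolding m_def by (metis (mono_tags, lifting) LeastI)+
  have m_min: "x ^ k \<notin> H" if "k < m" "k > 0" for k
    using that not_less_Least[of k "\<lambda>m. m > 0 \<and> x ^ m \<in> H"] unfolding m_def by blast
  have "m \<noteq> 1" using m x by (metis power_one_right)
  then obtain p where p: "prime p" "p dvd m" using prime_factor_nat by blast
  then obtain q where q: "m = p * q" by blast
  have p0: "p > 0" "p > 1" using p(1) prime_gt_0_nat prime_gt_1_nat by auto
  have q0: "q > 0" using m(1) q by auto
  define y where "y = x ^ q"
  have yX: "y \<in> X" unfolding y_def by (rule pow[OF x(1)])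
  have yp: "y ^ p \<in> H" using m(2) q unfolding y_def by (simp flip: power_mult add: mult.commute)
  have ymin: "y ^ d \<notin> H" if d: "0 < d" "d < p" for d
    using m_min[of "q * d"] d q0 q unfolding y_def by (simp add: power_mult)
  define H' where "H' = (\<lambda>(h, i). h * y ^ i) ` (H \<times> {..<p})"
  have inv: "\<exists>h'\<in>H. h * h' = 1" if h: "h \<in> H" for h
  proof -
    obtain n where "n > 0" "h ^ n = 1"
      using finite_cancel_power_eq_1[OF fin cl one canc, of h] h HX by blast
    then show ?thesis
      by (intro bexI[of _ "h ^ (n - 1)"]) (auto simp: powH h simp flip: power_Suc)
  qed
  have key: "i = j" if hh: "h \<in> H" "h' \<in> H" "h * y ^ i = h' * y ^ j" "i \<le> j" "j < p" for h h' i j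
  proof (rule ccontr)
    assume "i \<noteq> j"
    then have d: "0 < j - i" "j - i < p" using hh by auto
    obtain g where g: "g \<in> H" "h' * g = 1" using inv[OF hh(2)] by blast
    have "y ^ i * h = y ^ i * (h' * y ^ (j - i))"
      using hh(3,4) by (metis le_add_diff_inverse mult.assoc mult.commute power_add)
    then have "h = h' * y ^ (j - i)"
      using canc hh(1,2) HX pow[OF yX] cl by (meson psubsetD)
    then have "h * g = y ^ (j - i)" using g(2) by (metis mult.assoc mult.commute mult_1)
    then show False using ymin[OF d] clH hh(1) g(1) by fastforce
  qed
  have inj: "inj_on (\<lambda>(h, i). h * y ^ i) (H \<times> {..<p})"
  proof (rule inj_onI, unfold split_paired_all, elim SigmaE2, unfold prod.case)
    fix h i h' j
    assume a: "h \<in> H" "h' \<in> H" "i \<in> {..<p}" "j \<in> {..<p}" "h * y ^ i = h' * y ^ j"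
    have "i = j" using key[of h h' i j] key[of h' h j i] a by (metis lessThan_iff nat_le_linear)
    moreover have "h = h'"
      using canc a HX pow[OF yX] \<open>i = j\<close> by (metis mult.commute psubsetD)
    ultimately show "(h, i) = (h', j)" by blast
  qed
  have card: "card H' = p * card H"
    unfolding H'_def by (simp add: card_image[OF inj] card_cartesian_product)
  have inH': "h * y ^ i \<in> H'" if h: "h \<in> H" for h i
    using h
  proof (induction i arbitrary: h rule: less_induct)
    case (less i)
    show ?case
    proof (cases "i < p")
      case True
      then show ?thesis using less.prems unfolding H'_def by force
    next
      case False
      then have "h * y ^ i = (h * y ^ p) * y ^ (i - p)"
        by (simp add: mult.assoc flip: power_add)
      then show ?thesis using less.IH[of "i - p" "h * y ^ p"] False p0 less.prems clH yp by simp
    qed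
  qed
  have closed: "u * v \<in> H'" if uv: "u \<in> H'" "v \<in> H'" for u v
  proof -
    obtain h i where u: "h \<in> H" "u = h * y ^ i" using uv(1) unfolding H'_def by auto
    obtain h' j where v: "h' \<in> H" "v = h' * y ^ j" using uv(2) unfolding H'_def by auto
    have "u * v = (h * h') * y ^ (i + j)" using u v by (simp add: power_add ac_simps)
    then show ?thesis using inH' clH u(1) v(1) by simp
  qed
  have "H \<subseteq> H'" using inH'[of _ 0] by auto
  moreover have "y \<in> H'" using inH'[OF oneH, of 1] by simp
  moreover have "y \<notin> H" using ymin[of 1] p0 by simp
  moreover have "H' \<subseteq> X" unfolding H'_def using HX pow[OF yX] cl by auto
  ultimately show ?thesis using card closed p(1) by blast
qed

text \<open>Along a chain of subgroups \<open>H\<^sub>i\<close> with prime indices, \<open>xs (i + 1)\<close> is chosen in \<open>H\<^sub>i\<^sub>+\<^sub>1\<close> but not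
  in \<open>H\<^sub>i\<close>, which contains all powers of \<open>xs 0, \<dots>, xs i\<close>.\<close>

lemma long_sequence_avoiding_powers:
  fixes X :: "'a::comm_monoid_mult set"
  assumes fin: "finite X" and cl: "\<forall>x\<in>X. \<forall>y\<in>X. x * y \<in> X" and one: "1 \<in> X"
    and canc: "\<forall>x\<in>X. \<forall>y\<in>X. \<forall>z\<in>X. x * y = x * z \<longrightarrow> y = z"
  shows "\<exists>xs. (\<forall>i\<le>size (prime_factorization (card X)). xs i \<in> X) \<and>
    (\<forall>j\<le>size (prime_factorization (card X)). \<forall>i<j. \<forall>k::nat. xs j \<noteq> xs i ^ k)"
proof -
  define good where "good = (\<lambda>H. H \<subseteq> X \<and> 1 \<in> H \<and> (\<forall>x\<in>H. \<forall>y\<in>H. x * y \<in> H) \<and>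
    (\<exists>xs. (\<forall>i\<le>size (prime_factorization (card H)). xs i \<in> H) \<and>
     (\<forall>j\<le>size (prime_factorization (card H)). \<forall>i<j. \<forall>k::nat. xs j \<noteq> xs i ^ k)))"
  have g1: "good {1}"
    unfolding good_def using one by (auto intro!: exI[of _ "\<lambda>_. 1"])
  have step: "\<exists>H'. good H' \<and> card H < card H'" if H: "good H" and ne: "H \<noteq> X" for H
  proof -
    have "H \<subseteq> X" and oneH: "1 \<in> H" and clH: "\<forall>x\<in>H. \<forall>y\<in>H. x * y \<in> H"
      using H unfolding good_def by blast+
    then have HX: "H \<subset> X" using ne by blast
    obtain xs where xs': "\<forall>i\<le>size (prime_factorization (card H)). xs i \<in> H"
        "\<forall>j\<le>size (prime_factorization (card H)). \<forall>i<j. \<forall>k::nat. xs j \<noteq> xs i ^ k"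
      using H unfolding good_def by (elim conjE exE) (rule that)
    have xs: "\<And>i. i \<le> size (prime_factorization (card H)) \<Longrightarrow> xs i \<in> H"
      "\<And>i j k. j \<le> size (prime_factorization (card H)) \<Longrightarrow> i < j \<Longrightarrow> xs j \<noteq> xs i ^ (k::nat)"
      using xs' by simp_all
    obtain H' p where H': "prime p" "H \<subset> H'" "H' \<subseteq> X" "card H' = p * card H"
      "\<forall>x\<in>H'. \<forall>y\<in>H'. x * y \<in> H'"
      using prime_extension_of_submonoid[OF fin cl one canc HX oneH clH] by metis
    obtain y where y: "y \<in> H'" "y \<notin> H" using H'(2) by blast
    have finH: "finite H" "finite H'" using fin H' HX finite_subset by blast+
    have "card H > 0" using oneH finH by (auto simp: card_gt_0_iff)
    then have size: "size (prime_factorization (card H')) = Suc (size (prime_factorization (card H)))"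
      using H'(1,4) prime_gt_0_nat[OF H'(1)]
      by (simp add: prime_factorization_mult prime_factorization_prime)
    let ?n = "size (prime_factorization (card H))"
    have powH: "z ^ k \<in> H" if "z \<in> H" for z and k :: nat
      using that by (induction k) (auto simp: oneH clH)
    define ys where "ys = xs(Suc ?n := y)"
    have "ys i \<in> H'" if "i \<le> Suc ?n" for i
      using that xs(1)[of i] y H'(2) unfolding ys_def by auto
    moreover have "ys j \<noteq> ys i ^ k" if "j \<le> Suc ?n" "i < j" for i j k
      using that xs(1)[of i] xs(2)[of j i k] powH[of "xs i" k] y unfolding ys_def by auto
    ultimately have "good H'"
      unfolding good_def size using H'(2,3,5) oneH by (intro conjI exI[of _ ys]) auto
    moreover have "card H < card H'" using H'(2) finH(2) psubset_card_mono by blast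
    ultimately show ?thesis by blast
  qed
  have bd: "card H \<le> card X" if "good H" for H
  proof -
    have "H \<subseteq> X" using that unfolding good_def by (elim conjE)
    then show ?thesis using fin card_mono by blast
  qed
  have "\<exists>H. good H \<and> (\<forall>H'. good H' \<longrightarrow> card H' \<le> card H)"
    by (rule ex_has_greatest_nat[where P = good and f = card and b = "Suc (card X)", OF g1]) (use bd in \<open>simp add: less_Suc_eq_le\<close>)
  then have "good X" using step by (metis not_less)
  then show ?thesis unfolding good_def by (elim conjE)
qed

lemma card_eq_of_nondegenerate_pairing:
  fixes X :: "('g \<Rightarrow> complex) set" and op :: "'g \<Rightarrow> 'g \<Rightarrow> 'g"
  assumes finG: "finite G" and finX: "finite X"
    and op_closed: "\<And>g h. g \<in> G \<Longrightarrow> h \<in> G \<Longrightarrow> op g h \<in> G"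
    and op_inj: "\<And>h. h \<in> G \<Longrightarrow> inj_on (op h) G"
    and hom: "\<And>x g h. x \<in> X \<Longrightarrow> g \<in> G \<Longrightarrow> h \<in> G \<Longrightarrow> x (op g h) = x g * x h"
    and oneX: "1 \<in> X" and clX: "\<And>x y. x \<in> X \<Longrightarrow> y \<in> X \<Longrightarrow> x * y \<in> X"
    and canc: "\<forall>x\<in>X. \<forall>y\<in>X. \<forall>z\<in>X. x * y = x * z \<longrightarrow> y = z"
    and out: "\<And>x g. x \<in> X \<Longrightarrow> g \<notin> G \<Longrightarrow> x g = 1"
    and e: "e \<in> G" "\<And>x. x \<in> X \<Longrightarrow> x e = 1"
    and nondeg: "\<And>g. g \<in> G \<Longrightarrow> (\<And>x. x \<in> X \<Longrightarrow> x g = 1) \<Longrightarrow> g = e"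
  shows "card X = card G"
proof -
  have G_sum: "(\<Sum>g\<in>G. x g) = (if x = 1 then of_nat (card G) else 0)" if x: "x \<in> X" for x
  proof (cases "x = 1")
    case False
    then obtain h where h: "h \<in> G" "x h \<noteq> 1"
      using out[OF x] by (metis one_fun_apply ext)
    have "op h ` G = G"
      using op_closed h(1) by (intro endo_inj_surj[OF finG _ op_inj[OF h(1)]]) auto
    then have "(\<Sum>g\<in>G. x g) = (\<Sum>g\<in>G. x (op h g))"
      using sum.reindex[OF op_inj[OF h(1)], of x] by simp
    also have "\<dots> = x h * (\<Sum>g\<in>G. x g)"
      by (simp add: hom x h(1) sum_distrib_left)
    finally show ?thesis using h(2) False by simp
  qed simp
  have X_sum: "(\<Sum>x\<in>X. x g) = (if g = e then of_nat (card X) else 0)" if g: "g \<in> G" for g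
  proof (cases "g = e")
    case False
    then obtain y where y: "y \<in> X" "y g \<noteq> 1" using nondeg[OF g] by blast
    have inj: "inj_on (\<lambda>x. y * x) X"
      using canc y(1) by (auto intro: inj_onI)
    have "(\<lambda>x. y * x) ` X = X"
      using clX y(1) by (intro endo_inj_surj[OF finX _ inj]) auto
    then have "(\<Sum>x\<in>X. x g) = (\<Sum>x\<in>X. (y * x) g)"
      using sum.reindex[OF inj, of "\<lambda>x. x g"] by simp
    also have "\<dots> = y g * (\<Sum>x\<in>X. x g)"
      by (simp add: sum_distrib_left)
    finally show ?thesis using y(2) False by simp
  qed (simp add: e)
  have "of_nat (card X) = (\<Sum>g\<in>G. \<Sum>x\<in>X. x g)"
    using finG e(1) by (simp add: X_sum sum.delta)
  also have "\<dots> = (\<Sum>x\<in>X. \<Sum>g\<in>G. x g)"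
    by (rule sum.swap)
  also have "\<dots> = (of_nat (card G) :: complex)"
    using finX oneX by (simp add: G_sum sum.delta)
  finally show ?thesis by (simp only: of_nat_eq_iff)
qed

lemma size_prime_factorization_prod_power:
  assumes "finite J" "\<And>j. j \<in> J \<Longrightarrow> prime (p j :: nat)"
  shows "size (prime_factorization (\<Prod>j\<in>J. p j ^ a j)) = (\<Sum>j\<in>J. a j)"
  using assms
proof (induction J rule: finite_induct)
  case (insert j J)
  then have "(\<Prod>j\<in>J. p j ^ a j) \<noteq> 0" "p j \<noteq> 0"
    using prime_gt_0_nat by (auto simp: prod_zero_iff) 
  with insert show ?case
    by (simp add: prime_factorization_mult prime_factorization_prime_power)
qed simp

lemma gal_Qbar_root_of_unity:
  assumes \<sigma>: "\<sigma> \<in> gal_Qbar" and n: "n > 0"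
  shows "\<exists>k. \<forall>z. z ^ n = 1 \<longrightarrow> \<sigma> z = z ^ k"
proof -
  have alg: "algebraic z" if "z ^ n = 1" for z :: complex
  proof (rule algebraicI)
    show "poly (monom 1 n - 1) z = 0" using that by (simp add: poly_monom)
    show "(monom 1 n - 1 :: complex poly) \<noteq> 0"
      using n by (metis coeff_0 coeff_diff coeff_monom degree_1 coeff_eq_0 diff_zero one_neq_zero)
    show "coeff (monom 1 n - 1 :: complex poly) i \<in> \<int>" for i
      by (auto simp: coeff_monom coeff_1)
  qed
  have mult: "\<sigma> (x * y) = \<sigma> x * \<sigma> y" if "algebraic x" "algebraic y" for x y
    using \<sigma> that unfolding gal_Qbar_def by blast
  have one: "\<sigma> 1 = 1" using \<sigma> unfolding gal_Qbar_def by auto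
  define \<zeta> where "\<zeta> = cis (2 * pi / n)"
  have pow: "z ^ n = 1 \<longleftrightarrow> (\<exists>j. z = \<zeta> ^ j)" for z
  proof
    assume "z ^ n = 1"
    then have "z \<in> (\<lambda>k. cis (2 * pi * real k / real n)) ` {..<n}"
      using bij_betw_roots_unity[OF n] by (auto simp: bij_betw_def)
    then obtain j where "z = cis (2 * pi * real j / real n)" by blast
    then show "\<exists>j. z = \<zeta> ^ j"
      unfolding \<zeta>_def by (auto simp: DeMoivre mult_ac intro!: exI[of _ j])
  next
    assume "\<exists>j. z = \<zeta> ^ j"
    then show "z ^ n = 1"
      using n unfolding \<zeta>_def using cis_multiple_2pi[OF Ints_of_nat] by (auto simp: DeMoivre mult_ac)
  qed
  have \<zeta>: "\<zeta> ^ n = 1" using pow[of \<zeta>] by (metis power_one_right)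
  have \<sigma>_pow: "\<sigma> (z ^ j) = \<sigma> z ^ j" if "z ^ n = 1" for z j
  proof (induction j)
    case (Suc j)
    have "(z ^ j) ^ n = 1" using that by (metis power_commutes power_mult power_one mult.commute)
    then show ?case using Suc mult[of z "z ^ j"] that alg by simp
  qed (simp add: one)
  have "\<sigma> \<zeta> ^ n = 1" using \<sigma>_pow[OF \<zeta>, of n] \<zeta> one by simp
  then obtain k where k: "\<sigma> \<zeta> = \<zeta> ^ k" using pow by blast
  have "\<sigma> z = z ^ k" if z: "z ^ n = 1" for z
  proof -
    obtain j where "z = \<zeta> ^ j" using z pow by blast
    then show ?thesis using \<sigma>_pow[OF \<zeta>, of j] k by (metis mult.commute power_mult)
  qed
  then show ?thesis by blast
qed

section \<open>A calculus of typed arrows\<close>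

text \<open>
  A morphism packaged with its source and target. Ill-typed composites have the value \<open>None\<close>, which
  makes composition associative without side conditions; the typing conditions of the other laws
  become equations between objects that the simplifier can check.
\<close>

datatype ('o, 'm) arrow = Arrow (dm: 'o) (cd: 'o) (mo: "'m option")

abbreviation hm :: "'o \<Rightarrow> 'o \<Rightarrow> 'm \<Rightarrow> ('o, 'm) arrow" where
  "hm X Y f \<equiv> Arrow X Y (Some f)"

context linear_category
begin

lemma inv_mor_props:
  assumes "X \<in> Ob C" "Y \<in> Ob C" "is_iso X Y f"
  shows "inv_mor X Y f \<in> Hom C Y X" "inv_mor X Y f \<cdot> f = Idt C X" "f \<cdot> inv_mor X Y f = Idt C Y"
proof -
  obtain g where g: "g \<in> Hom C Y X" "g \<cdot> f = Idt C X" "f \<cdot> g = Idt C Y" and f: "f \<in> Hom C X Y"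
    using assms(3) unfolding is_iso_def by blast
  have "\<exists>!g. g \<in> Hom C Y X \<and> g \<cdot> f = Idt C X \<and> f \<cdot> g = Idt C Y"
  proof (rule ex1I[of _ g])
    fix h assume h: "h \<in> Hom C Y X \<and> h \<cdot> f = Idt C X \<and> f \<cdot> h = Idt C Y"
    have "h = h \<cdot> (f \<cdot> g)" using h g assms Cmp_Idt by simp
    also have "\<dots> = (h \<cdot> f) \<cdot> g" using Cmp_assoc[of Y X Y X g f h] h g f assms by simp
    also have "\<dots> = g" using h g assms Idt_Cmp by simp
    finally show "h = g" .
  qed (use g in blast)
  from theI'[OF this] show "inv_mor X Y f \<in> Hom C Y X" "inv_mor X Y f \<cdot> f = Idt C X"
    "f \<cdot> inv_mor X Y f = Idt C Y"
    unfolding inv_mor_def by blast+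
qed

definition arr :: "('o, 'm) arrow \<Rightarrow> bool" where
  "arr a \<longleftrightarrow> dm a \<in> Ob C \<and> cd a \<in> Ob C \<and> (\<exists>f \<in> Hom C (dm a) (cd a). mo a = Some f)"

definition cmp :: "('o, 'm) arrow \<Rightarrow> ('o, 'm) arrow \<Rightarrow> ('o, 'm) arrow" (infixr \<open>\<bullet>\<close> 55) where
  "b \<bullet> a = Arrow (dm a) (cd b)
     (if arr a \<and> arr b \<and> cd a = dm b then Some (the (mo b) \<cdot> the (mo a)) else None)"

definition ide :: "'o \<Rightarrow> ('o, 'm) arrow" where
  "ide X = Arrow X X (if X \<in> Ob C then Some (Idt C X) else None)"

definition scl :: "complex \<Rightarrow> ('o, 'm) arrow \<Rightarrow> ('o, 'm) arrow" where
  "scl z a = Arrow (dm a) (cd a) (if arr a then Some (Scl C z (the (mo a))) else None)"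

lemma arr_hm [simp]: "arr (hm X Y f) \<longleftrightarrow> X \<in> Ob C \<and> Y \<in> Ob C \<and> f \<in> Hom C X Y"
  unfolding arr_def by auto

lemma arrE:
  assumes "arr a"
  obtains X Y f where "a = hm X Y f" "X \<in> Ob C" "Y \<in> Ob C" "f \<in> Hom C X Y"
  using assms unfolding arr_def by (metis arrow.collapse)

lemma Scl_in_Hom: "\<lbrakk>X \<in> Ob C; Y \<in> Ob C; f \<in> Hom C X Y\<rbrakk> \<Longrightarrow> Scl C z f \<in> Hom C X Y"
  using subspace_Hom subspace_scale by blast

lemma arr_ob [simp]: "arr a \<Longrightarrow> dm a \<in> Ob C" "arr a \<Longrightarrow> cd a \<in> Ob C"
  unfolding arr_def by auto

lemma dm_cmp [simp]: "dm (b \<bullet> a) = dm a" and cd_cmp [simp]: "cd (b \<bullet> a) = cd b"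
  and dm_ide [simp]: "dm (ide X) = X" and cd_ide [simp]: "cd (ide X) = X"
  and dm_scl [simp]: "dm (scl z a) = dm a" and cd_scl [simp]: "cd (scl z a) = cd a"
  unfolding cmp_def ide_def scl_def by simp_all

lemma arr_cmp [simp]: "arr (b \<bullet> a) \<longleftrightarrow> arr a \<and> arr b \<and> cd a = dm b"
proof
  assume "arr a \<and> arr b \<and> cd a = dm b"
  then show "arr (b \<bullet> a)"
    unfolding cmp_def arr_def using Cmp_in_Hom by fastforce
next
  assume "arr (b \<bullet> a)"
  then have "mo (b \<bullet> a) \<noteq> None" by (auto elim: arrE)
  then show "arr a \<and> arr b \<and> cd a = dm b" by (simp add: cmp_def split: if_splits)
qed

lemma arr_ide [simp]: "arr (ide X) \<longleftrightarrow> X \<in> Ob C"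
  unfolding arr_def ide_def using Idt_in_Hom by auto

lemma arr_scl [simp]: "arr (scl z a) \<longleftrightarrow> arr a"
proof
  assume "arr a"
  then show "arr (scl z a)"
    unfolding scl_def arr_def using Scl_in_Hom by fastforce
next
  assume "arr (scl z a)"
  then have "mo (scl z a) \<noteq> None" by (auto elim: arrE)
  then show "arr a" by (simp add: scl_def split: if_splits)
qed

lemma mo_None: "\<not> arr (b \<bullet> a) \<Longrightarrow> mo (b \<bullet> a) = None" "\<not> arr (scl z a) \<Longrightarrow> mo (scl z a) = None"
  unfolding arr_cmp arr_scl by (auto simp: cmp_def scl_def)

lemma cmp_hm: "\<lbrakk>X \<in> Ob C; Y \<in> Ob C; Z \<in> Ob C; f \<in> Hom C X Y; g \<in> Hom C Y Z\<rbrakk>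
    \<Longrightarrow> hm Y Z g \<bullet> hm X Y f = hm X Z (g \<cdot> f)"
  by (simp add: cmp_def)

lemma ide_hm: "X \<in> Ob C \<Longrightarrow> ide X = hm X X (Idt C X)"
  by (simp add: ide_def)

lemma scl_hm: "\<lbrakk>X \<in> Ob C; Y \<in> Ob C; f \<in> Hom C X Y\<rbrakk> \<Longrightarrow> scl z (hm X Y f) = hm X Y (Scl C z f)"
  by (simp add: scl_def)

lemma cmp_assoc [simp]: "(c \<bullet> b) \<bullet> a = c \<bullet> b \<bullet> a"
proof (cases "arr a \<and> arr b \<and> arr c \<and> cd a = dm b \<and> cd b = dm c")
  case True
  then show ?thesis
    by (auto elim!: arrE simp: cmp_hm Cmp_in_Hom Cmp_assoc)
next
  case False
  then show ?thesis by (auto intro!: arrow.expand simp: mo_None)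
qed

text \<open>Instances \<open>cmp_pre[OF law]\<close> rewrite inside right-nested composites.\<close>

lemma cmp_pre: "b \<bullet> a = c \<Longrightarrow> b \<bullet> a \<bullet> x = c \<bullet> x"
  by (metis cmp_assoc)

lemma ide_cmp [simp]: "\<lbrakk>arr f; cd f = Y\<rbrakk> \<Longrightarrow> ide Y \<bullet> f = f"
  by (auto elim!: arrE simp: ide_hm cmp_hm Idt_in_Hom Idt_Cmp)

lemma cmp_ide [simp]: "\<lbrakk>arr f; dm f = X\<rbrakk> \<Longrightarrow> f \<bullet> ide X = f"
  by (auto elim!: arrE simp: ide_hm cmp_hm Idt_in_Hom Cmp_Idt)

lemma cmp_scl [simp]: "g \<bullet> scl z f = scl z (g \<bullet> f)"
proof (cases "arr f \<and> arr g \<and> cd f = dm g")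
  case True
  then show ?thesis
    by (auto elim!: arrE simp: cmp_hm scl_hm Scl_in_Hom Cmp_in_Hom Cmp_Scl_right)
qed (auto intro!: arrow.expand simp: mo_None)

lemma scl_cmp [simp]: "scl z g \<bullet> f = scl z (g \<bullet> f)"
proof (cases "arr f \<and> arr g \<and> cd f = dm g")
  case True
  then show ?thesis
    by (auto elim!: arrE simp: cmp_hm scl_hm Scl_in_Hom Cmp_in_Hom Cmp_Scl_left)
qed (auto intro!: arrow.expand simp: mo_None)

lemma scl_scl [simp]: "scl z (scl w f) = scl (z * w) f"
  by (cases "arr f") (auto elim!: arrE intro!: arrow.expand simp: scl_hm Scl_in_Hom mo_None)

end

context monoidal_linear_category
begin

definition tens :: "('o, 'm) arrow \<Rightarrow> ('o, 'm) arrow \<Rightarrow> ('o, 'm) arrow" where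
  "tens a b = Arrow (dm a \<boxtimes> dm b) (cd a \<boxtimes> cd b)
     (if arr a \<and> arr b then Some (the (mo a) \<star> the (mo b)) else None)"

abbreviation lw :: "'o \<Rightarrow> ('o, 'm) arrow \<Rightarrow> ('o, 'm) arrow" (infixr \<open>\<rhd>\<close> 60) where
  "X \<rhd> f \<equiv> tens (ide X) f"

abbreviation rw :: "('o, 'm) arrow \<Rightarrow> 'o \<Rightarrow> ('o, 'm) arrow" (infixl \<open>\<lhd>\<close> 60) where
  "f \<lhd> X \<equiv> tens f (ide X)"

definition aa where "aa X Y Z = Arrow (X \<boxtimes> Y \<boxtimes> Z) (X \<boxtimes> (Y \<boxtimes> Z))
  (if X \<in> Ob C \<and> Y \<in> Ob C \<and> Z \<in> Ob C then Some (Assoc C X Y Z) else None)"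
definition ai where "ai X Y Z = Arrow (X \<boxtimes> (Y \<boxtimes> Z)) (X \<boxtimes> Y \<boxtimes> Z)
  (if X \<in> Ob C \<and> Y \<in> Ob C \<and> Z \<in> Ob C then Some (Assoc_inv X Y Z) else None)"
definition ll where "ll X = Arrow (Unit C \<boxtimes> X) X (if X \<in> Ob C then Some (LUnit C X) else None)"
definition li where "li X = Arrow X (Unit C \<boxtimes> X) (if X \<in> Ob C then Some (LUnit_inv X) else None)"
definition rr where "rr X = Arrow (X \<boxtimes> Unit C) X (if X \<in> Ob C then Some (RUnit C X) else None)"
definition ri where "ri X = Arrow X (X \<boxtimes> Unit C) (if X \<in> Ob C then Some (RUnit_inv X) else None)"

declare Unit_in_Ob [simp] TensOb_in_Ob [simp]

lemma struct_in_Hom: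
  "\<lbrakk>X \<in> Ob C; Y \<in> Ob C; Z \<in> Ob C\<rbrakk> \<Longrightarrow> Assoc C X Y Z \<in> Hom C (X \<boxtimes> Y \<boxtimes> Z) (X \<boxtimes> (Y \<boxtimes> Z))"
  "\<lbrakk>X \<in> Ob C; Y \<in> Ob C; Z \<in> Ob C\<rbrakk> \<Longrightarrow> Assoc_inv X Y Z \<in> Hom C (X \<boxtimes> (Y \<boxtimes> Z)) (X \<boxtimes> Y \<boxtimes> Z)"
  "X \<in> Ob C \<Longrightarrow> LUnit C X \<in> Hom C (Unit C \<boxtimes> X) X"
  "X \<in> Ob C \<Longrightarrow> LUnit_inv X \<in> Hom C X (Unit C \<boxtimes> X)"
  "X \<in> Ob C \<Longrightarrow> RUnit C X \<in> Hom C (X \<boxtimes> Unit C) X"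
  "X \<in> Ob C \<Longrightarrow> RUnit_inv X \<in> Hom C X (X \<boxtimes> Unit C)"
  using Assoc_iso LUnit_iso RUnit_iso inv_mor_props(1)
  by (auto simp: Assoc_inv_def LUnit_inv_def RUnit_inv_def is_iso_def)

lemma struct_hm:
  "\<lbrakk>X \<in> Ob C; Y \<in> Ob C; Z \<in> Ob C\<rbrakk> \<Longrightarrow> aa X Y Z = hm (X \<boxtimes> Y \<boxtimes> Z) (X \<boxtimes> (Y \<boxtimes> Z)) (Assoc C X Y Z)"
  "\<lbrakk>X \<in> Ob C; Y \<in> Ob C; Z \<in> Ob C\<rbrakk> \<Longrightarrow> ai X Y Z = hm (X \<boxtimes> (Y \<boxtimes> Z)) (X \<boxtimes> Y \<boxtimes> Z) (Assoc_inv X Y Z)"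
  "X \<in> Ob C \<Longrightarrow> ll X = hm (Unit C \<boxtimes> X) X (LUnit C X)"
  "X \<in> Ob C \<Longrightarrow> li X = hm X (Unit C \<boxtimes> X) (LUnit_inv X)"
  "X \<in> Ob C \<Longrightarrow> rr X = hm (X \<boxtimes> Unit C) X (RUnit C X)"
  "X \<in> Ob C \<Longrightarrow> ri X = hm X (X \<boxtimes> Unit C) (RUnit_inv X)"
  by (simp_all add: aa_def ai_def ll_def li_def rr_def ri_def)

lemma struct_dm_cd [simp]:
  "dm (aa X Y Z) = X \<boxtimes> Y \<boxtimes> Z" "cd (aa X Y Z) = X \<boxtimes> (Y \<boxtimes> Z)"
  "cd (ai X Y Z) = X \<boxtimes> Y \<boxtimes> Z" "dm (ai X Y Z) = X \<boxtimes> (Y \<boxtimes> Z)"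
  "dm (ll X) = Unit C \<boxtimes> X" "cd (ll X) = X" "cd (li X) = Unit C \<boxtimes> X" "dm (li X) = X"
  "dm (rr X) = X \<boxtimes> Unit C" "cd (rr X) = X" "cd (ri X) = X \<boxtimes> Unit C" "dm (ri X) = X"
  "dm (tens f g) = dm f \<boxtimes> dm g" "cd (tens f g) = cd f \<boxtimes> cd g"
  by (simp_all add: aa_def ai_def ll_def li_def rr_def ri_def tens_def)

lemma arr_struct [simp]:
  "arr (aa X Y Z) \<longleftrightarrow> X \<in> Ob C \<and> Y \<in> Ob C \<and> Z \<in> Ob C"
  "arr (ai X Y Z) \<longleftrightarrow> X \<in> Ob C \<and> Y \<in> Ob C \<and> Z \<in> Ob C"
  "arr (ll X) \<longleftrightarrow> X \<in> Ob C" "arr (li X) \<longleftrightarrow> X \<in> Ob C"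
  "arr (rr X) \<longleftrightarrow> X \<in> Ob C" "arr (ri X) \<longleftrightarrow> X \<in> Ob C"
  unfolding arr_def by (auto simp: aa_def ai_def ll_def li_def rr_def ri_def struct_in_Hom)

lemma arr_tens [simp]: "arr (tens f g) \<longleftrightarrow> arr f \<and> arr g"
proof
  assume "arr f \<and> arr g"
  then show "arr (tens f g)"
    unfolding tens_def arr_def using TensMor_in_Hom by fastforce
next
  assume "arr (tens f g)"
  then have "mo (tens f g) \<noteq> None" by (auto elim: arrE)
  then show "arr f \<and> arr g" by (simp add: tens_def split: if_splits)
qed

lemma tens_hm: "\<lbrakk>X \<in> Ob C; X' \<in> Ob C; Y \<in> Ob C; Y' \<in> Ob C; f \<in> Hom C X X'; g \<in> Hom C Y Y'\<rbrakk>
    \<Longrightarrow> tens (hm X X' f) (hm Y Y' g) = hm (X \<boxtimes> Y) (X' \<boxtimes> Y') (f \<star> g)"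
  by (simp add: tens_def)

lemmas hm_simps = cmp_hm ide_hm scl_hm tens_hm struct_hm struct_in_Hom Idt_in_Hom
  Cmp_in_Hom TensMor_in_Hom Scl_in_Hom

lemma ide_tens [simp]: "tens (ide X) (ide Y) = ide (X \<boxtimes> Y)" if "X \<in> Ob C" "Y \<in> Ob C"
  using that by (simp add: hm_simps TensMor_Idt)

lemma tens_cmp: "\<lbrakk>arr f; arr f'; arr g; arr g'; cd f = dm f'; cd g = dm g'\<rbrakk>
    \<Longrightarrow> tens (f' \<bullet> f) (g' \<bullet> g) = tens f' g' \<bullet> tens f g"
  by (auto elim!: arrE simp: hm_simps TensMor_Cmp)

lemma lw_cmp: "\<lbrakk>arr g; arr g'; cd g = dm g'; X \<in> Ob C\<rbrakk> \<Longrightarrow> X \<rhd> (g' \<bullet> g) = (X \<rhd> g') \<bullet> (X \<rhd> g)"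
  by (simp flip: tens_cmp)

lemma rw_cmp: "\<lbrakk>arr g; arr g'; cd g = dm g'; X \<in> Ob C\<rbrakk> \<Longrightarrow> (g' \<bullet> g) \<lhd> X = (g' \<lhd> X) \<bullet> (g \<lhd> X)"
  by (simp flip: tens_cmp)

lemma tens_eq: "\<lbrakk>arr f; arr g; X = dm f; Y = cd g\<rbrakk> \<Longrightarrow> tens f g = (f \<lhd> Y) \<bullet> (X \<rhd> g)"
  by (simp flip: tens_cmp)

lemma interchange: "\<lbrakk>arr f; arr g; X = dm f; Y = cd g; X' = cd f; Y' = dm g\<rbrakk>
    \<Longrightarrow> (X' \<rhd> g) \<bullet> (f \<lhd> Y') = (f \<lhd> Y) \<bullet> (X \<rhd> g)"
  by (simp flip: tens_cmp)

lemma lw_scl [simp]: "X \<in> Ob C \<Longrightarrow> arr f \<Longrightarrow> X \<rhd> scl z f = scl z (X \<rhd> f)"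
  by (auto elim!: arrE simp: hm_simps TensMor_Scl_right)

lemma rw_scl [simp]: "X \<in> Ob C \<Longrightarrow> arr f \<Longrightarrow> scl z f \<lhd> X = scl z (f \<lhd> X)"
  by (auto elim!: arrE simp: hm_simps TensMor_Scl_left)

lemma struct_inv_raw:
  "\<lbrakk>X \<in> Ob C; Y \<in> Ob C; Z \<in> Ob C\<rbrakk> \<Longrightarrow> Assoc_inv X Y Z \<cdot> Assoc C X Y Z = Idt C (X \<boxtimes> Y \<boxtimes> Z)"
  "\<lbrakk>X \<in> Ob C; Y \<in> Ob C; Z \<in> Ob C\<rbrakk> \<Longrightarrow> Assoc C X Y Z \<cdot> Assoc_inv X Y Z = Idt C (X \<boxtimes> (Y \<boxtimes> Z))"
  "X \<in> Ob C \<Longrightarrow> LUnit_inv X \<cdot> LUnit C X = Idt C (Unit C \<boxtimes> X)"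
  "X \<in> Ob C \<Longrightarrow> LUnit C X \<cdot> LUnit_inv X = Idt C X"
  "X \<in> Ob C \<Longrightarrow> RUnit_inv X \<cdot> RUnit C X = Idt C (X \<boxtimes> Unit C)"
  "X \<in> Ob C \<Longrightarrow> RUnit C X \<cdot> RUnit_inv X = Idt C X"
  unfolding Assoc_inv_def LUnit_inv_def RUnit_inv_def
  by (rule inv_mor_props(2,3), simp_all add: Assoc_iso LUnit_iso RUnit_iso)+

lemma struct_inv:
  "\<lbrakk>X \<in> Ob C; Y \<in> Ob C; Z \<in> Ob C\<rbrakk> \<Longrightarrow> ai X Y Z \<bullet> aa X Y Z = ide (X \<boxtimes> Y \<boxtimes> Z)"
  "\<lbrakk>X \<in> Ob C; Y \<in> Ob C; Z \<in> Ob C\<rbrakk> \<Longrightarrow> aa X Y Z \<bullet> ai X Y Z = ide (X \<boxtimes> (Y \<boxtimes> Z))"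
  "X \<in> Ob C \<Longrightarrow> li X \<bullet> ll X = ide (Unit C \<boxtimes> X)" "X \<in> Ob C \<Longrightarrow> ll X \<bullet> li X = ide X"
  "X \<in> Ob C \<Longrightarrow> ri X \<bullet> rr X = ide (X \<boxtimes> Unit C)" "X \<in> Ob C \<Longrightarrow> rr X \<bullet> ri X = ide X"
  by (simp_all add: hm_simps struct_inv_raw)

lemma aa_nat1: "\<lbrakk>arr f; cd f = X'; Y \<in> Ob C; Z \<in> Ob C\<rbrakk>
    \<Longrightarrow> aa X' Y Z \<bullet> (f \<lhd> Y \<lhd> Z) = (f \<lhd> (Y \<boxtimes> Z)) \<bullet> aa (dm f) Y Z"
  using Assoc_natural[of "dm f" "cd f" Y Y Z Z _ "Idt C Y" "Idt C Z"]
  by (auto elim!: arrE simp: hm_simps TensMor_Idt)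

lemma aa_nat2: "\<lbrakk>arr f; cd f = X'; Y \<in> Ob C; Z \<in> Ob C\<rbrakk>
    \<Longrightarrow> aa Y X' Z \<bullet> ((Y \<rhd> f) \<lhd> Z) = (Y \<rhd> (f \<lhd> Z)) \<bullet> aa Y (dm f) Z"
  using Assoc_natural[of Y Y "dm f" "cd f" Z Z "Idt C Y" _ "Idt C Z"]
  by (auto elim!: arrE simp: hm_simps TensMor_Idt)

lemma aa_nat3: "\<lbrakk>arr f; cd f = X'; Y \<in> Ob C; Z \<in> Ob C\<rbrakk>
    \<Longrightarrow> aa Y Z X' \<bullet> ((Y \<boxtimes> Z) \<rhd> f) = (Y \<rhd> Z \<rhd> f) \<bullet> aa Y Z (dm f)"
  using Assoc_natural[of Y Y Z Z "dm f" "cd f" "Idt C Y" "Idt C Z"]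
  by (auto elim!: arrE simp: hm_simps TensMor_Idt)

lemma ll_nat: "\<lbrakk>arr f; cd f = X'\<rbrakk> \<Longrightarrow> ll X' \<bullet> (Unit C \<rhd> f) = f \<bullet> ll (dm f)"
  by (auto elim!: arrE simp: hm_simps LUnit_natural)

lemma rr_nat: "\<lbrakk>arr f; cd f = X'\<rbrakk> \<Longrightarrow> rr X' \<bullet> (f \<lhd> Unit C) = f \<bullet> rr (dm f)"
  by (auto elim!: arrE simp: hm_simps RUnit_natural)

lemma aa_pentagon: "\<lbrakk>W \<in> Ob C; X \<in> Ob C; Y \<in> Ob C; Z \<in> Ob C\<rbrakk>
    \<Longrightarrow> aa W X (Y \<boxtimes> Z) \<bullet> aa (W \<boxtimes> X) Y Z = (W \<rhd> aa X Y Z) \<bullet> aa W (X \<boxtimes> Y) Z \<bullet> (aa W X Y \<lhd> Z)"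
  using Cmp_in_Hom[of "W \<boxtimes> X \<boxtimes> Y \<boxtimes> Z" "W \<boxtimes> (X \<boxtimes> Y) \<boxtimes> Z" "W \<boxtimes> (X \<boxtimes> Y \<boxtimes> Z)"
    "Assoc C W X Y \<star> Idt C Z" "Assoc C W (X \<boxtimes> Y) Z"]
  by (simp add: hm_simps pentagon)

lemma triangle': "\<lbrakk>X \<in> Ob C; Y \<in> Ob C\<rbrakk> \<Longrightarrow> (X \<rhd> ll Y) \<bullet> aa X (Unit C) Y = rr X \<lhd> Y"
  by (simp add: hm_simps triangle)

lemma cancel_right: "\<lbrakk>a \<bullet> b = c \<bullet> b; b \<bullet> b' = ide X; arr a; arr c; dm a = X; dm c = X\<rbrakk> \<Longrightarrow> a = c"
  by (metis cmp_assoc cmp_ide)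

lemma cancel_left: "\<lbrakk>b \<bullet> a = b \<bullet> c; b' \<bullet> b = ide X; arr a; arr c; cd a = X; cd c = X\<rbrakk> \<Longrightarrow> a = c"
  by (metis cmp_assoc ide_cmp)

lemma ai_nat1: "\<lbrakk>arr f; cd f = X'; Y \<in> Ob C; Z \<in> Ob C\<rbrakk>
    \<Longrightarrow> ai X' Y Z \<bullet> (f \<lhd> (Y \<boxtimes> Z)) = (f \<lhd> Y \<lhd> Z) \<bullet> ai (dm f) Y Z"
  by (rule cancel_left[of "aa X' Y Z" _ _ "ai X' Y Z"])
    (auto simp: struct_inv cmp_pre[OF struct_inv(2)] cmp_pre[OF aa_nat1])

lemma ai_nat2: "\<lbrakk>arr f; cd f = X'; Y \<in> Ob C; Z \<in> Ob C\<rbrakk>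
    \<Longrightarrow> ai Y X' Z \<bullet> (Y \<rhd> (f \<lhd> Z)) = ((Y \<rhd> f) \<lhd> Z) \<bullet> ai Y (dm f) Z"
  by (rule cancel_left[of "aa Y X' Z" _ _ "ai Y X' Z"])
    (auto simp: struct_inv cmp_pre[OF struct_inv(2)] cmp_pre[OF aa_nat2])

lemma ai_nat3: "\<lbrakk>arr f; cd f = X'; Y \<in> Ob C; Z \<in> Ob C\<rbrakk>
    \<Longrightarrow> ai Y Z X' \<bullet> (Y \<rhd> Z \<rhd> f) = ((Y \<boxtimes> Z) \<rhd> f) \<bullet> ai Y Z (dm f)"
  by (rule cancel_left[of "aa Y Z X'" _ _ "ai Y Z X'"])
    (auto simp: struct_inv cmp_pre[OF struct_inv(2)] cmp_pre[OF aa_nat3])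

lemma li_nat: "arr f \<Longrightarrow> cd f = X' \<Longrightarrow> li X' \<bullet> f = (Unit C \<rhd> f) \<bullet> li (dm f)"
  by (rule cancel_left[of "ll X'" _ _ "li X'"])
    (auto simp: struct_inv cmp_pre[OF struct_inv(4)] cmp_pre[OF ll_nat])

lemma ri_nat: "arr f \<Longrightarrow> cd f = X' \<Longrightarrow> ri X' \<bullet> f = (f \<lhd> Unit C) \<bullet> ri (dm f)"
  by (rule cancel_left[of "rr X'" _ _ "ri X'"])
    (auto simp: struct_inv cmp_pre[OF struct_inv(6)] cmp_pre[OF rr_nat])

lemma unit_lw_faithful: "\<lbrakk>Unit C \<rhd> f = Unit C \<rhd> g; arr f; arr g; cd f = cd g; dm f = dm g\<rbrakk> \<Longrightarrow> f = g"
  using ll_nat[of f "cd f"] ll_nat[of g "cd g"]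
  by (intro cancel_right[of f "ll (dm f)" g "li (dm f)" "dm f"]) (auto simp: struct_inv)

lemma ll_tens: "\<lbrakk>X \<in> Ob C; Y \<in> Ob C\<rbrakk> \<Longrightarrow> ll (X \<boxtimes> Y) \<bullet> aa (Unit C) X Y = ll X \<lhd> Y"
proof -
  assume o: "X \<in> Ob C" "Y \<in> Ob C"
  let ?I = "Unit C"
  let ?b = "aa ?I (?I \<boxtimes> X) Y \<bullet> (aa ?I ?I X \<lhd> Y)"
  have "(?I \<rhd> ll (X \<boxtimes> Y)) \<bullet> (?I \<rhd> aa ?I X Y) \<bullet> ?b
      = (?I \<rhd> ll (X \<boxtimes> Y)) \<bullet> aa ?I ?I (X \<boxtimes> Y) \<bullet> aa (?I \<boxtimes> ?I) X Y"
    using o by (simp add: aa_pentagon)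
  also have "\<dots> = aa ?I X Y \<bullet> (rr ?I \<lhd> X \<lhd> Y)"
    using o by (simp add: cmp_pre[OF triangle'] aa_nat1)
  also have "\<dots> = (?I \<rhd> (ll X \<lhd> Y)) \<bullet> ?b"
    using o by (simp flip: triangle' add: rw_cmp cmp_pre[OF aa_nat2])
  finally have "(?I \<rhd> (ll (X \<boxtimes> Y) \<bullet> aa ?I X Y)) \<bullet> ?b = (?I \<rhd> (ll X \<lhd> Y)) \<bullet> ?b"
    using o by (simp add: lw_cmp)
  moreover have "?b \<bullet> (ai ?I ?I X \<lhd> Y) \<bullet> ai ?I (?I \<boxtimes> X) Y = ide (?I \<boxtimes> (?I \<boxtimes> X \<boxtimes> Y))"
    using o by (simp add: cmp_pre[OF rw_cmp[symmetric]] struct_inv)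
  ultimately have "?I \<rhd> (ll (X \<boxtimes> Y) \<bullet> aa ?I X Y) = ?I \<rhd> (ll X \<lhd> Y)"
    by (rule cancel_right) (use o in simp_all)
  then show ?thesis
    by (rule unit_lw_faithful) (use o in simp_all)
qed

lemma li_tens: "\<lbrakk>X \<in> Ob C; Y \<in> Ob C\<rbrakk> \<Longrightarrow> ai (Unit C) X Y \<bullet> li (X \<boxtimes> Y) = li X \<lhd> Y"
  by (rule cancel_left[of "ll X \<lhd> Y" _ _ "li X \<lhd> Y"])
    (auto simp flip: rw_cmp simp: struct_inv, simp add: struct_inv cmp_pre[OF struct_inv(2)] flip: ll_tens)

lemma triangle_inv: "\<lbrakk>X \<in> Ob C; Y \<in> Ob C\<rbrakk> \<Longrightarrow> ai X (Unit C) Y \<bullet> (X \<rhd> li Y) = ri X \<lhd> Y"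
  by (rule cancel_left[of "rr X \<lhd> Y" _ _ "ri X \<lhd> Y"])
    (auto simp flip: rw_cmp simp: struct_inv, simp add: struct_inv cmp_pre[OF struct_inv(2)]
      flip: triangle' lw_cmp)

lemma pentagon_mixed1: "\<lbrakk>W \<in> Ob C; X \<in> Ob C; Y \<in> Ob C; Z \<in> Ob C\<rbrakk>
    \<Longrightarrow> (W \<rhd> ai X Y Z) \<bullet> aa W X (Y \<boxtimes> Z) = aa W (X \<boxtimes> Y) Z \<bullet> (aa W X Y \<lhd> Z) \<bullet> ai (W \<boxtimes> X) Y Z"
proof -
  assume o: "W \<in> Ob C" "X \<in> Ob C" "Y \<in> Ob C" "Z \<in> Ob C"
  have "(W \<rhd> ai X Y Z) \<bullet> aa W X (Y \<boxtimes> Z) = (W \<rhd> ai X Y Z) \<bullet> aa W X (Y \<boxtimes> Z) \<bullet> aa (W \<boxtimes> X) Y Z \<bullet> ai (W \<boxtimes> X) Y Z"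
    using o by (simp add: struct_inv)
  also have "\<dots> = aa W (X \<boxtimes> Y) Z \<bullet> (aa W X Y \<lhd> Z) \<bullet> ai (W \<boxtimes> X) Y Z"
    using o by (simp add: cmp_pre[OF aa_pentagon])
      (simp add: cmp_pre[OF lw_cmp[symmetric]] struct_inv)
  finally show ?thesis .
qed

lemma pentagon_mixed2: "\<lbrakk>W \<in> Ob C; X \<in> Ob C; Y \<in> Ob C; Z \<in> Ob C\<rbrakk>
    \<Longrightarrow> ai W X (Y \<boxtimes> Z) \<bullet> (W \<rhd> aa X Y Z) = aa (W \<boxtimes> X) Y Z \<bullet> (ai W X Y \<lhd> Z) \<bullet> ai W (X \<boxtimes> Y) Z"
proof -
  assume o: "W \<in> Ob C" "X \<in> Ob C" "Y \<in> Ob C" "Z \<in> Ob C"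
  have "ai W X (Y \<boxtimes> Z) \<bullet> (W \<rhd> aa X Y Z)
      = ai W X (Y \<boxtimes> Z) \<bullet> ((W \<rhd> aa X Y Z) \<bullet> aa W (X \<boxtimes> Y) Z \<bullet> (aa W X Y \<lhd> Z)) \<bullet> (ai W X Y \<lhd> Z) \<bullet> ai W (X \<boxtimes> Y) Z"
    using o by (simp add: struct_inv cmp_pre[OF rw_cmp[symmetric]])
  also have "\<dots> = aa (W \<boxtimes> X) Y Z \<bullet> (ai W X Y \<lhd> Z) \<bullet> ai W (X \<boxtimes> Y) Z"
    using o by (simp only: aa_pentagon[symmetric]) (simp add: cmp_pre[OF struct_inv(1)])
  finally show ?thesis .
qed

lemma pentagon_inv: "\<lbrakk>W \<in> Ob C; X \<in> Ob C; Y \<in> Ob C; Z \<in> Ob C\<rbrakk>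
    \<Longrightarrow> (ai W X Y \<lhd> Z) \<bullet> ai W (X \<boxtimes> Y) Z \<bullet> (W \<rhd> ai X Y Z) = ai (W \<boxtimes> X) Y Z \<bullet> ai W X (Y \<boxtimes> Z)"
proof -
  assume o: "W \<in> Ob C" "X \<in> Ob C" "Y \<in> Ob C" "Z \<in> Ob C"
  have "ai (W \<boxtimes> X) Y Z \<bullet> ai W X (Y \<boxtimes> Z) = ai (W \<boxtimes> X) Y Z \<bullet> ai W X (Y \<boxtimes> Z) \<bullet> (W \<rhd> aa X Y Z) \<bullet> (W \<rhd> ai X Y Z)"
    using o by (simp add: struct_inv flip: lw_cmp)
  also have "\<dots> = (ai W X Y \<lhd> Z) \<bullet> ai W (X \<boxtimes> Y) Z \<bullet> (W \<rhd> ai X Y Z)"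
    using o by (simp add: cmp_pre[OF pentagon_mixed2] cmp_pre[OF struct_inv(1)])
  finally show ?thesis by simp
qed

end

section \<open>Pairings, copairings and mates\<close>

context monoidal_linear_category
begin

lemma hm_eqI: "\<lbrakk>arr a; dm a = X; cd a = Y; the (mo a) = f\<rbrakk> \<Longrightarrow> hm X Y f = a"
  by (auto elim!: arrE)

lemma the_mo:
  "arr (b \<bullet> a) \<Longrightarrow> the (mo (b \<bullet> a)) = the (mo b) \<cdot> the (mo a)"
  "arr (tens b a) \<Longrightarrow> the (mo (tens b a)) = the (mo b) \<star> the (mo a)"
  "X \<in> Ob C \<Longrightarrow> the (mo (ide X)) = Idt C X"
  "arr a \<Longrightarrow> the (mo (scl z a)) = Scl C z (the (mo a))"
  "\<lbrakk>X \<in> Ob C; Y \<in> Ob C; Z \<in> Ob C\<rbrakk> \<Longrightarrow> the (mo (aa X Y Z)) = Assoc C X Y Z"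
  "\<lbrakk>X \<in> Ob C; Y \<in> Ob C; Z \<in> Ob C\<rbrakk> \<Longrightarrow> the (mo (ai X Y Z)) = Assoc_inv X Y Z"
  "X \<in> Ob C \<Longrightarrow> the (mo (ll X)) = LUnit C X" "X \<in> Ob C \<Longrightarrow> the (mo (li X)) = LUnit_inv X"
  "X \<in> Ob C \<Longrightarrow> the (mo (rr X)) = RUnit C X" "X \<in> Ob C \<Longrightarrow> the (mo (ri X)) = RUnit_inv X"
  unfolding arr_cmp arr_tens by (simp_all add: cmp_def tens_def ide_def scl_def struct_hm)

text \<open>
  Pairings \<open>X \<otimes> Y \<rightarrow> 1\<close> and copairings \<open>1 \<rightarrow> X \<otimes> Y\<close> as natural transformations between the identity
  and the composite functor \<open>X \<otimes> (Y \<otimes> -)\<close>. Composition of functors being strict, the computations with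
  duals below then involve no associativity constraints.
\<close>

definition pairing_at :: "('o, 'm) arrow \<Rightarrow> 'o \<Rightarrow> 'o \<Rightarrow> 'o \<Rightarrow> ('o, 'm) arrow" where
  "pairing_at e X Y W = ll W \<bullet> (e \<lhd> W) \<bullet> ai X Y W"

definition copairing_at :: "('o, 'm) arrow \<Rightarrow> 'o \<Rightarrow> 'o \<Rightarrow> 'o \<Rightarrow> ('o, 'm) arrow" where
  "copairing_at c X Y W = aa X Y W \<bullet> (c \<lhd> W) \<bullet> li W"

definition is_pairing :: "'o \<Rightarrow> 'o \<Rightarrow> ('o, 'm) arrow \<Rightarrow> bool" where
  "is_pairing X Y e \<longleftrightarrow> X \<in> Ob C \<and> Y \<in> Ob C \<and> arr e \<and> dm e = X \<boxtimes> Y \<and> cd e = Unit C"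

definition is_copairing :: "'o \<Rightarrow> 'o \<Rightarrow> ('o, 'm) arrow \<Rightarrow> bool" where
  "is_copairing X Y c \<longleftrightarrow> X \<in> Ob C \<and> Y \<in> Ob C \<and> arr c \<and> cd c = X \<boxtimes> Y \<and> dm c = Unit C"

lemma ap_dm_cd [simp]:
  "dm (pairing_at e X Y W) = X \<boxtimes> (Y \<boxtimes> W)" "cd (pairing_at e X Y W) = W"
  "dm (copairing_at c X Y W) = W" "cd (copairing_at c X Y W) = X \<boxtimes> (Y \<boxtimes> W)"
  by (simp_all add: pairing_at_def copairing_at_def)

lemma arr_pairing_at [simp]: "\<lbrakk>is_pairing X Y e; W \<in> Ob C\<rbrakk> \<Longrightarrow> arr (pairing_at e X Y W)"
  by (simp add: pairing_at_def is_pairing_def)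

lemma arr_copairing_at [simp]: "\<lbrakk>is_copairing X Y c; W \<in> Ob C\<rbrakk> \<Longrightarrow> arr (copairing_at c X Y W)"
  by (simp add: copairing_at_def is_copairing_def)

lemma pairing_at_nat:
  assumes e: "is_pairing X Y e" and f: "arr f" "cd f = W"
  shows "pairing_at e X Y W \<bullet> (X \<rhd> Y \<rhd> f) = f \<bullet> pairing_at e X Y (dm f)"
proof -
  have o: "X \<in> Ob C" "Y \<in> Ob C" "arr e" "dm e = X \<boxtimes> Y" "cd e = Unit C" "W \<in> Ob C"
    using e f unfolding is_pairing_def by auto
  have "(e \<lhd> W) \<bullet> ((X \<boxtimes> Y) \<rhd> f) = (Unit C \<rhd> f) \<bullet> (e \<lhd> dm f)"
    using o f by (intro interchange[symmetric]) auto
  from cmp_pre[OF this] show ?thesis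
    using o f by (simp add: pairing_at_def ai_nat3 cmp_pre[OF ll_nat])
qed

lemma copairing_at_nat:
  assumes c: "is_copairing X Y c" and f: "arr f" "cd f = W"
  shows "copairing_at c X Y W \<bullet> f = (X \<rhd> Y \<rhd> f) \<bullet> copairing_at c X Y (dm f)"
proof -
  have o: "X \<in> Ob C" "Y \<in> Ob C" "arr c" "cd c = X \<boxtimes> Y" "dm c = Unit C" "W \<in> Ob C"
    using c f unfolding is_copairing_def by auto
  have "(c \<lhd> W) \<bullet> (Unit C \<rhd> f) = ((X \<boxtimes> Y) \<rhd> f) \<bullet> (c \<lhd> dm f)"
    using o f by (intro interchange[symmetric]) auto
  from cmp_pre[OF this] show ?thesis
    using o f by (simp add: copairing_at_def li_nat cmp_pre[OF aa_nat3])
qed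

lemma pairing_at_pre:
  assumes e: "is_pairing X Y e" and f: "arr f" "cd f = X" and W: "W \<in> Ob C"
  shows "pairing_at e X Y W \<bullet> (f \<lhd> (Y \<boxtimes> W)) = pairing_at (e \<bullet> (f \<lhd> Y)) (dm f) Y W"
  using e f W unfolding is_pairing_def by (auto simp: pairing_at_def ai_nat1 rw_cmp)

lemma pairing_at_pre2:
  assumes e: "is_pairing X Y e" and f: "arr f" "cd f = Y" and W: "W \<in> Ob C"
  shows "pairing_at e X Y W \<bullet> (X \<rhd> (f \<lhd> W)) = pairing_at (e \<bullet> (X \<rhd> f)) X (dm f) W"
  using e f W unfolding is_pairing_def by (auto simp: pairing_at_def ai_nat2 rw_cmp)

lemma pairing_at_copairing_at:
  assumes "is_pairing X Y e" "is_copairing X Y c" "e \<bullet> c = scl t (ide (Unit C))" "W \<in> Ob C"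
  shows "pairing_at e X Y W \<bullet> copairing_at c X Y W = scl t (ide W)"
proof -
  have o: "X \<in> Ob C" "Y \<in> Ob C" "arr c" "cd c = X \<boxtimes> Y" "dm c = Unit C" "W \<in> Ob C"
    "arr e" "dm e = X \<boxtimes> Y" "cd e = Unit C"
    using assms unfolding is_pairing_def is_copairing_def by auto
  have "pairing_at e X Y W \<bullet> copairing_at c X Y W = ll W \<bullet> ((e \<bullet> c) \<lhd> W) \<bullet> li W"
    using o by (simp add: pairing_at_def copairing_at_def cmp_pre[OF struct_inv(1)] rw_cmp)
  then show ?thesis using o assms(3) by (simp add: struct_inv)
qed

definition mate_arr :: "'o \<Rightarrow> 'o \<Rightarrow> 'o \<Rightarrow> ('o, 'm) arrow \<Rightarrow> ('o, 'm) arrow \<Rightarrow> ('o, 'm) arrow" where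
  "mate_arr A Z B e c = ll B \<bullet> (e \<lhd> B) \<bullet> ai A Z B \<bullet> (A \<rhd> c) \<bullet> ri A"

lemma hm_mate:
  assumes "A \<in> Ob C" "Z \<in> Ob C" "B \<in> Ob C" "e \<in> Hom C (A \<boxtimes> Z) (Unit C)" "c \<in> Hom C (Unit C) (Z \<boxtimes> B)"
  shows "hm A B (mate A Z B e c) = mate_arr A Z B (hm (A \<boxtimes> Z) (Unit C) e) (hm (Unit C) (Z \<boxtimes> B) c)"
  using assms by (intro hm_eqI) (simp_all add: mate_arr_def the_mo mate_def)

lemma mate_arr_dm_cd [simp]: "dm (mate_arr A Z B e c) = A" "cd (mate_arr A Z B e c) = B"
  by (simp_all add: mate_arr_def)

lemma arr_mate_arr [simp]: "is_pairing A Z e \<Longrightarrow> is_copairing Z B c \<Longrightarrow> arr (mate_arr A Z B e c)"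
  by (simp add: mate_arr_def is_pairing_def is_copairing_def)

lemma mate_arr_rw:
  assumes "is_pairing A Z e" "is_copairing Z B c" "W \<in> Ob C"
  shows "mate_arr A Z B e c \<lhd> W = pairing_at e A Z (B \<boxtimes> W) \<bullet> (A \<rhd> copairing_at c Z B W)"
proof -
  have o: "A \<in> Ob C" "Z \<in> Ob C" "B \<in> Ob C" "W \<in> Ob C" "arr c" "cd c = Z \<boxtimes> B" "dm c = Unit C"
    "arr e" "dm e = A \<boxtimes> Z" "cd e = Unit C"
    using assms unfolding is_pairing_def is_copairing_def by auto
  have "pairing_at e A Z (B \<boxtimes> W) \<bullet> (A \<rhd> copairing_at c Z B W)
    = ll (B \<boxtimes> W) \<bullet> (e \<lhd> (B \<boxtimes> W)) \<bullet> aa (A \<boxtimes> Z) B W \<bullet> (ai A Z B \<lhd> W) \<bullet> ai A (Z \<boxtimes> B) W \<bullet>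
      (A \<rhd> (c \<lhd> W)) \<bullet> (A \<rhd> li W)"
    using o by (simp add: pairing_at_def copairing_at_def lw_cmp cmp_pre[OF pentagon_mixed2])
  also have "\<dots> = ll (B \<boxtimes> W) \<bullet> aa (Unit C) B W \<bullet> (e \<lhd> B \<lhd> W) \<bullet> (ai A Z B \<lhd> W) \<bullet>
      ((A \<rhd> c) \<lhd> W) \<bullet> ai A (Unit C) W \<bullet> (A \<rhd> li W)"
    using o by (simp add: cmp_pre[OF ai_nat2] cmp_pre[OF aa_nat1])
  also have "\<dots> = mate_arr A Z B e c \<lhd> W"
    using o by (simp add: mate_arr_def triangle_inv cmp_pre[OF ll_tens] rw_cmp)
  finally show ?thesis by simp
qed

definition is_dual_pair :: "'o \<Rightarrow> 'o \<Rightarrow> ('o, 'm) arrow \<Rightarrow> ('o, 'm) arrow \<Rightarrow> bool" where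
  "is_dual_pair X D e c \<longleftrightarrow> is_pairing D X e \<and> is_copairing X D c \<and>
     rr X \<bullet> (X \<rhd> e) \<bullet> aa X D X \<bullet> (c \<lhd> X) \<bullet> li X = ide X \<and> mate_arr D X D e c = ide D"

lemma is_dual_pair:
  assumes "X \<in> Ob C" "D \<in> Ob C" "is_left_dual X D e c"
  shows "is_dual_pair X D (hm (D \<boxtimes> X) (Unit C) e) (hm (Unit C) (X \<boxtimes> D) c)"
proof -
  let ?e = "hm (D \<boxtimes> X) (Unit C) e" and ?c = "hm (Unit C) (X \<boxtimes> D) c"
  have ec: "e \<in> Hom C (D \<boxtimes> X) (Unit C)" "c \<in> Hom C (Unit C) (X \<boxtimes> D)"
    and z1: "RUnit C X \<cdot> (Idt C X \<star> e) \<cdot> Assoc C X D X \<cdot> (c \<star> Idt C X) \<cdot> LUnit_inv X = Idt C X"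
    and z2: "mate D X D e c = Idt C D"
    using assms(3) unfolding is_left_dual_def mate_def by blast+
  have "hm X X (Idt C X) = rr X \<bullet> (X \<rhd> ?e) \<bullet> aa X D X \<bullet> (?c \<lhd> X) \<bullet> li X"
    using assms(1,2) ec by (intro hm_eqI) (simp_all add: the_mo z1)
  moreover have "mate_arr D X D ?e ?c = ide D"
    using hm_mate[of D X D e c] assms(1,2) ec z2 by (simp add: ide_hm)
  ultimately show ?thesis
    using assms(1,2) ec unfolding is_dual_pair_def is_pairing_def is_copairing_def
    by (simp add: ide_hm)
qed

lemma dual_zigzag:
  assumes d: "is_dual_pair X D e c" and W: "W \<in> Ob C"
  shows "(X \<rhd> pairing_at e D X W) \<bullet> copairing_at c X D (X \<boxtimes> W) = ide (X \<boxtimes> W)"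
proof -
  have o: "X \<in> Ob C" "D \<in> Ob C" "arr c" "cd c = X \<boxtimes> D" "dm c = Unit C"
    "arr e" "dm e = D \<boxtimes> X" "cd e = Unit C"
    and z: "rr X \<bullet> (X \<rhd> e) \<bullet> aa X D X \<bullet> (c \<lhd> X) \<bullet> li X = ide X"
    using d unfolding is_dual_pair_def is_pairing_def is_copairing_def by auto
  have "(X \<rhd> pairing_at e D X W) \<bullet> copairing_at c X D (X \<boxtimes> W)
    = (X \<rhd> ll W) \<bullet> (X \<rhd> (e \<lhd> W)) \<bullet> aa X (D \<boxtimes> X) W \<bullet> (aa X D X \<lhd> W) \<bullet> ai (X \<boxtimes> D) X W \<bullet>
      (c \<lhd> (X \<boxtimes> W)) \<bullet> li (X \<boxtimes> W)"
    using o W by (simp add: pairing_at_def copairing_at_def lw_cmp cmp_pre[OF pentagon_mixed1])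
  also have "\<dots> = (X \<rhd> ll W) \<bullet> aa X (Unit C) W \<bullet> ((X \<rhd> e) \<lhd> W) \<bullet> (aa X D X \<lhd> W) \<bullet>
      (c \<lhd> X \<lhd> W) \<bullet> ai (Unit C) X W \<bullet> li (X \<boxtimes> W)"
    using o W by (simp add: cmp_pre[OF ai_nat1] cmp_pre[OF aa_nat2])
  also have "\<dots> = (rr X \<bullet> (X \<rhd> e) \<bullet> aa X D X \<bullet> (c \<lhd> X) \<bullet> li X) \<lhd> W"
    using o W by (simp add: li_tens cmp_pre[OF triangle'] rw_cmp del: cmp_assoc) 
  finally show ?thesis using z o W by simp
qed

lemma pairing_at_mate_arr:
  assumes d: "is_dual_pair Z D e c" and q: "is_pairing A Z q" and W: "W \<in> Ob C"
  shows "pairing_at e D Z W \<bullet> (mate_arr A Z D q c \<lhd> (Z \<boxtimes> W)) = pairing_at q A Z W"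
proof -
  have p: "is_pairing D Z e" "is_copairing Z D c" using d unfolding is_dual_pair_def by auto
  have o: "A \<in> Ob C" "D \<in> Ob C" "Z \<in> Ob C" using p q unfolding is_pairing_def by auto
  have "pairing_at e D Z W \<bullet> (mate_arr A Z D q c \<lhd> (Z \<boxtimes> W))
    = (pairing_at e D Z W \<bullet> pairing_at q A Z (dm (pairing_at e D Z W))) \<bullet> (A \<rhd> copairing_at c Z D (Z \<boxtimes> W))"
    using mate_arr_rw[OF q p(2), of "Z \<boxtimes> W"] o W by simp
  also have "\<dots> = pairing_at q A Z W \<bullet> (A \<rhd> ((Z \<rhd> pairing_at e D Z W) \<bullet> copairing_at c Z D (Z \<boxtimes> W)))"
    using cmp_pre[OF pairing_at_nat[OF q, of "pairing_at e D Z W" W]] p o W by (simp add: lw_cmp)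
  also have "\<dots> = pairing_at q A Z W"
    using q o W by (simp add: dual_zigzag[OF d])
  finally show ?thesis .
qed

lemma pairing_at_inj:
  assumes "is_pairing X Y e" "is_pairing X Y e'" "pairing_at e X Y (Unit C) = pairing_at e' X Y (Unit C)"
  shows "e = e'"
proof -
  have o: "X \<in> Ob C" "Y \<in> Ob C" "arr e'" "dm e' = X \<boxtimes> Y" "cd e' = Unit C"
     "arr e" "dm e = X \<boxtimes> Y" "cd e = Unit C"
    using assms unfolding is_pairing_def by auto
  have "ll (Unit C) \<bullet> (e \<lhd> Unit C) = ll (Unit C) \<bullet> (e' \<lhd> Unit C)"
    by (rule cancel_right[of _ "ai X Y (Unit C)" _ "aa X Y (Unit C)"])
      (use assms(3) o in \<open>auto simp: pairing_at_def struct_inv\<close>)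
  then have "e \<lhd> Unit C = e' \<lhd> Unit C"
    by (rule cancel_left[OF _ struct_inv(3)]) (use o in auto)
  then have "e \<bullet> rr (X \<boxtimes> Y) = e' \<bullet> rr (X \<boxtimes> Y)"
    using rr_nat[of e "Unit C"] rr_nat[of e' "Unit C"] o by simp
  then show ?thesis
    by (rule cancel_right[OF _ struct_inv(6)]) (use o in auto)
qed

lemma pairing_mate_arr:
  assumes d: "is_dual_pair Z D e c" and q: "is_pairing A Z q"
  shows "e \<bullet> (mate_arr A Z D q c \<lhd> Z) = q"
proof -
  have p: "is_pairing D Z e" "is_copairing Z D c" using d unfolding is_dual_pair_def by auto
  have t: "arr (mate_arr A Z D q c)" using q p by simp
  have "pairing_at (e \<bullet> (mate_arr A Z D q c \<lhd> Z)) (dm (mate_arr A Z D q c)) Z (Unit C) = pairing_at q A Z (Unit C)"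
    by (rule trans[OF pairing_at_pre[symmetric] pairing_at_mate_arr[OF d q]]) (use p t in auto)
  then have "pairing_at (e \<bullet> (mate_arr A Z D q c \<lhd> Z)) A Z (Unit C) = pairing_at q A Z (Unit C)"
    by (simp only: mate_arr_dm_cd)
  moreover have "is_pairing A Z (e \<bullet> (mate_arr A Z D q c \<lhd> Z))"
    using p q t by (simp add: is_pairing_def)
  ultimately show ?thesis using q by (rule pairing_at_inj[of A Z, rotated 2])
qed

lemma mate_arr_copairing:
  assumes d: "is_dual_pair Z P e c" and k: "is_copairing Z Q k" and W: "W \<in> Ob C"
  shows "(Z \<rhd> (mate_arr P Z Q e k \<lhd> W)) \<bullet> copairing_at c Z P W = copairing_at k Z Q W"
proof -
  have p: "is_pairing P Z e" "is_copairing Z P c" using d unfolding is_dual_pair_def by auto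
  have o: "P \<in> Ob C" "Q \<in> Ob C" "Z \<in> Ob C" using p k unfolding is_pairing_def is_copairing_def by auto
  have "(Z \<rhd> (mate_arr P Z Q e k \<lhd> W)) \<bullet> copairing_at c Z P W
    = (Z \<rhd> pairing_at e P Z (Q \<boxtimes> W)) \<bullet> (Z \<rhd> P \<rhd> copairing_at k Z Q W) \<bullet> copairing_at c Z P W"
    using mate_arr_rw[OF p(1) k W] p k o W by (simp add: lw_cmp)
  also have "(Z \<rhd> P \<rhd> copairing_at k Z Q W) \<bullet> copairing_at c Z P W = copairing_at c Z P (Z \<boxtimes> (Q \<boxtimes> W)) \<bullet> copairing_at k Z Q W"
    using copairing_at_nat[OF p(2), of "copairing_at k Z Q W" "Z \<boxtimes> (Q \<boxtimes> W)"] k W by simp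
  also have "(Z \<rhd> pairing_at e P Z (Q \<boxtimes> W)) \<bullet> \<dots> = copairing_at k Z Q W"
    using cmp_pre[OF dual_zigzag[OF d]] k o W by simp
  finally show ?thesis .
qed

lemma pairing_at_rw:
  assumes "is_pairing D X e" "Y \<in> Ob C" "W \<in> Ob C"
  shows "pairing_at e D X Y \<lhd> W = pairing_at e D X (Y \<boxtimes> W) \<bullet> (D \<rhd> aa X Y W) \<bullet> aa D (X \<boxtimes> Y) W"
proof -
  have o: "D \<in> Ob C" "X \<in> Ob C" "arr e" "dm e = D \<boxtimes> X" "cd e = Unit C"
    using assms unfolding is_pairing_def by auto
  have "pairing_at e D X (Y \<boxtimes> W) \<bullet> (D \<rhd> aa X Y W) \<bullet> aa D (X \<boxtimes> Y) W
    = ll (Y \<boxtimes> W) \<bullet> (e \<lhd> (Y \<boxtimes> W)) \<bullet> aa (D \<boxtimes> X) Y W \<bullet> (ai D X Y \<lhd> W)"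
    using o assms by (simp add: pairing_at_def cmp_pre[OF pentagon_mixed2] struct_inv)
  also have "\<dots> = pairing_at e D X Y \<lhd> W"
    using o assms by (simp add: pairing_at_def cmp_pre[OF aa_nat1] rw_cmp flip: ll_tens)
  finally show ?thesis by simp
qed

lemma copairing_at_rw:
  assumes "is_copairing Y D c" "V \<in> Ob C" "W \<in> Ob C"
  shows "copairing_at c Y D V \<lhd> W = ai Y (D \<boxtimes> V) W \<bullet> (Y \<rhd> ai D V W) \<bullet> copairing_at c Y D (V \<boxtimes> W)"
proof -
  have o: "D \<in> Ob C" "Y \<in> Ob C" "arr c" "cd c = Y \<boxtimes> D" "dm c = Unit C"
    using assms unfolding is_copairing_def by auto
  have "ai Y (D \<boxtimes> V) W \<bullet> (Y \<rhd> ai D V W) \<bullet> copairing_at c Y D (V \<boxtimes> W)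
    = (aa Y D V \<lhd> W) \<bullet> ai (Y \<boxtimes> D) V W \<bullet> (c \<lhd> (V \<boxtimes> W)) \<bullet> li (V \<boxtimes> W)"
    using o assms by (simp add: copairing_at_def cmp_pre[OF pentagon_mixed1] cmp_pre[OF struct_inv(1)])
  also have "\<dots> = copairing_at c Y D V \<lhd> W"
    using o assms by (simp add: copairing_at_def cmp_pre[OF ai_nat1] li_tens rw_cmp)
  finally show ?thesis by simp
qed

end

context monoidal_linear_category
begin

lemma cmp_pre3: "c \<bullet> b \<bullet> a = d \<Longrightarrow> c \<bullet> b \<bullet> a \<bullet> x = d \<bullet> x"
  by (metis cmp_assoc)

lemma lw_rw: "\<lbrakk>arr f; cd f = X'; Y \<in> Ob C; Z \<in> Ob C\<rbrakk>
    \<Longrightarrow> (Y \<rhd> f) \<lhd> Z = ai Y X' Z \<bullet> (Y \<rhd> (f \<lhd> Z)) \<bullet> aa Y (dm f) Z"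
  using aa_nat2[of f X' Y Z] by (auto simp flip: aa_nat2 simp: cmp_pre[OF struct_inv(1)])

definition tens_pairing where
  "tens_pairing e\<^sub>1 X' X e\<^sub>2 Y' Y = e\<^sub>2 \<bullet> (Y' \<rhd> pairing_at e\<^sub>1 X' X Y) \<bullet> aa Y' X' (X \<boxtimes> Y)"

definition tens_copairing where
  "tens_copairing c\<^sub>1 X X' c\<^sub>2 Y Y' = ai X Y (Y' \<boxtimes> X') \<bullet> (X \<rhd> copairing_at c\<^sub>2 Y Y' X') \<bullet> c\<^sub>1"

lemma is_pairing_tens_pairing:
  "\<lbrakk>is_pairing X' X e\<^sub>1; is_pairing Y' Y e\<^sub>2\<rbrakk> \<Longrightarrow> is_pairing (Y' \<boxtimes> X') (X \<boxtimes> Y) (tens_pairing e\<^sub>1 X' X e\<^sub>2 Y' Y)"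
  unfolding tens_pairing_def by (subst is_pairing_def) (simp, simp add: is_pairing_def)

lemma is_copairing_tens_copairing:
  "\<lbrakk>is_copairing X X' c\<^sub>1; is_copairing Y Y' c\<^sub>2\<rbrakk> \<Longrightarrow> is_copairing (X \<boxtimes> Y) (Y' \<boxtimes> X') (tens_copairing c\<^sub>1 X X' c\<^sub>2 Y Y')"
  unfolding tens_copairing_def by (subst is_copairing_def) (simp, simp add: is_copairing_def)

lemma pairing_at_tens_pairing:
  assumes e\<^sub>1: "is_pairing X' X e\<^sub>1" and e\<^sub>2: "is_pairing Y' Y e\<^sub>2" and W: "W \<in> Ob C"
  shows "pairing_at (tens_pairing e\<^sub>1 X' X e\<^sub>2 Y' Y) (Y' \<boxtimes> X') (X \<boxtimes> Y) W =
    pairing_at e\<^sub>2 Y' Y W \<bullet> (Y' \<rhd> pairing_at e\<^sub>1 X' X (Y \<boxtimes> W)) \<bullet> aa Y' X' (X \<boxtimes> (Y \<boxtimes> W)) \<bullet> ((Y' \<boxtimes> X') \<rhd> aa X Y W)"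
proof -
  have o: "X \<in> Ob C" "X' \<in> Ob C" "Y \<in> Ob C" "Y' \<in> Ob C" "arr e\<^sub>2" "dm e\<^sub>2 = Y' \<boxtimes> Y" "cd e\<^sub>2 = Unit C"
    using e\<^sub>1 e\<^sub>2 unfolding is_pairing_def by auto
  have "pairing_at (tens_pairing e\<^sub>1 X' X e\<^sub>2 Y' Y) (Y' \<boxtimes> X') (X \<boxtimes> Y) W =
    ll W \<bullet> (e\<^sub>2 \<lhd> W) \<bullet> ((Y' \<rhd> pairing_at e\<^sub>1 X' X Y) \<lhd> W) \<bullet> (aa Y' X' (X \<boxtimes> Y) \<lhd> W) \<bullet> ai (Y' \<boxtimes> X') (X \<boxtimes> Y) W"
    using o e\<^sub>1 W unfolding pairing_at_def[of "tens_pairing _ _ _ _ _ _"] by (simp add: tens_pairing_def rw_cmp)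
  also have "(Y' \<rhd> pairing_at e\<^sub>1 X' X Y) \<lhd> W = ai Y' Y W \<bullet> (Y' \<rhd> pairing_at e\<^sub>1 X' X (Y \<boxtimes> W)) \<bullet>
      (Y' \<rhd> X' \<rhd> aa X Y W) \<bullet> (Y' \<rhd> aa X' (X \<boxtimes> Y) W) \<bullet> aa Y' (X' \<boxtimes> (X \<boxtimes> Y)) W"
    using o e\<^sub>1 W lw_rw[of "pairing_at e\<^sub>1 X' X Y" Y Y' W] by (simp add: pairing_at_rw lw_cmp)
  also have "ll W \<bullet> (e\<^sub>2 \<lhd> W) \<bullet> (\<dots>) \<bullet> (aa Y' X' (X \<boxtimes> Y) \<lhd> W) \<bullet> ai (Y' \<boxtimes> X') (X \<boxtimes> Y) W
    = pairing_at e\<^sub>2 Y' Y W \<bullet> (Y' \<rhd> pairing_at e\<^sub>1 X' X (Y \<boxtimes> W)) \<bullet> (Y' \<rhd> X' \<rhd> aa X Y W) \<bullet> aa Y' X' ((X \<boxtimes> Y) \<boxtimes> W) \<bullet>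
      aa (Y' \<boxtimes> X') (X \<boxtimes> Y) W \<bullet> ai (Y' \<boxtimes> X') (X \<boxtimes> Y) W"
    using o e\<^sub>1 e\<^sub>2 W by (simp add: pairing_at_def[of e\<^sub>2] cmp_pre3[OF aa_pentagon[symmetric]])
  also have "\<dots> = pairing_at e\<^sub>2 Y' Y W \<bullet> (Y' \<rhd> pairing_at e\<^sub>1 X' X (Y \<boxtimes> W)) \<bullet> aa Y' X' (X \<boxtimes> (Y \<boxtimes> W)) \<bullet> ((Y' \<boxtimes> X') \<rhd> aa X Y W)"
    using o e\<^sub>1 e\<^sub>2 W by (simp add: struct_inv aa_nat3)
  finally show ?thesis .
qed

lemma copairing_at_tens_copairing:
  assumes c\<^sub>1: "is_copairing X X' c\<^sub>1" and c\<^sub>2: "is_copairing Y Y' c\<^sub>2" and W: "W \<in> Ob C"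
  shows "copairing_at (tens_copairing c\<^sub>1 X X' c\<^sub>2 Y Y') (X \<boxtimes> Y) (Y' \<boxtimes> X') W =
    ai X Y (Y' \<boxtimes> X' \<boxtimes> W) \<bullet> (X \<rhd> Y \<rhd> ai Y' X' W) \<bullet> (X \<rhd> copairing_at c\<^sub>2 Y Y' (X' \<boxtimes> W)) \<bullet> copairing_at c\<^sub>1 X X' W"
proof -
  have o: "X \<in> Ob C" "X' \<in> Ob C" "Y \<in> Ob C" "Y' \<in> Ob C" "arr c\<^sub>1" "cd c\<^sub>1 = X \<boxtimes> X'" "dm c\<^sub>1 = Unit C"
    using c\<^sub>1 c\<^sub>2 unfolding is_copairing_def by auto
  have "copairing_at (tens_copairing c\<^sub>1 X X' c\<^sub>2 Y Y') (X \<boxtimes> Y) (Y' \<boxtimes> X') W =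
    aa (X \<boxtimes> Y) (Y' \<boxtimes> X') W \<bullet> (ai X Y (Y' \<boxtimes> X') \<lhd> W) \<bullet> ((X \<rhd> copairing_at c\<^sub>2 Y Y' X') \<lhd> W) \<bullet> (c\<^sub>1 \<lhd> W) \<bullet> li W"
    using o c\<^sub>2 W unfolding copairing_at_def[of "tens_copairing _ _ _ _ _ _"] by (simp add: tens_copairing_def rw_cmp)
  also have "(X \<rhd> copairing_at c\<^sub>2 Y Y' X') \<lhd> W = ai X (Y \<boxtimes> (Y' \<boxtimes> X')) W \<bullet> (X \<rhd> ai Y (Y' \<boxtimes> X') W) \<bullet>
      (X \<rhd> Y \<rhd> ai Y' X' W) \<bullet> (X \<rhd> copairing_at c\<^sub>2 Y Y' (X' \<boxtimes> W)) \<bullet> aa X X' W"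
    using o c\<^sub>2 W lw_rw[of "copairing_at c\<^sub>2 Y Y' X'" "Y \<boxtimes> (Y' \<boxtimes> X')" X W] by (simp add: copairing_at_rw lw_cmp)
  also have "aa (X \<boxtimes> Y) (Y' \<boxtimes> X') W \<bullet> (ai X Y (Y' \<boxtimes> X') \<lhd> W) \<bullet> (\<dots>) \<bullet> (c\<^sub>1 \<lhd> W) \<bullet> li W
    = aa (X \<boxtimes> Y) (Y' \<boxtimes> X') W \<bullet> ai (X \<boxtimes> Y) (Y' \<boxtimes> X') W \<bullet> ai X Y (Y' \<boxtimes> X' \<boxtimes> W) \<bullet>
      (X \<rhd> Y \<rhd> ai Y' X' W) \<bullet> (X \<rhd> copairing_at c\<^sub>2 Y Y' (X' \<boxtimes> W)) \<bullet> copairing_at c\<^sub>1 X X' W"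
    using o c\<^sub>1 c\<^sub>2 W by (simp add: copairing_at_def[of c\<^sub>1] cmp_pre3[OF pentagon_inv])
  also have "\<dots> = ai X Y (Y' \<boxtimes> X' \<boxtimes> W) \<bullet> (X \<rhd> Y \<rhd> ai Y' X' W) \<bullet> (X \<rhd> copairing_at c\<^sub>2 Y Y' (X' \<boxtimes> W)) \<bullet> copairing_at c\<^sub>1 X X' W"
    using o c\<^sub>1 c\<^sub>2 W by (simp add: cmp_pre[OF struct_inv(2)])
  finally show ?thesis .
qed

lemma pairing_at_rw_copairing_at:
  assumes e: "is_pairing A D e" and c: "is_copairing X D c" and p: "arr p" "dm p = X" "cd p = A"
    and t: "e \<bullet> (p \<lhd> D) \<bullet> c = scl t (ide (Unit C))" and W: "W \<in> Ob C"
  shows "pairing_at e A D W \<bullet> (p \<lhd> (D \<boxtimes> W)) \<bullet> copairing_at c X D W = scl t (ide W)"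
proof -
  have "pairing_at e A D W \<bullet> (p \<lhd> (D \<boxtimes> W)) = pairing_at (e \<bullet> (p \<lhd> D)) X D W"
    using pairing_at_pre[OF e p(1,3) W] p by simp
  moreover have "is_pairing X D (e \<bullet> (p \<lhd> D))"
    using e c p unfolding is_pairing_def is_copairing_def by simp
  ultimately show ?thesis
    using pairing_at_copairing_at[of X D "e \<bullet> (p \<lhd> D)" c t W] c t W by (simp flip: cmp_assoc)
qed

lemma trace_tens:
  assumes e\<^sub>1: "is_pairing A\<^sub>1 D\<^sub>1 e\<^sub>1" and e\<^sub>2: "is_pairing A\<^sub>2 D\<^sub>2 e\<^sub>2"
    and c\<^sub>1: "is_copairing X D\<^sub>1 c\<^sub>1" and c\<^sub>2: "is_copairing Y D\<^sub>2 c\<^sub>2"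
    and p\<^sub>1: "arr p\<^sub>1" "dm p\<^sub>1 = X" "cd p\<^sub>1 = A\<^sub>1" and p\<^sub>2: "arr p\<^sub>2" "dm p\<^sub>2 = Y" "cd p\<^sub>2 = A\<^sub>2"
    and t\<^sub>1: "e\<^sub>1 \<bullet> (p\<^sub>1 \<lhd> D\<^sub>1) \<bullet> c\<^sub>1 = scl t\<^sub>1 (ide (Unit C))"
    and t\<^sub>2: "e\<^sub>2 \<bullet> (p\<^sub>2 \<lhd> D\<^sub>2) \<bullet> c\<^sub>2 = scl t\<^sub>2 (ide (Unit C))"
    and W: "W \<in> Ob C"
  shows "pairing_at (tens_pairing e\<^sub>2 A\<^sub>2 D\<^sub>2 e\<^sub>1 A\<^sub>1 D\<^sub>1) (A\<^sub>1 \<boxtimes> A\<^sub>2) (D\<^sub>2 \<boxtimes> D\<^sub>1) W \<bullet> (tens p\<^sub>1 p\<^sub>2 \<lhd> (D\<^sub>2 \<boxtimes> D\<^sub>1 \<boxtimes> W)) \<bullet>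
    copairing_at (tens_copairing c\<^sub>1 X D\<^sub>1 c\<^sub>2 Y D\<^sub>2) (X \<boxtimes> Y) (D\<^sub>2 \<boxtimes> D\<^sub>1) W = scl (t\<^sub>1 * t\<^sub>2) (ide W)"
proof -
  let ?V = "D\<^sub>2 \<boxtimes> (D\<^sub>1 \<boxtimes> W)"
  have o: "X \<in> Ob C" "Y \<in> Ob C" "A\<^sub>1 \<in> Ob C" "A\<^sub>2 \<in> Ob C" "D\<^sub>1 \<in> Ob C" "D\<^sub>2 \<in> Ob C"
    using e\<^sub>1 e\<^sub>2 c\<^sub>1 c\<^sub>2 unfolding is_pairing_def is_copairing_def by auto
  have i1: "((A\<^sub>1 \<boxtimes> A\<^sub>2) \<rhd> aa D\<^sub>2 D\<^sub>1 W) \<bullet> (tens p\<^sub>1 p\<^sub>2 \<lhd> (D\<^sub>2 \<boxtimes> D\<^sub>1 \<boxtimes> W))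
      = (tens p\<^sub>1 p\<^sub>2 \<lhd> ?V) \<bullet> ((X \<boxtimes> Y) \<rhd> aa D\<^sub>2 D\<^sub>1 W)"
    using o p\<^sub>1 p\<^sub>2 W by (intro interchange) auto
  have i2: "((X \<boxtimes> Y) \<rhd> aa D\<^sub>2 D\<^sub>1 W) \<bullet> ai X Y (D\<^sub>2 \<boxtimes> D\<^sub>1 \<boxtimes> W) = ai X Y ?V \<bullet> (X \<rhd> Y \<rhd> aa D\<^sub>2 D\<^sub>1 W)"
    using o W ai_nat3[of "aa D\<^sub>2 D\<^sub>1 W" ?V X Y] by simp
  have i3: "(X \<rhd> Y \<rhd> aa D\<^sub>2 D\<^sub>1 W) \<bullet> (X \<rhd> Y \<rhd> ai D\<^sub>2 D\<^sub>1 W) = ide (X \<boxtimes> (Y \<boxtimes> ?V))"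
    using o W by (simp add: struct_inv flip: lw_cmp)
  have i4: "aa A\<^sub>1 A\<^sub>2 ?V \<bullet> (tens p\<^sub>1 p\<^sub>2 \<lhd> ?V) \<bullet> ai X Y ?V = (p\<^sub>1 \<lhd> (A\<^sub>2 \<boxtimes> ?V)) \<bullet> (X \<rhd> (p\<^sub>2 \<lhd> ?V))"
    using o p\<^sub>1 p\<^sub>2 W
    by (simp add: tens_eq[of p\<^sub>1 p\<^sub>2 X A\<^sub>2] rw_cmp cmp_pre[OF aa_nat1] cmp_pre[OF aa_nat2] struct_inv)
  have i5: "(A\<^sub>1 \<rhd> pairing_at e\<^sub>2 A\<^sub>2 D\<^sub>2 (D\<^sub>1 \<boxtimes> W)) \<bullet> (p\<^sub>1 \<lhd> (A\<^sub>2 \<boxtimes> ?V))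
      = (p\<^sub>1 \<lhd> (D\<^sub>1 \<boxtimes> W)) \<bullet> (X \<rhd> pairing_at e\<^sub>2 A\<^sub>2 D\<^sub>2 (D\<^sub>1 \<boxtimes> W))"
    using o p\<^sub>1 e\<^sub>2 W by (intro interchange) auto
  have i6: "(X \<rhd> pairing_at e\<^sub>2 A\<^sub>2 D\<^sub>2 (D\<^sub>1 \<boxtimes> W)) \<bullet> (X \<rhd> (p\<^sub>2 \<lhd> ?V)) \<bullet> (X \<rhd> copairing_at c\<^sub>2 Y D\<^sub>2 (D\<^sub>1 \<boxtimes> W))
      = scl t\<^sub>2 (ide (X \<boxtimes> (D\<^sub>1 \<boxtimes> W)))"
    using o p\<^sub>2 e\<^sub>2 c\<^sub>2 W pairing_at_rw_copairing_at[OF e\<^sub>2 c\<^sub>2 p\<^sub>2 t\<^sub>2, of "D\<^sub>1 \<boxtimes> W"] by (simp flip: lw_cmp)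
  have "pairing_at (tens_pairing e\<^sub>2 A\<^sub>2 D\<^sub>2 e\<^sub>1 A\<^sub>1 D\<^sub>1) (A\<^sub>1 \<boxtimes> A\<^sub>2) (D\<^sub>2 \<boxtimes> D\<^sub>1) W \<bullet> (tens p\<^sub>1 p\<^sub>2 \<lhd> (D\<^sub>2 \<boxtimes> D\<^sub>1 \<boxtimes> W)) \<bullet>
    copairing_at (tens_copairing c\<^sub>1 X D\<^sub>1 c\<^sub>2 Y D\<^sub>2) (X \<boxtimes> Y) (D\<^sub>2 \<boxtimes> D\<^sub>1) W
    = pairing_at e\<^sub>1 A\<^sub>1 D\<^sub>1 W \<bullet> (A\<^sub>1 \<rhd> pairing_at e\<^sub>2 A\<^sub>2 D\<^sub>2 (D\<^sub>1 \<boxtimes> W)) \<bullet> aa A\<^sub>1 A\<^sub>2 ?V \<bullet> (tens p\<^sub>1 p\<^sub>2 \<lhd> ?V) \<bullet> ai X Y ?V \<bullet>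
      (X \<rhd> Y \<rhd> aa D\<^sub>2 D\<^sub>1 W) \<bullet> (X \<rhd> Y \<rhd> ai D\<^sub>2 D\<^sub>1 W) \<bullet> (X \<rhd> copairing_at c\<^sub>2 Y D\<^sub>2 (D\<^sub>1 \<boxtimes> W)) \<bullet> copairing_at c\<^sub>1 X D\<^sub>1 W"
    by (simp add: pairing_at_tens_pairing[OF e\<^sub>2 e\<^sub>1 W] copairing_at_tens_copairing[OF c\<^sub>1 c\<^sub>2 W] cmp_pre[OF i1] cmp_pre[OF i2])
  also have "\<dots> = pairing_at e\<^sub>1 A\<^sub>1 D\<^sub>1 W \<bullet> (p\<^sub>1 \<lhd> (D\<^sub>1 \<boxtimes> W)) \<bullet> (X \<rhd> pairing_at e\<^sub>2 A\<^sub>2 D\<^sub>2 (D\<^sub>1 \<boxtimes> W)) \<bullet> (X \<rhd> (p\<^sub>2 \<lhd> ?V)) \<bullet>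
      (X \<rhd> copairing_at c\<^sub>2 Y D\<^sub>2 (D\<^sub>1 \<boxtimes> W)) \<bullet> copairing_at c\<^sub>1 X D\<^sub>1 W"
    using o c\<^sub>2 c\<^sub>1 W by (simp add: cmp_pre[OF i3] cmp_pre3[OF i4] cmp_pre[OF i5])
  also have "\<dots> = scl (t\<^sub>2 * t\<^sub>1) (ide W)"
    using pairing_at_rw_copairing_at[OF e\<^sub>1 c\<^sub>1 p\<^sub>1 t\<^sub>1 W] o c\<^sub>1 W by (simp add: cmp_pre3[OF i6])
  finally show ?thesis by (simp add: mult.commute)
qed

lemma copairing_at_post:
  assumes c: "is_copairing X D c" and f: "arr f" "dm f = X" "cd f = Y" and W: "W \<in> Ob C"
  shows "copairing_at ((f \<lhd> D) \<bullet> c) Y D W = (f \<lhd> (D \<boxtimes> W)) \<bullet> copairing_at c X D W"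
  using c f W unfolding is_copairing_def by (auto simp: copairing_at_def cmp_pre[OF aa_nat1] rw_cmp)

lemma mate_arr_slide:
  assumes e: "is_pairing P Z e" and c: "is_copairing Z' Q c" and g: "arr g" "dm g = Z'" "cd g = Z"
  shows "mate_arr P Z' Q (e \<bullet> (P \<rhd> g)) c = mate_arr P Z Q e ((g \<lhd> Q) \<bullet> c)"
  using e c g unfolding is_pairing_def is_copairing_def mate_arr_def
  by (auto simp: rw_cmp lw_cmp cmp_pre[OF ai_nat2])

end

context rigid_monoidal_category
begin

declare Dual_in_Ob [simp]

definition ev where "ev X = hm (Dual C X \<boxtimes> X) (Unit C) (Ev C X)"
definition cv where "cv X = hm (Unit C) (X \<boxtimes> Dual C X) (Coev C X)"

lemma dual_pair: "X \<in> Ob C \<Longrightarrow> is_dual_pair X (Dual C X) (ev X) (cv X)"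
  unfolding ev_def cv_def using is_dual_pair[OF _ _ left_dual] by simp

lemma is_pairing_ev: "X \<in> Ob C \<Longrightarrow> is_pairing (Dual C X) X (ev X)"
  and is_copairing_cv: "X \<in> Ob C \<Longrightarrow> is_copairing X (Dual C X) (cv X)"
  using dual_pair unfolding is_dual_pair_def by blast+

lemma ev_cv_simps [simp]:
  "dm (ev X) = Dual C X \<boxtimes> X" "cd (ev X) = Unit C" "dm (cv X) = Unit C" "cd (cv X) = X \<boxtimes> Dual C X"
  "X \<in> Ob C \<Longrightarrow> arr (ev X)" "X \<in> Ob C \<Longrightarrow> arr (cv X)"
  using is_pairing_ev is_copairing_cv by (auto simp: ev_def cv_def is_pairing_def is_copairing_def)

lemma the_mo_ev_cv: "the (mo (ev X)) = Ev C X" "the (mo (cv X)) = Coev C X"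
  by (simp_all add: ev_def cv_def)

lemma hm_dual_mor:
  assumes "X \<in> Ob C" "Y \<in> Ob C" "f \<in> Hom C X Y"
  shows "hm (Dual C Y) (Dual C X) (dual_mor X Y f) =
    mate_arr (Dual C Y) X (Dual C X) (ev Y \<bullet> (Dual C Y \<rhd> hm X Y f)) (cv X)"
  using assms by (intro hm_eqI) (simp_all add: mate_arr_def dual_mor_def mate_def the_mo the_mo_ev_cv)

lemma hm_Ev_tensor:
  assumes "X \<in> Ob C" "Y \<in> Ob C"
  shows "hm (Dual C Y \<boxtimes> Dual C X \<boxtimes> (X \<boxtimes> Y)) (Unit C) (Ev_tensor X Y) =
    tens_pairing (ev X) (Dual C X) X (ev Y) (Dual C Y) Y"
proof -
  have "hm (Dual C Y \<boxtimes> Dual C X \<boxtimes> (X \<boxtimes> Y)) (Unit C) (Ev_tensor X Y) = ev Y \<bullet> (Dual C Y \<rhd> ll Y) \<bullet>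
      (Dual C Y \<rhd> (ev X \<lhd> Y)) \<bullet> (Dual C Y \<rhd> ai (Dual C X) X Y) \<bullet> aa (Dual C Y) (Dual C X) (X \<boxtimes> Y)"
    using assms by (intro hm_eqI) (simp_all add: Ev_tensor_def Let_def the_mo the_mo_ev_cv)
  then show ?thesis using assms by (simp add: tens_pairing_def pairing_at_def lw_cmp)
qed

lemma hm_Coev_tensor:
  assumes "X \<in> Ob C" "Y \<in> Ob C"
  shows "hm (Unit C) (X \<boxtimes> Y \<boxtimes> (Dual C Y \<boxtimes> Dual C X)) (Coev_tensor X Y) =
    tens_copairing (cv X) X (Dual C X) (cv Y) Y (Dual C Y)"
proof -
  have "hm (Unit C) (X \<boxtimes> Y \<boxtimes> (Dual C Y \<boxtimes> Dual C X)) (Coev_tensor X Y) =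
    ai X Y (Dual C Y \<boxtimes> Dual C X) \<bullet> (X \<rhd> aa Y (Dual C Y) (Dual C X)) \<bullet>
    (X \<rhd> (cv Y \<lhd> Dual C X)) \<bullet> (X \<rhd> li (Dual C X)) \<bullet> cv X"
    using assms by (intro hm_eqI) (simp_all add: Coev_tensor_def Let_def the_mo the_mo_ev_cv)
  then show ?thesis using assms by (simp add: tens_copairing_def copairing_at_def lw_cmp)
qed

end

section \<open>Multiplicativity of dimensions\<close>

context fusion_category
begin

lemma scalar_Scl [simp]: "scalar (Scl C z (Idt C (Unit C))) = z"
  unfolding scalar_def using Idt_Unit_nonzero by auto

lemma scalar_eq:
  assumes "f \<in> Hom C (Unit C) (Unit C)"
  shows "f = Scl C (scalar f) (Idt C (Unit C))"
proof -
  obtain z where "f = Scl C z (Idt C (Unit C))"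
    using assms unfolding End_Unit span_singleton by blast
  then show ?thesis by simp
qed

lemma scl_ide_Unit_eq: "scl t (ide (Unit C)) = scl t' (ide (Unit C)) \<Longrightarrow> t = t'"
  using Idt_Unit_nonzero by (simp add: ide_hm scl_hm Idt_in_Hom)

end

context modular_tensor_category
begin

definition pv where "pv X = hm X (Dual C (Dual C X)) (Piv C X)"

lemma pv_simps [simp]:
  "dm (pv X) = X" "cd (pv X) = Dual C (Dual C X)" "X \<in> Ob C \<Longrightarrow> arr (pv X)"
  using Piv_iso unfolding pv_def is_iso_def by auto

definition cat_dim :: "'o \<Rightarrow> complex" where
  "cat_dim X = scalar (Ev C (Dual C X) \<cdot> (Piv C X \<star> Idt C (Dual C X)) \<cdot> Coev C X)"

lemma cat_dim_arrow:
  assumes X: "X \<in> Ob C"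
  shows "ev (Dual C X) \<bullet> (pv X \<lhd> Dual C X) \<bullet> cv X = scl (cat_dim X) (ide (Unit C))"
proof -
  let ?a = "ev (Dual C X) \<bullet> (pv X \<lhd> Dual C X) \<bullet> cv X"
  have a: "arr ?a" "dm ?a = Unit C" "cd ?a = Unit C" using X by simp_all
  have m: "the (mo ?a) = Ev C (Dual C X) \<cdot> (Piv C X \<star> Idt C (Dual C X)) \<cdot> Coev C X"
    using X by (simp add: the_mo the_mo_ev_cv) (simp add: pv_def)
  have "hm (Unit C) (Unit C) (Ev C (Dual C X) \<cdot> (Piv C X \<star> Idt C (Dual C X)) \<cdot> Coev C X) = ?a"
    by (rule hm_eqI[OF a m])
  then show ?thesis
    unfolding cat_dim_def using a scalar_eq
    by (metis Unit_in_Ob Idt_in_Hom arr_hm ide_hm scl_hm)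
qed

lemma cat_dim_ap:
  assumes X: "X \<in> Ob C" and W: "W \<in> Ob C"
  shows "pairing_at (ev (Dual C X)) (Dual C (Dual C X)) (Dual C X) W \<bullet> (pv X \<lhd> (Dual C X \<boxtimes> W)) \<bullet>
    copairing_at (cv X) X (Dual C X) W = scl (cat_dim X) (ide W)"
  using X W by (intro pairing_at_rw_copairing_at is_pairing_ev is_copairing_cv cat_dim_arrow) simp_all

lemma qtrace_Scl:
  assumes X: "X \<in> Ob C"
  shows "qtrace X (Scl C z (Idt C X)) = z * cat_dim X"
proof -
  let ?b = "ev (Dual C X) \<bullet> ((pv X \<bullet> scl z (ide X)) \<lhd> Dual C X) \<bullet> cv X"
  have "the (mo ?b) = Ev C (Dual C X) \<cdot> ((Piv C X \<cdot> Scl C z (Idt C X)) \<star> Idt C (Dual C X)) \<cdot> Coev C X"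
    using X by (simp add: the_mo the_mo_ev_cv del: cmp_scl cmp_ide rw_scl) (simp add: pv_def)
  moreover have "?b = scl (z * cat_dim X) (ide (Unit C))"
    using X cat_dim_arrow[OF X] by simp
  ultimately have "Ev C (Dual C X) \<cdot> ((Piv C X \<cdot> Scl C z (Idt C X)) \<star> Idt C (Dual C X)) \<cdot> Coev C X
      = Scl C (z * cat_dim X) (Idt C (Unit C))"
    by (metis the_mo(3,4) Unit_in_Ob arr_ide)
  then show ?thesis
    by (simp add: qtrace_def)
qed

lemma cat_dim_tens:
  assumes X: "X \<in> Ob C" and Y: "Y \<in> Ob C"
  shows "cat_dim (X \<boxtimes> Y) = cat_dim X * cat_dim Y"
proof -
  define X' where "X' = Dual C X"
  define Y' where "Y' = Dual C Y"
  define Z where "Z = X \<boxtimes> Y"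
  define P where "P = Dual C Z"
  define Q where "Q = Y' \<boxtimes> X'"
  define A where "A = Dual C X' \<boxtimes> Dual C Y'"
  let ?W = "Unit C"
  define E where "E = tens_pairing (ev Y') (Dual C Y') Y' (ev X') (Dual C X') X'"
  define K where "K = tens_copairing (cv X) X X' (cv Y) Y Y'"
  define \<psi> where "\<psi> = mate_arr P Z Q (ev Z) K"
  define \<phi> where "\<phi> = mate_arr A Q (Dual C Q) E (cv Q)"
  define \<delta> where "\<delta> = mate_arr (Dual C Q) P (Dual C P) (ev Q \<bullet> (Dual C Q \<rhd> \<psi>)) (cv P)"
  note defs = X'_def Y'_def Z_def P_def Q_def A_def
  have o: "X' \<in> Ob C" "Y' \<in> Ob C" "Z \<in> Ob C" "P \<in> Ob C" "Q \<in> Ob C" "A \<in> Ob C" "X \<boxtimes> Y \<in> Ob C"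
    using X Y by (simp_all add: defs)
  have E: "is_pairing A Q E"
    unfolding E_def A_def Q_def using o by (intro is_pairing_tens_pairing is_pairing_ev)
  have K: "is_copairing Z Q K"
    unfolding K_def Q_def Z_def X'_def Y'_def using X Y by (intro is_copairing_tens_copairing is_copairing_cv)
  have \<psi>: "arr \<psi>" "dm \<psi> = P" "cd \<psi> = Q"
    using K o is_pairing_ev[of Z] by (simp_all add: \<psi>_def P_def)
  have \<phi>: "arr \<phi>" "dm \<phi> = A" "cd \<phi> = Dual C Q"
    using E o is_copairing_cv[of Q] by (simp_all add: \<phi>_def)
  have q: "is_pairing (Dual C Q) P (ev Q \<bullet> (Dual C Q \<rhd> \<psi>))"
    using \<psi> o by (simp add: is_pairing_def)
  have \<delta>: "arr \<delta>" "dm \<delta> = Dual C Q" "cd \<delta> = Dual C P"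
    using q o is_copairing_cv[of P] by (simp_all add: \<delta>_def)
  have mem: "Ev_tensor Y' X' \<in> Hom C (A \<boxtimes> Q) (Unit C)" "Coev_tensor X Y \<in> Hom C (Unit C) (Z \<boxtimes> Q)"
    "Ev C Z \<in> Hom C (P \<boxtimes> Z) (Unit C)" "Coev C Q \<in> Hom C (Unit C) (Q \<boxtimes> Dual C Q)"
    using hm_Ev_tensor[of Y' X'] hm_Coev_tensor[of X Y] E K left_dual[of Z] left_dual[of Q] X Y o
    unfolding is_pairing_def is_copairing_def is_left_dual_def
    by (simp_all add: E_def K_def defs) (metis arr_hm)+
  have hm_psi: "hm P Q (dual_tensor_inv X Y) = \<psi>"
    using hm_mate[of P Z Q "Ev C Z" "Coev_tensor X Y"] mem o hm_Coev_tensor[OF X Y]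
    by (simp add: dual_tensor_inv_def \<psi>_def K_def defs ev_def)
  have hm_phi: "hm A (Dual C Q) (dual_tensor Y' X') = \<phi>"
    using hm_mate[of A Q "Dual C Q" "Ev_tensor Y' X'" "Coev C Q"] mem o hm_Ev_tensor[of Y' X']
    by (simp add: dual_tensor_def \<phi>_def E_def Q_def A_def cv_def)
  have hm_delta: "hm (Dual C Q) (Dual C P) (dual_mor P Q (dual_tensor_inv X Y)) = \<delta>"
    using hm_dual_mor[of P Q "dual_tensor_inv X Y"] hm_psi \<psi>(1) o unfolding \<delta>_def
    by (metis arr_hm)
  have pvZ: "pv Z = \<delta> \<bullet> \<phi> \<bullet> tens (pv X) (pv Y)"
  proof -
    have "hm Z (Dual C P) (Piv C Z) = (\<delta> \<bullet> \<phi>) \<bullet> tens (pv X) (pv Y)"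
    proof (rule hm_eqI)
      have "arr \<delta> \<and> arr \<phi> \<and> cd \<phi> = dm \<delta>" "arr (tens (pv X) (pv Y)) \<and> cd (tens (pv X) (pv Y)) = dm \<phi>"
        using \<delta> \<phi> X Y by (simp_all add: A_def X'_def Y'_def)
      then have "the (mo ((\<delta> \<bullet> \<phi>) \<bullet> tens (pv X) (pv Y))) =
          (the (mo \<delta>) \<cdot> the (mo \<phi>)) \<cdot> (the (mo (pv X)) \<star> the (mo (pv Y)))"
        using the_mo(1)[of "\<delta> \<bullet> \<phi>" "tens (pv X) (pv Y)"] the_mo(1)[of \<delta> \<phi>] the_mo(2)[of "pv X" "pv Y"]
        by (simp del: cmp_assoc)
      also have "\<dots> = Piv C Z"
        using Piv_monoidal[OF X Y] by (simp add: ddual_tensor_def pv_def defs flip: hm_delta hm_phi)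
      finally show "the (mo ((\<delta> \<bullet> \<phi>) \<bullet> tens (pv X) (pv Y))) = Piv C Z" .
    qed (use \<delta> \<phi> X Y o in \<open>simp_all add: A_def X'_def Y'_def Z_def\<close>)
    then show ?thesis by (simp add: pv_def P_def)
  qed
  have s1: "pairing_at (ev P) (Dual C P) P ?W \<bullet> (\<delta> \<lhd> (P \<boxtimes> ?W)) = pairing_at (ev Q) (Dual C Q) Q ?W \<bullet> (Dual C Q \<rhd> (\<psi> \<lhd> ?W))"
    unfolding \<delta>_def using pairing_at_mate_arr[OF dual_pair q] pairing_at_pre2[OF is_pairing_ev \<psi>(1,3)] \<psi>(2) o by simp
  have s2: "(Dual C Q \<rhd> (\<psi> \<lhd> ?W)) \<bullet> (\<phi> \<lhd> (P \<boxtimes> ?W)) = (\<phi> \<lhd> (Q \<boxtimes> ?W)) \<bullet> (A \<rhd> (\<psi> \<lhd> ?W))"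
    using \<psi> \<phi> o by (intro interchange) auto
  have s3: "(A \<rhd> (\<psi> \<lhd> ?W)) \<bullet> (tens (pv X) (pv Y) \<lhd> (P \<boxtimes> ?W))
      = (tens (pv X) (pv Y) \<lhd> (Q \<boxtimes> ?W)) \<bullet> (Z \<rhd> (\<psi> \<lhd> ?W))"
    using \<psi> X Y o by (intro interchange) (auto simp: defs)
  have s4: "(Z \<rhd> (\<psi> \<lhd> ?W)) \<bullet> copairing_at (cv Z) Z P ?W = copairing_at K Z Q ?W"
    unfolding \<psi>_def P_def using K o by (intro mate_arr_copairing dual_pair) auto
  have s5: "pairing_at (ev Q) (Dual C Q) Q ?W \<bullet> (\<phi> \<lhd> (Q \<boxtimes> ?W)) = pairing_at E A Q ?W"
    unfolding \<phi>_def using E o by (intro pairing_at_mate_arr dual_pair) auto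
  have s6: "pairing_at E A Q ?W \<bullet> (tens (pv X) (pv Y) \<lhd> (Q \<boxtimes> ?W)) \<bullet> copairing_at K Z Q ?W = scl (cat_dim X * cat_dim Y) (ide ?W)"
    unfolding E_def K_def A_def Q_def Z_def X'_def Y'_def using X Y
    by (intro trace_tens is_pairing_ev is_copairing_cv cat_dim_arrow) simp_all
  have "scl (cat_dim Z) (ide ?W) = pairing_at (ev P) (Dual C P) P ?W \<bullet> (pv Z \<lhd> (P \<boxtimes> ?W)) \<bullet> copairing_at (cv Z) Z P ?W"
    using cat_dim_ap[of Z ?W] o by (simp add: P_def)
  also have "pv Z \<lhd> (P \<boxtimes> ?W) = (\<delta> \<lhd> (P \<boxtimes> ?W)) \<bullet> (\<phi> \<lhd> (P \<boxtimes> ?W)) \<bullet> (tens (pv X) (pv Y) \<lhd> (P \<boxtimes> ?W))"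
    using pvZ \<delta> \<phi> X Y o by (simp add: rw_cmp A_def X'_def Y'_def)
  also have "pairing_at (ev P) (Dual C P) P ?W \<bullet> (\<dots>) \<bullet> copairing_at (cv Z) Z P ?W
    = pairing_at E A Q ?W \<bullet> (tens (pv X) (pv Y) \<lhd> (Q \<boxtimes> ?W)) \<bullet> copairing_at K Z Q ?W"
    by (simp add: cmp_pre[OF s1] cmp_pre[OF s2] cmp_pre[OF s3] s4 cmp_pre[OF s5])
  finally show ?thesis
    using s6 scl_ide_Unit_eq unfolding Z_def by metis
qed

lemma cat_dim_iso:
  assumes X: "X \<in> Ob C" and Y: "Y \<in> Ob C" and iso: "isomorphic X Y"
  shows "cat_dim X = cat_dim Y"
proof -
  obtain f g where fg: "f \<in> Hom C X Y" "g \<in> Hom C Y X" "g \<cdot> f = Idt C X" "f \<cdot> g = Idt C Y"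
    using iso unfolding isomorphic_def is_iso_def by blast
  let ?W = "Unit C"
  define X' where "X' = Dual C X"
  define Y' where "Y' = Dual C Y"
  define F where "F = hm X Y f"
  define G where "G = hm Y X g"
  have F: "arr F" "dm F = X" "cd F = Y" and G: "arr G" "dm G = Y" "cd G = X"
    using fg X Y by (simp_all add: F_def G_def)
  have GF: "G \<bullet> F = ide X" and FG: "F \<bullet> G = ide Y"
    using fg X Y by (simp_all add: F_def G_def cmp_hm ide_hm)
  have o: "X' \<in> Ob C" "Y' \<in> Ob C" using X Y by (simp_all add: X'_def Y'_def)
  define G' where "G' = mate_arr X' Y Y' (ev X \<bullet> (X' \<rhd> G)) (cv Y)"
  have pG: "is_pairing X' Y (ev X \<bullet> (X' \<rhd> G))"
    using G o X Y unfolding is_pairing_def by (simp add: X'_def)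
  have G': "arr G'" "dm G' = X'" "cd G' = Y'" "G' = hm X' Y' (dual_mor Y X g)"
    using pG is_copairing_cv[OF Y] hm_dual_mor[OF Y X fg(2)]
    by (simp_all add: G'_def X'_def Y'_def G_def)
  have slide: "(X \<rhd> (G' \<lhd> ?W)) \<bullet> copairing_at (cv X) X X' ?W = (G \<lhd> (Y' \<boxtimes> ?W)) \<bullet> copairing_at (cv Y) Y Y' ?W"
  proof -
    have "G' = mate_arr X' X Y' (ev X) ((G \<lhd> Y') \<bullet> cv Y)"
      unfolding G'_def using mate_arr_slide[OF is_pairing_ev[OF X] is_copairing_cv[OF Y] G]
      by (simp add: X'_def Y'_def)
    moreover have "is_copairing X Y' ((G \<lhd> Y') \<bullet> cv Y)"
      using G o X Y unfolding is_copairing_def by (simp add: Y'_def)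
    ultimately show ?thesis
      using mate_arr_copairing[OF dual_pair[OF X], of Y' "(G \<lhd> Y') \<bullet> cv Y" ?W]
        copairing_at_post[OF is_copairing_cv[OF Y] G, of ?W] by (simp add: X'_def Y'_def)
  qed
  define G'' where "G'' = mate_arr (Dual C Y') X' (Dual C X') (ev Y' \<bullet> (Dual C Y' \<rhd> G')) (cv X')"
  have pG': "is_pairing (Dual C Y') X' (ev Y' \<bullet> (Dual C Y' \<rhd> G'))"
    using G' o unfolding is_pairing_def by simp
  have G'': "arr G''" "dm G'' = Dual C Y'" "cd G'' = Dual C X'"
    using pG' is_copairing_cv[OF o(1)] by (simp_all add: G''_def)
  have hm_G'': "G'' = hm (Dual C Y') (Dual C X') (dual_mor X' Y' (dual_mor Y X g))"
    using hm_dual_mor[OF o(1,2), of "dual_mor Y X g"] G' o unfolding G''_def by (metis arr_hm)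
  have nat: "pv X \<bullet> G = G'' \<bullet> pv Y"
  proof -
    have "hm Y (Dual C X') (Piv C X \<cdot> g) = pv X \<bullet> G"
      using X Y G by (intro hm_eqI) (simp_all add: the_mo X'_def, simp add: pv_def G_def)
    moreover have "hm Y (Dual C X') (Piv C X \<cdot> g) = G'' \<bullet> pv Y"
      using Piv_natural[OF Y X fg(2)] X Y G'' hm_G''
      by (intro hm_eqI) (simp_all add: the_mo Y'_def, simp add: pv_def X'_def)
    ultimately show ?thesis by simp
  qed
  have pull: "pairing_at (ev X') (Dual C X') X' ?W \<bullet> (G'' \<lhd> (X' \<boxtimes> ?W))
      = pairing_at (ev Y') (Dual C Y') Y' ?W \<bullet> (Dual C Y' \<rhd> (G' \<lhd> ?W))"
    unfolding G''_def using pairing_at_mate_arr[OF dual_pair[OF o(1)] pG', of ?W]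
      pairing_at_pre2[OF is_pairing_ev[OF o(2)] G'(1,3), of ?W] G'(2) by simp
  have i1: "(Dual C Y' \<rhd> (G' \<lhd> ?W)) \<bullet> (pv Y \<lhd> (X' \<boxtimes> ?W)) = (pv Y \<lhd> (Y' \<boxtimes> ?W)) \<bullet> (Y \<rhd> (G' \<lhd> ?W))"
    using G' o Y by (intro interchange) (auto simp: Y'_def)
  have i2: "(Y \<rhd> (G' \<lhd> ?W)) \<bullet> (F \<lhd> (X' \<boxtimes> ?W)) = (F \<lhd> (Y' \<boxtimes> ?W)) \<bullet> (X \<rhd> (G' \<lhd> ?W))"
    using G' o F by (intro interchange) auto
  have FG_rw: "(F \<lhd> (Y' \<boxtimes> ?W)) \<bullet> (G \<lhd> (Y' \<boxtimes> ?W)) = ide (Y \<boxtimes> (Y' \<boxtimes> ?W))"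
    using F G o Y FG by (simp flip: rw_cmp)
  have "pv X = G'' \<bullet> pv Y \<bullet> F"
    using GF cmp_pre[OF nat, of F] X by simp
  then have "scl (cat_dim X) (ide ?W) = pairing_at (ev X') (Dual C X') X' ?W \<bullet> (G'' \<lhd> (X' \<boxtimes> ?W)) \<bullet>
      (pv Y \<lhd> (X' \<boxtimes> ?W)) \<bullet> (F \<lhd> (X' \<boxtimes> ?W)) \<bullet> copairing_at (cv X) X X' ?W"
    using cat_dim_ap[OF X, of ?W] G'' F o Y by (simp add: X'_def Y'_def rw_cmp)
  also have "\<dots> = pairing_at (ev Y') (Dual C Y') Y' ?W \<bullet> (pv Y \<lhd> (Y' \<boxtimes> ?W)) \<bullet> (F \<lhd> (Y' \<boxtimes> ?W)) \<bullet>
      (G \<lhd> (Y' \<boxtimes> ?W)) \<bullet> copairing_at (cv Y) Y Y' ?W"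
    by (simp add: cmp_pre[OF pull] cmp_pre[OF i1] cmp_pre[OF i2] slide)
  also have "\<dots> = scl (cat_dim Y) (ide ?W)"
    using cat_dim_ap[OF Y, of ?W] is_copairing_cv[OF Y] by (simp add: cmp_pre[OF FG_rw[unfolded Y'_def]] Y'_def Y)
  finally show ?thesis by (rule scl_ide_Unit_eq)
qed

lemma cat_dim_Dual: "X \<in> Ob C \<Longrightarrow> cat_dim (Dual C X) = cat_dim X"
  using spherical unfolding cat_dim_def by simp

end

section \<open>Simple objects\<close>

context linear_category
begin

lemma zero_in_Hom [simp]: "X \<in> Ob C \<Longrightarrow> Y \<in> Ob C \<Longrightarrow> 0 \<in> Hom C X Y"
  using subspace_Hom subspace_0 by blast

lemma add_in_Hom: "\<lbrakk>X \<in> Ob C; Y \<in> Ob C; f \<in> Hom C X Y; g \<in> Hom C X Y\<rbrakk> \<Longrightarrow> f + g \<in> Hom C X Y"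
  using subspace_Hom subspace_add by blast

lemma diff_in_Hom: "\<lbrakk>X \<in> Ob C; Y \<in> Ob C; f \<in> Hom C X Y; g \<in> Hom C X Y\<rbrakk> \<Longrightarrow> f - g \<in> Hom C X Y"
  using subspace_Hom subspace_diff by blast

lemma Cmp_zero_right: "\<lbrakk>X \<in> Ob C; Y \<in> Ob C; Z \<in> Ob C; g \<in> Hom C Y Z\<rbrakk> \<Longrightarrow> g \<cdot> 0 = 0"
  using Cmp_Scl_right[of X Y Z 0 g 0] by simp

lemma Cmp_zero_left: "\<lbrakk>X \<in> Ob C; Y \<in> Ob C; Z \<in> Ob C; f \<in> Hom C X Y\<rbrakk> \<Longrightarrow> 0 \<cdot> f = 0"
  using Cmp_Scl_left[of X Y Z f 0 0] by simp

lemma Cmp_diff_right: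
  "\<lbrakk>X \<in> Ob C; Y \<in> Ob C; Z \<in> Ob C; f \<in> Hom C X Y; f' \<in> Hom C X Y; g \<in> Hom C Y Z\<rbrakk>
    \<Longrightarrow> g \<cdot> (f - f') = (g \<cdot> f) - (g \<cdot> f')"
  using Cmp_add_right[of X Y Z "f - f'" f' g] by (simp add: diff_in_Hom)

lemma is_zero_object_iff:
  assumes X: "X \<in> Ob C"
  shows "is_zero_object X \<longleftrightarrow> Idt C X = 0"
proof
  assume "is_zero_object X"
  then show "Idt C X = 0" using X Idt_in_Hom unfolding is_zero_object_def by blast
next
  assume z: "Idt C X = 0"
  have "Hom C W X = {0} \<and> Hom C X W = {0}" if W: "W \<in> Ob C" for W
  proof -
    have "f = 0" if "f \<in> Hom C W X" for f
      using Idt_Cmp[OF W X that] Cmp_zero_left[OF W X X that] z by simp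
    moreover have "f = 0" if "f \<in> Hom C X W" for f
      using Cmp_Idt[OF X W that] Cmp_zero_right[OF X X W that] z by simp
    ultimately show ?thesis using X W zero_in_Hom by blast
  qed
  then show "is_zero_object X" using X unfolding is_zero_object_def by blast
qed

lemma simple_Ob: "simple X \<Longrightarrow> X \<in> Ob C"
  unfolding simple_def by blast

lemma simple_Idt_nonzero: "simple X \<Longrightarrow> Idt C X \<noteq> 0"
  using is_zero_object_iff unfolding simple_def by blast

lemma isomorphic_arrow:
  assumes "X \<in> Ob C" "Y \<in> Ob C"
  shows "isomorphic X Y \<longleftrightarrow> (\<exists>f g. arr f \<and> dm f = X \<and> cd f = Y \<and> arr g \<and> dm g = Y \<and> cd g = X \<and>
    g \<bullet> f = ide X \<and> f \<bullet> g = ide Y)" (is "_ \<longleftrightarrow> ?R")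
proof
  assume "isomorphic X Y"
  then obtain f g where "f \<in> Hom C X Y" "g \<in> Hom C Y X" "g \<cdot> f = Idt C X" "f \<cdot> g = Idt C Y"
    unfolding isomorphic_def is_iso_def by blast
  then show ?R
    using assms by (intro exI[of _ "hm X Y f"] exI[of _ "hm Y X g"]) (simp add: cmp_hm ide_hm)
next
  assume ?R
  then obtain f g where "hm Y X g \<bullet> hm X Y f = ide X" "hm X Y f \<bullet> hm Y X g = ide Y"
    "f \<in> Hom C X Y" "g \<in> Hom C Y X"
    by (auto elim!: arrE)
  then show "isomorphic X Y"
    using assms unfolding isomorphic_def is_iso_def by (auto simp: cmp_hm ide_hm)
qed

lemma isomorphicI:
  "\<lbrakk>arr f; arr g; dm f = X; cd f = Y; g \<bullet> f = ide X; f \<bullet> g = ide Y\<rbrakk> \<Longrightarrow> isomorphic X Y"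
  using isomorphic_arrow[of X Y] arr_ob by (metis dm_cmp cd_cmp dm_ide cd_ide)

lemma isomorphicE:
  assumes "isomorphic X Y" "X \<in> Ob C" "Y \<in> Ob C"
  obtains f g where "arr f" "dm f = X" "cd f = Y" "arr g" "dm g = Y" "cd g = X"
    "g \<bullet> f = ide X" "f \<bullet> g = ide Y"
  using isomorphic_arrow[OF assms(2,3)] assms(1) by metis

lemma isomorphic_refl: "X \<in> Ob C \<Longrightarrow> isomorphic X X"
  by (rule isomorphicI[of "ide X" "ide X"]) simp_all

lemma isomorphic_sym: "\<lbrakk>isomorphic X Y; X \<in> Ob C; Y \<in> Ob C\<rbrakk> \<Longrightarrow> isomorphic Y X"
  by (erule isomorphicE) (auto intro: isomorphicI)

lemma isomorphic_trans:
  assumes "isomorphic X Y" "isomorphic Y Z" "X \<in> Ob C" "Y \<in> Ob C" "Z \<in> Ob C"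
  shows "isomorphic X Z"
proof -
  obtain f g where f: "arr f" "dm f = X" "cd f = Y" "arr g" "dm g = Y" "cd g = X"
    "g \<bullet> f = ide X" "f \<bullet> g = ide Y" using isomorphicE[OF assms(1,3,4)] .
  obtain h k where h: "arr h" "dm h = Y" "cd h = Z" "arr k" "dm k = Z" "cd k = Y"
    "k \<bullet> h = ide Y" "h \<bullet> k = ide Z" using isomorphicE[OF assms(2,4,5)] .
  show ?thesis
    by (rule isomorphicI[of "h \<bullet> f" "g \<bullet> k"]) (use f h cmp_pre[OF h(7)] cmp_pre[OF f(8)] in simp_all)
qed

lemma simple_iso:
  assumes Y: "simple Y" and X: "X \<in> Ob C" and iso: "isomorphic X Y"
  shows "simple X"
proof -
  note YO = simple_Ob[OF Y]
  obtain f g where fg: "f \<in> Hom C X Y" "g \<in> Hom C Y X" "g \<cdot> f = Idt C X" "f \<cdot> g = Idt C Y"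
    using iso unfolding isomorphic_def is_iso_def by blast
  have "Idt C X \<noteq> 0"
  proof
    assume z: "Idt C X = 0"
    have "f = 0" using Cmp_Idt[OF X YO fg(1)] Cmp_zero_right[OF X X YO fg(1)] z by simp
    then have "Idt C Y = 0" using fg(4) Cmp_zero_left[OF YO X YO fg(2)] by simp
    then show False using simple_Idt_nonzero[OF Y] by simp
  qed
  moreover have "is_zero_object Z \<or> is_iso Z X i" if Z: "Z \<in> Ob C" and i: "is_mono Z X i" for Z i
  proof -
    have iH: "i \<in> Hom C Z X" using i unfolding is_mono_def by blast
    have gfi: "g \<cdot> (f \<cdot> i) = i"
      using Cmp_assoc[OF Z X YO X iH fg(1,2)] Idt_Cmp[OF Z X iH] fg(3) by simp
    have "is_mono Z Y (f \<cdot> i)"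
      unfolding is_mono_def
    proof (intro conjI ballI impI)
      show "f \<cdot> i \<in> Hom C Z Y" using Cmp_in_Hom[OF Z X YO iH fg(1)] .
      fix W a b assume W: "W \<in> Ob C" and ab: "a \<in> Hom C W Z" "b \<in> Hom C W Z"
        and eq: "(f \<cdot> i) \<cdot> a = (f \<cdot> i) \<cdot> b"
      have fiH: "f \<cdot> i \<in> Hom C Z Y" using Cmp_in_Hom[OF Z X YO iH fg(1)] .
      have "i \<cdot> a = i \<cdot> b"
        using Cmp_assoc[OF W Z YO X ab(1) fiH fg(2)] Cmp_assoc[OF W Z YO X ab(2) fiH fg(2)] eq gfi
        by simp
      then show "a = b" using i W ab unfolding is_mono_def by blast
    qed
    then consider "is_zero_object Z" | "is_iso Z Y (f \<cdot> i)" using Y Z unfolding simple_def by blast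
    then show ?thesis
    proof cases
      case 2
      then have "\<exists>k. k \<in> Hom C Y Z \<and> k \<cdot> (f \<cdot> i) = Idt C Z \<and> (f \<cdot> i) \<cdot> k = Idt C Y"
        unfolding is_iso_def by blast
      then obtain k where k: "k \<in> Hom C Y Z" "k \<cdot> (f \<cdot> i) = Idt C Z" "(f \<cdot> i) \<cdot> k = Idt C Y" by blast
      have "(k \<cdot> f) \<cdot> i = Idt C Z" using Cmp_assoc[OF Z X YO Z iH fg(1) k(1)] k(2) by simp
      moreover have "i \<cdot> (k \<cdot> f) = Idt C X"
      proof -
        have "i \<cdot> k = g"
          using Cmp_assoc[OF YO Z YO X k(1) Cmp_in_Hom[OF Z X YO iH fg(1)] fg(2)] k(3) gfi
            Cmp_Idt[OF YO X fg(2)] by simp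
        then show ?thesis using Cmp_assoc[OF X YO Z X fg(1) k(1) iH] fg(3) by simp
      qed
      ultimately show ?thesis
        using iH Cmp_in_Hom[OF X YO Z fg(1) k(1)] unfolding is_iso_def by blast
    qed blast
  qed
  ultimately show ?thesis
    using X is_zero_object_iff unfolding simple_def by blast
qed

end

context abelian_category
begin

lemma schur:
  assumes X: "simple X" and Y: "simple Y" and f: "f \<in> Hom C X Y" "f \<noteq> 0"
  shows "is_iso X Y f"
proof -
  note XO = simple_Ob[OF X] and YO = simple_Ob[OF Y]
  obtain K k where K: "K \<in> Ob C" and k: "is_kernel K X Y k f"
    using kernel_ex[OF XO YO f(1)] by blast
  have kH: "k \<in> Hom C K X" and fk: "f \<cdot> k = 0"
    and univ: "\<And>W g. W \<in> Ob C \<Longrightarrow> g \<in> Hom C W X \<Longrightarrow> f \<cdot> g = 0 \<Longrightarrow> \<exists>!h. h \<in> Hom C W K \<and> k \<cdot> h = g"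
    using k unfolding is_kernel_def by blast+
  have "is_mono K X k"
    unfolding is_mono_def
  proof (intro conjI ballI impI kH)
    fix W a b assume W: "W \<in> Ob C" and ab: "a \<in> Hom C W K" "b \<in> Hom C W K" and eq: "k \<cdot> a = k \<cdot> b"
    have "f \<cdot> (k \<cdot> a) = 0"
      using Cmp_assoc[OF W K XO YO ab(1) kH f(1)] fk Cmp_zero_left[OF W K YO ab(1)] by simp
    then show "a = b" using univ[OF W Cmp_in_Hom[OF W K XO ab(1) kH]] ab eq by metis
  qed
  then consider "is_zero_object K" | "is_iso K X k" using X K unfolding simple_def by blast
  then have Kz: "is_zero_object K"
  proof cases
    case 2
    then obtain l where l: "l \<in> Hom C X K" "k \<cdot> l = Idt C X" unfolding is_iso_def by blast
    have "f = f \<cdot> (k \<cdot> l)" using l Cmp_Idt[OF XO YO f(1)] by simp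
    also have "\<dots> = 0"
      using Cmp_assoc[OF XO K XO YO l(1) kH f(1)] fk Cmp_zero_left[OF XO K YO l(1)] by simp
    finally show ?thesis using f(2) by simp
  qed
  have "is_mono X Y f"
    unfolding is_mono_def
  proof (intro conjI ballI impI f(1))
    fix W a b assume W: "W \<in> Ob C" and ab: "a \<in> Hom C W X" "b \<in> Hom C W X" and eq: "f \<cdot> a = f \<cdot> b"
    have "f \<cdot> (a - b) = 0" using Cmp_diff_right[OF W XO YO ab f(1)] eq by simp
    then obtain h where h: "h \<in> Hom C W K" "k \<cdot> h = a - b"
      using univ[OF W diff_in_Hom[OF W XO ab]] by blast
    have "h = 0" using Kz W h(1) unfolding is_zero_object_def by blast
    then show "a = b" using h(2) Cmp_zero_right[OF W K XO kH] by simp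
  qed
  then show ?thesis using X Y XO unfolding simple_def by blast
qed

end

context fusion_category
begin

lemma polynomial_annihilator:
  assumes X: "X \<in> Ob C" and f: "f \<in> Hom C X X"
  obtains \<Phi> :: "complex poly \<Rightarrow> 'm" where "\<Phi> 0 = 0"
    "\<And>a p. \<Phi> (pCons a p) = Scl C a (Idt C X) + (f \<cdot> \<Phi> p)" "\<And>p. \<Phi> p \<in> Hom C X X"
    "\<And>p q. \<Phi> (p + q) = \<Phi> p + \<Phi> q" "\<And>a p. \<Phi> (smult a p) = Scl C a (\<Phi> p)"
    "\<exists>p. p \<noteq> 0 \<and> \<Phi> p = 0"
proof -
  define \<Phi> where "\<Phi> = (\<lambda>p :: complex poly. fold_coeffs (\<lambda>a r. Scl C a (Idt C X) + (f \<cdot> r)) p 0)"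
  have rec: "\<Phi> (pCons a p) = Scl C a (Idt C X) + (f \<cdot> \<Phi> p)" for a p
    unfolding \<Phi>_def using Cmp_zero_right[OF X X X f]
    by (cases "p = 0 \<and> a = 0") (auto simp: fold_coeffs_pCons_not_0_0_eq fold_coeffs_pCons_coeff_not_0_eq)
  have zero: "\<Phi> 0 = 0" unfolding \<Phi>_def by simp
  have H: "\<Phi> p \<in> Hom C X X" for p
    by (induction p) (auto simp: rec zero X f Cmp_in_Hom[OF X X X] Idt_in_Hom Scl_in_Hom intro!: add_in_Hom)
  have add: "\<Phi> (p + q) = \<Phi> p + \<Phi> q" for p q
    by (induction p q rule: poly_induct2)
      (auto simp: rec zero X f H Cmp_add_right[OF X X X] scale_left_distrib)
  have smult: "\<Phi> (smult a p) = Scl C a (\<Phi> p)" for a p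
    by (induction p) (auto simp: rec zero X f H Cmp_Scl_right[OF X X X] scale_right_distrib)
  have sum: "\<Phi> (\<Sum>i\<in>I. q i) = (\<Sum>i\<in>I. \<Phi> (q i))" for I and q :: "nat \<Rightarrow> complex poly"
    by (induction I rule: infinite_finite_induct) (auto simp: add zero)
  obtain B where B: "finite B" "span B = Hom C X X" using Hom_finite_dim[OF X X] by blast
  let ?g = "\<lambda>i. \<Phi> (monom 1 i)" and ?I = "{..card B}"
  have ann: "\<exists>p. p \<noteq> 0 \<and> \<Phi> p = 0"
  proof (cases "inj_on ?g ?I")
    case False
    then obtain i j where ij: "i \<noteq> j" "?g i = ?g j" by (auto simp: inj_on_def)
    have "\<Phi> (monom 1 i + smult (-1) (monom 1 j)) = 0"
      unfolding add smult using ij by simp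
    moreover have "coeff (monom 1 i + smult (-1) (monom 1 j) :: complex poly) i = 1"
      using ij by simp
    then have "monom 1 i + smult (-1) (monom 1 j) \<noteq> (0 :: complex poly)"
      by (metis coeff_0 one_neq_zero)
    ultimately show ?thesis by blast
  next
    case True
    have "dependent (?g ` ?I)"
    proof (rule ccontr)
      assume "\<not> ?thesis"
      then have "card (?g ` ?I) \<le> card B"
        using independent_span_bound[OF B(1)] B(2) H by auto
      then show False using card_image[OF True] by simp
    qed
    then obtain u i where u: "i \<in> ?I" "u (?g i) \<noteq> 0" "(\<Sum>v\<in>?g ` ?I. Scl C (u v) v) = 0"
      using dependent_finite[of "?g ` ?I"] by auto
    define p where "p = (\<Sum>i\<in>?I. smult (u (?g i)) (monom 1 i))"
    have "\<Phi> p = 0"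
      using u(3) by (simp add: p_def sum smult sum.reindex[OF True])
    moreover have "coeff p i = u (?g i)"
      using u(1) unfolding p_def by (simp add: coeff_sum if_distrib cong: if_cong)
    then have "p \<noteq> 0" using u(2) by auto
    ultimately show ?thesis by blast
  qed
  show thesis by (rule that[OF zero rec H add smult ann])
qed

lemma End_simple:
  assumes X: "simple X" and f: "f \<in> Hom C X X"
  shows "\<exists>z. f = Scl C z (Idt C X)"
proof -
  note XO = simple_Ob[OF X]
  obtain \<Phi> :: "complex poly \<Rightarrow> 'm" where zero: "\<Phi> 0 = 0"
    and \<Phi>: "\<And>a p. \<Phi> (pCons a p) = Scl C a (Idt C X) + (f \<cdot> \<Phi> p)" "\<And>p. \<Phi> p \<in> Hom C X X"
      "\<And>p q. \<Phi> (p + q) = \<Phi> p + \<Phi> q" "\<And>a p. \<Phi> (smult a p) = Scl C a (\<Phi> p)"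
      "\<exists>p. p \<noteq> 0 \<and> \<Phi> p = 0"
    by (rule polynomial_annihilator[OF XO f]) (rule that)
  obtain p\<^sub>0 where p\<^sub>0: "p\<^sub>0 \<noteq> 0 \<and> \<Phi> p\<^sub>0 = 0" using \<Phi>(5) by (elim exE)
  have "\<exists>p. (p \<noteq> 0 \<and> \<Phi> p = 0) \<and> (\<forall>q. q \<noteq> 0 \<and> \<Phi> q = 0 \<longrightarrow> degree p \<le> degree q)"
    by (rule ex_has_least_nat[where P = "\<lambda>p. p \<noteq> 0 \<and> \<Phi> p = 0", OF p\<^sub>0])
  then obtain p where p: "p \<noteq> 0" "\<Phi> p = 0" and min: "\<And>q. q \<noteq> 0 \<Longrightarrow> \<Phi> q = 0 \<Longrightarrow> degree p \<le> degree q"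
    by (elim exE conjE) simp
  have "degree p \<noteq> 0"
  proof
    assume "degree p = 0"
    then obtain c where c: "p = [:c:]" by (meson degree_eq_zeroE)
    then have "Scl C c (Idt C X) = 0" using p(2) \<Phi>(1)[of c 0] zero Cmp_zero_right[OF XO XO XO f] by simp
    then show False using p(1) c simple_Idt_nonzero[OF X] by simp
  qed
  then obtain a where "poly p a = 0"
    using fundamental_theorem_of_algebra[of p] by (auto simp: constant_degree)
  then obtain q where q: "p = [:- a, 1:] * q" by (metis dvdE poly_eq_0_iff_dvd)
  have q0: "q \<noteq> 0" using p q by auto
  have "degree q < degree p"
    unfolding q using q0 by (subst degree_mult_eq) auto
  then have \<Phi>q: "\<Phi> q \<noteq> 0" using min[OF q0] by fastforce
  let ?h = "f - Scl C a (Idt C X)"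
  have aH: "Scl C a (Idt C X) \<in> Hom C X X" using XO by (simp add: Scl_in_Hom Idt_in_Hom)
  have h: "?h \<in> Hom C X X" using diff_in_Hom[OF XO XO f aH] .
  have "p = pCons 0 q + smult (- a) q" unfolding q by simp
  then have "\<Phi> p = (f \<cdot> \<Phi> q) - Scl C a (\<Phi> q)"
    by (simp only: \<Phi>(3,4)) (simp add: \<Phi>(1))
  also have "\<dots> = ?h \<cdot> \<Phi> q"
    using Cmp_add_left[OF XO XO XO \<Phi>(2)[of q] h aH] Cmp_Scl_left[OF XO XO XO \<Phi>(2)[of q] Idt_in_Hom[OF XO], of a]
      Idt_Cmp[OF XO XO \<Phi>(2)[of q]] by (simp add: algebra_simps)
  finally have hq: "?h \<cdot> \<Phi> q = 0" using p(2) by simp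
  have "?h = 0"
  proof (rule ccontr)
    assume "?h \<noteq> 0"
    then obtain k where k: "k \<in> Hom C X X" "k \<cdot> ?h = Idt C X"
      using schur[OF X X h] unfolding is_iso_def by blast
    have "\<Phi> q = (k \<cdot> ?h) \<cdot> \<Phi> q" using Idt_Cmp[OF XO XO \<Phi>(2)[of q]] k(2) by simp
    also have "\<dots> = 0"
      using Cmp_assoc[OF XO XO XO XO \<Phi>(2)[of q] h k(1)] hq Cmp_zero_right[OF XO XO XO k(1)] by simp
    finally show False using \<Phi>q by simp
  qed
  then show ?thesis by auto
qed

lemma simple_summand:
  fixes \<Theta> :: "'m \<Rightarrow> 'b::ab_group_add"
  assumes X: "X \<in> Ob C"
    and add: "\<And>f g. f \<in> Hom C X X \<Longrightarrow> g \<in> Hom C X X \<Longrightarrow> \<Theta> (f + g) = \<Theta> f + \<Theta> g"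
    and nz: "\<Theta> (Idt C X) \<noteq> 0"
  obtains S \<iota> \<pi> where "simple S" "\<iota> \<in> Hom C S X" "\<pi> \<in> Hom C X S" "\<pi> \<cdot> \<iota> = Idt C S" "\<Theta> (\<iota> \<cdot> \<pi>) \<noteq> 0"
proof -
  obtain Ys where Ys: "\<And>Y. Y \<in> set Ys \<Longrightarrow> simple Y" "is_direct_sum X Ys" using semisimple[OF X] by blast
  obtain \<iota> \<pi> where ip: "\<And>k. k < length Ys \<Longrightarrow> \<iota> k \<in> Hom C (Ys ! k) X \<and> \<pi> k \<in> Hom C X (Ys ! k)"
    "\<And>k l. k < length Ys \<Longrightarrow> l < length Ys \<Longrightarrow> \<pi> k \<cdot> \<iota> l = (if k = l then Idt C (Ys ! k) else 0)"
    "(\<Sum>k<length Ys. \<iota> k \<cdot> \<pi> k) = Idt C X"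
    using Ys(2) unfolding is_direct_sum_def by blast
  have H: "\<iota> k \<cdot> \<pi> k \<in> Hom C X X" if "k < length Ys" for k
    using ip(1)[OF that] Cmp_in_Hom[OF X simple_Ob X] Ys(1) that by (meson nth_mem)
  have z: "\<Theta> 0 = 0" using add[of 0 0] X by simp
  have "(\<Sum>k\<in>I. \<iota> k \<cdot> \<pi> k) \<in> Hom C X X \<and> \<Theta> (\<Sum>k\<in>I. \<iota> k \<cdot> \<pi> k) = (\<Sum>k\<in>I. \<Theta> (\<iota> k \<cdot> \<pi> k))"
    if "finite I" "I \<subseteq> {..<length Ys}" for I
    using that
    by (induction I rule: finite_induct) (auto simp: z X H add add_in_Hom)
  from this[of "{..<length Ys}"] have "(\<Sum>k<length Ys. \<Theta> (\<iota> k \<cdot> \<pi> k)) \<noteq> 0"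
    using nz ip(3) by simp
  then obtain k where k: "k < length Ys" "\<Theta> (\<iota> k \<cdot> \<pi> k) \<noteq> 0"
    by (metis (no_types, lifting) lessThan_iff sum.neutral)
  show ?thesis
    by (rule that[of "Ys ! k" "\<iota> k" "\<pi> k"]) (use k ip Ys(1) in auto)
qed

lemma simpleI:
  assumes X: "X \<in> Ob C" and nz: "Idt C X \<noteq> 0"
    and End: "\<And>f. f \<in> Hom C X X \<Longrightarrow> \<exists>z. f = Scl C z (Idt C X)"
  shows "simple X"
proof -
  obtain S \<iota> \<pi> where S: "simple S" "\<iota> \<in> Hom C S X" "\<pi> \<in> Hom C X S" "\<pi> \<cdot> \<iota> = Idt C S" "\<iota> \<cdot> \<pi> \<noteq> 0"
    using simple_summand[OF X, of "\<lambda>f. f"] nz by auto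
  note SO = simple_Ob[OF S(1)]
  have ipH: "\<iota> \<cdot> \<pi> \<in> Hom C X X" using Cmp_in_Hom[OF X SO X S(3,2)] .
  obtain z where z: "\<iota> \<cdot> \<pi> = Scl C z (Idt C X)" using End[OF ipH] by blast
  have "(\<iota> \<cdot> \<pi>) \<cdot> (\<iota> \<cdot> \<pi>) = \<iota> \<cdot> (\<pi> \<cdot> (\<iota> \<cdot> \<pi>))" using Cmp_assoc[OF X X SO X ipH S(3,2)] .
  also have "\<pi> \<cdot> (\<iota> \<cdot> \<pi>) = \<pi>"
    using Cmp_assoc[OF X SO X SO S(3,2,3)] S(4) Idt_Cmp[OF X SO S(3)] by simp
  finally have idem: "(\<iota> \<cdot> \<pi>) \<cdot> (\<iota> \<cdot> \<pi>) = \<iota> \<cdot> \<pi>" .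
  have "Scl C z (Idt C X) \<cdot> (\<iota> \<cdot> \<pi>) = Scl C z (\<iota> \<cdot> \<pi>)"
    using Cmp_Scl_left[OF X X X ipH Idt_in_Hom[OF X], of z] Idt_Cmp[OF X X ipH] by simp
  then have "Scl C z (\<iota> \<cdot> \<pi>) = \<iota> \<cdot> \<pi>"
    unfolding z[symmetric] idem by simp
  then have "Scl C (z - 1) (\<iota> \<cdot> \<pi>) = 0" by (simp add: scale_left_diff_distrib)
  then have "z = 1" using S(5) by simp
  then have "\<iota> \<cdot> \<pi> = Idt C X" using z by simp
  then have "isomorphic X S" using S unfolding isomorphic_def is_iso_def by blast
  then show ?thesis using simple_iso[OF S(1) X] by blast
qed

lemma simple_Unit: "simple (Unit C)"
  using End_Unit Idt_Unit_nonzero by (intro simpleI) (auto simp: span_singleton)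

end

section \<open>Invertible objects\<close>

context linear_category
begin

lemma scl_1 [simp]: "arr a \<Longrightarrow> scl 1 a = a"
  by (auto elim!: arrE simp: scl_hm)

lemma zero_hm_iff: "\<lbrakk>X \<in> Ob C; Y \<in> Ob C; f \<in> Hom C X Y\<rbrakk> \<Longrightarrow> scl 0 (hm X Y f) = hm X Y f \<longleftrightarrow> f = 0"
  by (auto simp: scl_hm)

lemma simple_ide_nonzero: "simple X \<Longrightarrow> scl 0 (ide X) \<noteq> ide X"
  using simple_Idt_nonzero simple_Ob by (simp add: ide_hm zero_hm_iff Idt_in_Hom)

end

context abelian_category
begin

lemma schur_arrow:
  assumes "simple X" "simple Y" "arr f" "dm f = X" "cd f = Y" "scl 0 f \<noteq> f"
  obtains g where "arr g" "dm g = Y" "cd g = X" "g \<bullet> f = ide X" "f \<bullet> g = ide Y"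
proof -
  obtain h where h: "f = hm X Y h" "h \<in> Hom C X Y"
    using assms(3-5) by (auto elim!: arrE)
  have o: "X \<in> Ob C" "Y \<in> Ob C" using assms simple_Ob by auto
  have "h \<noteq> 0" using assms(6) h o zero_hm_iff by blast
  then obtain g where "g \<in> Hom C Y X" "g \<cdot> h = Idt C X" "h \<cdot> g = Idt C Y"
    using schur[OF assms(1,2) h(2)] unfolding is_iso_def by blast
  then show thesis
    using that[of "hm Y X g"] h o by (simp add: cmp_hm ide_hm)
qed

lemma schur_isomorphic:
  assumes "simple X" "simple Y" "arr f" "dm f = X" "cd f = Y" "scl 0 f \<noteq> f"
  shows "isomorphic X Y"
  by (rule schur_arrow[OF assms]) (use assms in \<open>auto intro: isomorphicI\<close>)

end

context monoidal_linear_category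
begin

lemma isomorphic_lw:
  assumes i: "isomorphic X Y" and o: "X \<in> Ob C" "Y \<in> Ob C" "Z \<in> Ob C"
  shows "isomorphic (Z \<boxtimes> X) (Z \<boxtimes> Y)"
proof -
  obtain f g where "arr f" "dm f = X" "cd f = Y" "arr g" "dm g = Y" "cd g = X"
    "g \<bullet> f = ide X" "f \<bullet> g = ide Y" using isomorphicE[OF i o(1,2)] .
  then show ?thesis
    using o by (intro isomorphicI[of "Z \<rhd> f" "Z \<rhd> g"]) (simp_all flip: lw_cmp)
qed

lemma isomorphic_rw:
  assumes i: "isomorphic X Y" and o: "X \<in> Ob C" "Y \<in> Ob C" "Z \<in> Ob C"
  shows "isomorphic (X \<boxtimes> Z) (Y \<boxtimes> Z)"
proof -
  obtain f g where "arr f" "dm f = X" "cd f = Y" "arr g" "dm g = Y" "cd g = X"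
    "g \<bullet> f = ide X" "f \<bullet> g = ide Y" using isomorphicE[OF i o(1,2)] .
  then show ?thesis
    using o by (intro isomorphicI[of "f \<lhd> Z" "g \<lhd> Z"]) (simp_all flip: rw_cmp)
qed

lemma isomorphic_assoc:
  "\<lbrakk>X \<in> Ob C; Y \<in> Ob C; Z \<in> Ob C\<rbrakk> \<Longrightarrow> isomorphic (X \<boxtimes> Y \<boxtimes> Z) (X \<boxtimes> (Y \<boxtimes> Z))"
  "\<lbrakk>X \<in> Ob C; Y \<in> Ob C; Z \<in> Ob C\<rbrakk> \<Longrightarrow> isomorphic (X \<boxtimes> (Y \<boxtimes> Z)) (X \<boxtimes> Y \<boxtimes> Z)"
  by (rule isomorphicI[of "aa X Y Z" "ai X Y Z"], simp_all add: struct_inv)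
    (rule isomorphicI[of "ai X Y Z" "aa X Y Z"], simp_all add: struct_inv)

lemma isomorphic_unit:
  "X \<in> Ob C \<Longrightarrow> isomorphic (Unit C \<boxtimes> X) X" "X \<in> Ob C \<Longrightarrow> isomorphic (X \<boxtimes> Unit C) X"
  by (rule isomorphicI[of "ll X" "li X"], simp_all add: struct_inv)
    (rule isomorphicI[of "rr X" "ri X"], simp_all add: struct_inv)

lemma invertible_Ob: "invertible X \<Longrightarrow> X \<in> Ob C"
  unfolding invertible_def by blast

lemma invertibleE:
  assumes "invertible X"
  obtains Y where "invertible Y" "isomorphic (X \<boxtimes> Y) (Unit C)" "isomorphic (Y \<boxtimes> X) (Unit C)"
  using assms unfolding invertible_def by blast

lemma isomorphic_cancel:
  assumes o: "X \<in> Ob C" "Y \<in> Ob C" "Z \<in> Ob C" and i: "isomorphic (X \<boxtimes> Y) (Unit C)"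
  shows "isomorphic (X \<boxtimes> (Y \<boxtimes> Z)) Z"
proof -
  have "isomorphic (X \<boxtimes> (Y \<boxtimes> Z)) (Unit C \<boxtimes> Z)"
    using o isomorphic_trans[OF isomorphic_assoc(2) isomorphic_rw[OF i]] by simp
  then show ?thesis using o isomorphic_trans[OF _ isomorphic_unit(1)] by simp
qed

lemma invertible_Unit: "invertible (Unit C)"
  unfolding invertible_def using isomorphic_unit by (auto intro!: bexI[of _ "Unit C"])

lemma invertible_iso:
  assumes X: "invertible X" and Y: "Y \<in> Ob C" and i: "isomorphic X Y"
  shows "invertible Y"
proof -
  obtain Z where Z: "invertible Z" "isomorphic (X \<boxtimes> Z) (Unit C)" "isomorphic (Z \<boxtimes> X) (Unit C)"
    using X by (rule invertibleE)
  note o = Y invertible_Ob[OF X] invertible_Ob[OF Z(1)]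
  have i': "isomorphic Y X" using isomorphic_sym[OF i] o by simp
  show ?thesis
    unfolding invertible_def
    using o isomorphic_trans[OF isomorphic_rw[OF i'] Z(2)] isomorphic_trans[OF isomorphic_lw[OF i'] Z(3)]
    by (auto intro!: bexI[of _ Z])
qed

lemma invertible_tens:
  assumes X: "invertible X" and Y: "invertible Y"
  shows "invertible (X \<boxtimes> Y)"
proof -
  obtain X' where X': "invertible X'" "isomorphic (X \<boxtimes> X') (Unit C)" "isomorphic (X' \<boxtimes> X) (Unit C)"
    using X by (rule invertibleE)
  obtain Y' where Y': "invertible Y'" "isomorphic (Y \<boxtimes> Y') (Unit C)" "isomorphic (Y' \<boxtimes> Y) (Unit C)"
    using Y by (rule invertibleE)
  have key: "isomorphic (A \<boxtimes> B \<boxtimes> (B' \<boxtimes> A')) (Unit C)"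
    if o: "A \<in> Ob C" "B \<in> Ob C" "B' \<in> Ob C" "A' \<in> Ob C"
      and i: "isomorphic (A \<boxtimes> A') (Unit C)" "isomorphic (B \<boxtimes> B') (Unit C)" for A B A' B'
  proof -
    have "isomorphic (A \<boxtimes> B \<boxtimes> (B' \<boxtimes> A')) (A \<boxtimes> (B \<boxtimes> (B' \<boxtimes> A')))"
      using o by (intro isomorphic_assoc) simp_all
    moreover have "isomorphic (A \<boxtimes> (B \<boxtimes> (B' \<boxtimes> A'))) (A \<boxtimes> A')"
      using o i by (intro isomorphic_lw isomorphic_cancel) simp_all
    ultimately have "isomorphic (A \<boxtimes> B \<boxtimes> (B' \<boxtimes> A')) (A \<boxtimes> A')"
      by (rule isomorphic_trans) (use o in simp_all)
    then show ?thesis by (rule isomorphic_trans[OF _ i(1)]) (use o in simp_all)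
  qed
  note o = invertible_Ob[OF X] invertible_Ob[OF Y] invertible_Ob[OF X'(1)] invertible_Ob[OF Y'(1)]
  show ?thesis
    unfolding invertible_def
    using o key[OF o(1,2,4,3) X'(2) Y'(2)] key[OF o(4,3,1,2) Y'(3) X'(3)]
    by (auto intro!: bexI[of _ "Y' \<boxtimes> X'"])
qed

lemma lw_faithful:
  assumes X: "invertible X" and f: "arr f" "dm f = A" "cd f = B" and g: "arr g" "dm g = A" "cd g = B"
    and eq: "X \<rhd> f = X \<rhd> g"
  shows "f = g"
proof -
  obtain Y where Y: "invertible Y" "isomorphic (Y \<boxtimes> X) (Unit C)" using X by (rule invertibleE)
  have o: "X \<in> Ob C" "Y \<in> Ob C" "A \<in> Ob C" "B \<in> Ob C"
    using invertible_Ob[OF X] invertible_Ob[OF Y(1)] f by auto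
  obtain u v where u: "arr u" "dm u = Y \<boxtimes> X" "cd u = Unit C" "arr v" "dm v = Unit C" "cd v = Y \<boxtimes> X"
    "v \<bullet> u = ide (Y \<boxtimes> X)" "u \<bullet> v = ide (Unit C)"
    using isomorphicE[OF Y(2)] o by auto
  have "aa Y X B \<bullet> ((Y \<boxtimes> X) \<rhd> f) = aa Y X B \<bullet> ((Y \<boxtimes> X) \<rhd> g)"
    using aa_nat3[of f B Y X] aa_nat3[of g B Y X] f g o eq by simp
  then have YX: "(Y \<boxtimes> X) \<rhd> f = (Y \<boxtimes> X) \<rhd> g"
    by (rule cancel_left[OF _ struct_inv(1)]) (use f g o in simp_all)
  have "(Unit C \<rhd> f) \<bullet> (u \<lhd> A) = (u \<lhd> B) \<bullet> ((Y \<boxtimes> X) \<rhd> f)"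
    using u f o by (intro interchange) auto
  also have "\<dots> = (Unit C \<rhd> g) \<bullet> (u \<lhd> A)"
    unfolding YX using u g o by (intro interchange[symmetric]) auto
  finally have "Unit C \<rhd> f = Unit C \<rhd> g"
    by (rule cancel_right[where b' = "v \<lhd> A" and X = "Unit C \<boxtimes> A"]) (use u f g o in \<open>simp_all flip: rw_cmp\<close>)
  then show ?thesis by (rule unit_lw_faithful) (use f g in simp_all)
qed

lemma zigzag_slide:
  assumes d: "is_dual_pair X D e c" and h: "arr h" "dm h = X" "cd h = X"
  shows "rr X \<bullet> (X \<rhd> (e \<bullet> (D \<rhd> h))) \<bullet> aa X D X \<bullet> (c \<lhd> X) \<bullet> li X = h"
proof -
  have o: "X \<in> Ob C" "D \<in> Ob C" "arr c" "cd c = X \<boxtimes> D" "dm c = Unit C"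
    "arr e" "dm e = D \<boxtimes> X" "cd e = Unit C"
    and z: "rr X \<bullet> (X \<rhd> e) \<bullet> aa X D X \<bullet> (c \<lhd> X) \<bullet> li X = ide X"
    using d unfolding is_dual_pair_def is_pairing_def is_copairing_def by auto
  have n1: "(X \<rhd> D \<rhd> h) \<bullet> aa X D X = aa X D X \<bullet> ((X \<boxtimes> D) \<rhd> h)"
    using aa_nat3[of h X X D] h o by simp
  have n2: "((X \<boxtimes> D) \<rhd> h) \<bullet> (c \<lhd> X) = (c \<lhd> X) \<bullet> (Unit C \<rhd> h)"
    using h o by (intro interchange) auto
  have n3: "(Unit C \<rhd> h) \<bullet> li X = li X \<bullet> h" using li_nat[of h X] h by simp
  have "rr X \<bullet> (X \<rhd> (e \<bullet> (D \<rhd> h))) \<bullet> aa X D X \<bullet> (c \<lhd> X) \<bullet> li X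
    = (rr X \<bullet> (X \<rhd> e) \<bullet> aa X D X \<bullet> (c \<lhd> X) \<bullet> li X) \<bullet> h"
    using h o by (simp add: lw_cmp cmp_pre[OF n1] cmp_pre[OF n2] n3)
  then show ?thesis using z h by simp
qed

lemma mate_arr_pre:
  assumes d: "is_dual_pair X D e c" and f: "arr f" "dm f = Z" "cd f = D"
  shows "mate_arr Z X D (e \<bullet> (f \<lhd> X)) c = f"
proof -
  have o: "X \<in> Ob C" "D \<in> Ob C" "Z \<in> Ob C" "arr c" "cd c = X \<boxtimes> D" "dm c = Unit C"
    "arr e" "dm e = D \<boxtimes> X" "cd e = Unit C"
    and z: "mate_arr D X D e c = ide D"
    using d f unfolding is_dual_pair_def is_pairing_def is_copairing_def by auto
  have n1: "(f \<lhd> X \<lhd> D) \<bullet> ai Z X D = ai D X D \<bullet> (f \<lhd> (X \<boxtimes> D))"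
    using ai_nat1[of f D X D] f o by simp
  have n2: "(f \<lhd> (X \<boxtimes> D)) \<bullet> (Z \<rhd> c) = (D \<rhd> c) \<bullet> (f \<lhd> Unit C)"
    using f o by (intro interchange[symmetric]) auto
  have n3: "(f \<lhd> Unit C) \<bullet> ri Z = ri D \<bullet> f" using ri_nat[of f D] f by simp
  have "mate_arr Z X D (e \<bullet> (f \<lhd> X)) c = mate_arr D X D e c \<bullet> f"
    using f o by (simp add: mate_arr_def rw_cmp cmp_pre[OF n1] cmp_pre[OF n2] n3)
  then show ?thesis using z f by simp
qed

lemma dual_pair_nonzero:
  assumes d: "is_dual_pair X D e c" and nz: "scl 0 (ide X) \<noteq> ide X"
  shows "scl 0 c \<noteq> c" "scl 0 (ide D) \<noteq> ide D"
proof -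
  have o: "X \<in> Ob C" "D \<in> Ob C" "arr c" "cd c = X \<boxtimes> D" "dm c = Unit C"
    "arr e" "dm e = D \<boxtimes> X" "cd e = Unit C"
    and z: "rr X \<bullet> (X \<rhd> e) \<bullet> aa X D X \<bullet> (c \<lhd> X) \<bullet> li X = ide X"
    using d unfolding is_dual_pair_def is_pairing_def is_copairing_def by auto
  show c: "scl 0 c \<noteq> c"
  proof
    assume "scl 0 c = c"
    then have "rr X \<bullet> (X \<rhd> e) \<bullet> aa X D X \<bullet> (scl 0 c \<lhd> X) \<bullet> li X = ide X" using z by simp
    then show False using z nz o by simp
  qed
  show "scl 0 (ide D) \<noteq> ide D"
  proof
    assume "scl 0 (ide D) = ide D"
    then have "(X \<rhd> scl 0 (ide D)) \<bullet> c = c" using o by simp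
    then show False using c o by simp
  qed
qed

lemma pairing_nonzero:
  assumes d: "is_dual_pair X D e c" and f: "arr f" "dm f = Z" "cd f = D" and nz: "scl 0 f \<noteq> f"
  shows "scl 0 (e \<bullet> (f \<lhd> X)) \<noteq> e \<bullet> (f \<lhd> X)"
proof
  assume eq: "scl 0 (e \<bullet> (f \<lhd> X)) = e \<bullet> (f \<lhd> X)"
  have o: "X \<in> Ob C" "D \<in> Ob C" "Z \<in> Ob C" "arr c" "cd c = X \<boxtimes> D" "dm c = Unit C"
    "arr e" "dm e = D \<boxtimes> X" "cd e = Unit C"
    using d f unfolding is_dual_pair_def is_pairing_def is_copairing_def by auto
  have "mate_arr Z X D (scl 0 (e \<bullet> (f \<lhd> X))) c = scl 0 (mate_arr Z X D (e \<bullet> (f \<lhd> X)) c)"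
    unfolding mate_arr_def using f o by simp
  then show False using eq mate_arr_pre[OF d f] nz by simp
qed

end

context fusion_category
begin

lemma End_simple_arrow: "\<lbrakk>simple X; arr f; dm f = X; cd f = X\<rbrakk> \<Longrightarrow> \<exists>z. f = scl z (ide X)"
  using End_simple[of X] by (auto elim!: arrE simp: ide_hm scl_hm Idt_in_Hom)

lemma simpleI_arrow:
  assumes X: "X \<in> Ob C" and nz: "scl 0 (ide X) \<noteq> ide X"
    and End: "\<And>f. arr f \<Longrightarrow> dm f = X \<Longrightarrow> cd f = X \<Longrightarrow> \<exists>z. f = scl z (ide X)"
  shows "simple X"
proof (rule simpleI[OF X])
  show "Idt C X \<noteq> 0" using nz X by (simp add: ide_hm zero_hm_iff Idt_in_Hom)
  fix f assume "f \<in> Hom C X X"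
  then show "\<exists>z. f = Scl C z (Idt C X)"
    using End[of "hm X X f"] X by (auto simp: ide_hm scl_hm Idt_in_Hom)
qed

lemma invertible_tens_simple:
  assumes X: "invertible X" and Y: "simple Y"
  shows "simple (X \<boxtimes> Y)"
proof -
  obtain X' where X': "invertible X'" "isomorphic (X' \<boxtimes> X) (Unit C)" using X by (rule invertibleE)
  note o = invertible_Ob[OF X] simple_Ob[OF Y] invertible_Ob[OF X'(1)]
  have s: "simple (X' \<boxtimes> (X \<boxtimes> Y))"
    using simple_iso[OF Y] isomorphic_cancel[OF o(3,1,2) X'(2)] o by simp
  show ?thesis
  proof (rule simpleI_arrow)
    show "scl 0 (ide (X \<boxtimes> Y)) \<noteq> ide (X \<boxtimes> Y)"
    proof
      assume "scl 0 (ide (X \<boxtimes> Y)) = ide (X \<boxtimes> Y)"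
      then have "X \<rhd> scl 0 (ide Y) = X \<rhd> ide Y" using o by simp
      then have "scl 0 (ide Y) = ide Y" by (rule lw_faithful[OF X, rotated 6]) (use o in simp_all)
      then show False using simple_ide_nonzero[OF Y] by blast
    qed
    fix f assume f: "arr f" "dm f = X \<boxtimes> Y" "cd f = X \<boxtimes> Y"
    obtain z where "X' \<rhd> f = scl z (ide (X' \<boxtimes> (X \<boxtimes> Y)))"
      using End_simple_arrow[OF s, of "X' \<rhd> f"] f o by auto
    then have "X' \<rhd> f = X' \<rhd> scl z (ide (X \<boxtimes> Y))" using o by simp
    then have "f = scl z (ide (X \<boxtimes> Y))" by (rule lw_faithful[OF X'(1), rotated 6]) (use f o in simp_all)
    then show "\<exists>z. f = scl z (ide (X \<boxtimes> Y))" by blast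
  qed (use o in simp)
qed

lemma invertible_simple: "invertible X \<Longrightarrow> simple X"
  using simple_iso[OF invertible_tens_simple[OF _ simple_Unit]] isomorphic_unit(2) invertible_Ob
    isomorphic_sym by (metis TensOb_in_Ob Unit_in_Ob)

end

context modular_tensor_category
begin

lemma isomorphic_braid: "\<lbrakk>X \<in> Ob C; Y \<in> Ob C\<rbrakk> \<Longrightarrow> isomorphic (X \<boxtimes> Y) (Y \<boxtimes> X)"
  using Braid_iso unfolding isomorphic_def by blast

lemma isomorphic_ddual: "X \<in> Ob C \<Longrightarrow> isomorphic X (Dual C (Dual C X))"
  using Piv_iso unfolding isomorphic_def by blast

lemma simple_Dual:
  assumes X: "simple X"
  shows "simple (Dual C X)"
proof -
  let ?D = "Dual C X" let ?E = "Dual C ?D"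
  have o: "X \<in> Ob C" "?D \<in> Ob C" "?E \<in> Ob C" using simple_Ob[OF X] by simp_all
  have s: "simple ?E"
    using simple_iso[OF X o(3)] isomorphic_sym[OF isomorphic_ddual] o by simp
  show ?thesis
  proof (rule simpleI_arrow)
    show "scl 0 (ide ?D) \<noteq> ide ?D"
      using dual_pair_nonzero(2)[OF dual_pair simple_ide_nonzero[OF X]] o by simp
    fix h assume h: "arr h" "dm h = ?D" "cd h = ?D"
    have q: "is_pairing ?E ?D (ev ?D \<bullet> (?E \<rhd> h))"
      unfolding is_pairing_def using h o by simp
    obtain z where z: "mate_arr ?E ?D ?E (ev ?D \<bullet> (?E \<rhd> h)) (cv ?D) = scl z (ide ?E)"
      using End_simple_arrow[OF s, of "mate_arr ?E ?D ?E (ev ?D \<bullet> (?E \<rhd> h)) (cv ?D)"]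
        arr_mate_arr[OF q is_copairing_cv[OF o(2)]] by auto
    have "ev ?D \<bullet> (?E \<rhd> h) = ev ?D \<bullet> (scl z (ide ?E) \<lhd> ?D)"
      using pairing_mate_arr[OF dual_pair[OF o(2)] q] z by simp
    also have "\<dots> = ev ?D \<bullet> (?E \<rhd> scl z (ide ?D))" using o by simp
    finally have "h = scl z (ide ?D)"
      using zigzag_slide[OF dual_pair[OF o(2)] h] zigzag_slide[OF dual_pair[OF o(2)], of "scl z (ide ?D)"] o
      by (metis arr_ide arr_scl dm_ide dm_scl cd_ide cd_scl)
    then show "\<exists>z. h = scl z (ide ?D)" by blast
  qed (use o in simp)
qed

lemma cat_dim_simple_nonzero:
  assumes X: "simple X"
  shows "cat_dim X \<noteq> 0"
proof -
  let ?D = "Dual C X" let ?E = "Dual C ?D" let ?I = "Unit C"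
  have o: "X \<in> Ob C" "?D \<in> Ob C" "?E \<in> Ob C" using simple_Ob[OF X] by simp_all
  have c: "Coev C X \<in> Hom C ?I (X \<boxtimes> ?D)" using left_dual[OF o(1)] unfolding is_left_dual_def by blast
  have c0: "Coev C X \<noteq> 0"
    using dual_pair_nonzero(1)[OF dual_pair[OF o(1)] simple_ide_nonzero[OF X]] c o
    by (simp add: cv_def zero_hm_iff)
  have xd: "X \<boxtimes> ?D \<in> Ob C" using o by simp
  obtain S \<iota> \<pi> where S: "simple S" "\<iota> \<in> Hom C S (X \<boxtimes> ?D)" "\<pi> \<in> Hom C (X \<boxtimes> ?D) S"
    "(\<iota> \<cdot> \<pi>) \<cdot> Coev C X \<noteq> 0"
    using simple_summand[OF xd, of "\<lambda>h. h \<cdot> Coev C X"]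
      Cmp_add_left[OF Unit_in_Ob xd xd c] Idt_Cmp[OF Unit_in_Ob xd c] c0 by metis
  note SO = simple_Ob[OF S(1)]
  have "\<pi> \<cdot> Coev C X \<noteq> 0"
    using S(4) Cmp_assoc[OF Unit_in_Ob xd SO xd c S(3,2)] Cmp_zero_right[OF Unit_in_Ob SO xd S(2)] by auto
  moreover have pc: "\<pi> \<cdot> Coev C X \<in> Hom C ?I S" using Cmp_in_Hom[OF Unit_in_Ob xd SO c S(3)] .
  ultimately obtain k where k: "k \<in> Hom C S ?I" "k \<cdot> (\<pi> \<cdot> Coev C X) = Idt C ?I"
    using schur[OF simple_Unit S(1)] unfolding is_iso_def by blast
  define q where "q = hm S ?I k \<bullet> hm (X \<boxtimes> ?D) S \<pi>"
  have q: "is_pairing X ?D q"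
    unfolding is_pairing_def q_def using k(1) S(3) SO o xd by simp
  have qc: "q \<bullet> cv X = ide ?I"
    unfolding q_def cv_def cmp_assoc using k S(3) SO xd c pc by (simp add: cmp_hm ide_hm)
  define f where "f = mate_arr X ?D ?E q (cv ?D)"
  have f: "arr f" "dm f = X" "cd f = ?E"
    unfolding f_def using arr_mate_arr[OF q is_copairing_cv[OF o(2)]] by simp_all
  have ef: "ev ?D \<bullet> (f \<lhd> ?D) = q"
    unfolding f_def by (rule pairing_mate_arr[OF dual_pair[OF o(2)] q])
  obtain g where g: "arr g" "dm g = ?E" "cd g = X" "pv X \<bullet> g = ide ?E"
  proof -
    obtain g where "g \<in> Hom C ?E X" "Piv C X \<cdot> g = Idt C ?E"
      using Piv_iso[OF o(1)] unfolding is_iso_def by blast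
    then show thesis
      using that[of "hm ?E X g"] o pv_simps(3)[OF o(1)] by (simp add: pv_def cmp_hm ide_hm)
  qed
  obtain z where z: "g \<bullet> f = scl z (ide X)"
    using End_simple_arrow[OF X, of "g \<bullet> f"] f g by auto
  have "f = pv X \<bullet> g \<bullet> f" using cmp_pre[OF g(4)] f by simp
  then have "f = scl z (pv X)" using z o by simp
  then have "scl z (ev ?D \<bullet> (pv X \<lhd> ?D) \<bullet> cv X) = ide ?I"
    using ef qc o by (metis cmp_assoc pv_simps(3) cmp_scl rw_scl scl_cmp)
  then have "scl (z * cat_dim X) (ide ?I) = scl 1 (ide ?I)" by (simp add: cat_dim_arrow[OF o(1)])
  then show ?thesis using scl_ide_Unit_eq by fastforce
qed

lemma cat_dim_Unit: "cat_dim (Unit C) = 1"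
  using cat_dim_tens[of "Unit C" "Unit C"] cat_dim_iso[OF _ _ isomorphic_unit(1)[of "Unit C"]]
    cat_dim_simple_nonzero[OF simple_Unit] by simp

lemma cat_dim_invertible:
  assumes X: "invertible X"
  shows "cat_dim X * cat_dim X = 1"
proof -
  note o = invertible_Ob[OF X] and sX = invertible_simple[OF X]
  have "simple (X \<boxtimes> Dual C X)" using invertible_tens_simple[OF X simple_Dual[OF sX]] .
  then have "isomorphic (Unit C) (X \<boxtimes> Dual C X)"
    using dual_pair_nonzero(1)[OF dual_pair[OF o] simple_ide_nonzero[OF sX]] o
    by (intro schur_isomorphic[OF simple_Unit, of _ "cv X"]) auto
  then have "cat_dim (Unit C) = cat_dim (X \<boxtimes> Dual C X)" using o by (intro cat_dim_iso) simp_all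
  then show ?thesis using o by (simp add: cat_dim_Unit cat_dim_tens cat_dim_Dual)
qed

end

section \<open>The pointed part and the double braiding\<close>

context monoidal_linear_category
begin

lemma lw_nonzero:
  assumes X: "invertible X" and f: "arr f" and nz: "scl 0 f \<noteq> f"
  shows "scl 0 (X \<rhd> f) \<noteq> X \<rhd> f"
proof
  assume "scl 0 (X \<rhd> f) = X \<rhd> f"
  then have "X \<rhd> scl 0 f = X \<rhd> f" using invertible_Ob[OF X] f by simp
  then have "scl 0 f = f" by (rule lw_faithful[OF X, rotated 6]) (use f in simp_all)
  then show False using nz by simp
qed

end

context modular_tensor_category
begin

definition all_summands_invertible :: "'o \<Rightarrow> bool" where
  "all_summands_invertible X \<longleftrightarrow> X \<in> Ob C \<and>
     (\<forall>Z f. simple Z \<longrightarrow> f \<in> Hom C Z X \<longrightarrow> f \<noteq> 0 \<longrightarrow> invertible Z)"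

lemma all_summands_invertible_tens:
  assumes X: "all_summands_invertible X" and Y: "all_summands_invertible Y"
  shows "all_summands_invertible (X \<boxtimes> Y)"
proof -
  have o: "X \<in> Ob C" "Y \<in> Ob C" "X \<boxtimes> Y \<in> Ob C"
    using X Y unfolding all_summands_invertible_def by auto
  have "invertible Z" if Z: "simple Z" and f: "f \<in> Hom C Z (X \<boxtimes> Y)" "f \<noteq> 0" for Z f
  proof -
    note ZO = simple_Ob[OF Z]
    have add: "(h + k) \<star> Idt C Y \<cdot> f = (h \<star> Idt C Y \<cdot> f) + (k \<star> Idt C Y \<cdot> f)"
      if "h \<in> Hom C X X" "k \<in> Hom C X X" for h k
      using TensMor_add_left[OF o(1,1,2,2) that Idt_in_Hom[OF o(2)]]
        Cmp_add_left[OF ZO o(3,3) f(1)] TensMor_in_Hom[OF o(1,1,2,2) _ Idt_in_Hom[OF o(2)]] that by simp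
    obtain S \<iota> \<pi> where S: "simple S" "\<iota> \<in> Hom C S X" "\<pi> \<in> Hom C X S" "\<pi> \<cdot> \<iota> = Idt C S"
      "(\<iota> \<cdot> \<pi>) \<star> Idt C Y \<cdot> f \<noteq> 0"
    proof (rule simple_summand[OF o(1), of "\<lambda>h. h \<star> Idt C Y \<cdot> f"])
      show "Idt C X \<star> Idt C Y \<cdot> f \<noteq> 0"
        using TensMor_Idt[OF o(1,2)] Idt_Cmp[OF ZO o(3) f(1)] f(2) by simp
    qed (use add in auto)
    note SO = simple_Ob[OF S(1)]
    define f' where "f' = \<pi> \<star> Idt C Y \<cdot> f"
    have SY: "S \<boxtimes> Y \<in> Ob C" using SO o by simp
    have pY: "\<pi> \<star> Idt C Y \<in> Hom C (X \<boxtimes> Y) (S \<boxtimes> Y)"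
      using TensMor_in_Hom[OF o(1) SO o(2,2) S(3) Idt_in_Hom[OF o(2)]] .
    have iY: "\<iota> \<star> Idt C Y \<in> Hom C (S \<boxtimes> Y) (X \<boxtimes> Y)"
      using TensMor_in_Hom[OF SO o(1,2,2) S(2) Idt_in_Hom[OF o(2)]] .
    have f': "f' \<in> Hom C Z (S \<boxtimes> Y)" unfolding f'_def using Cmp_in_Hom[OF ZO o(3) SY f(1) pY] .
    have "(\<iota> \<cdot> \<pi>) \<star> Idt C Y = (\<iota> \<star> Idt C Y) \<cdot> (\<pi> \<star> Idt C Y)"
      using TensMor_Cmp[OF o(1) SO o(1,2,2,2) S(3,2) Idt_in_Hom[OF o(2)] Idt_in_Hom[OF o(2)]]
        Idt_Cmp[OF o(2,2) Idt_in_Hom[OF o(2)]] by simp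
    then have "(\<iota> \<star> Idt C Y) \<cdot> f' \<noteq> 0"
      unfolding f'_def using S(5) Cmp_assoc[OF ZO o(3) SY o(3) f(1) pY iY] by simp
    then have f'0: "f' \<noteq> 0" using Cmp_zero_right[OF ZO SY o(3) iY] by auto
    have "\<iota> \<noteq> 0"
      using S(4) simple_Idt_nonzero[OF S(1)] Cmp_zero_right[OF SO o(1) SO S(3)] by auto
    then have Sinv: "invertible S" using X S(1,2) unfolding all_summands_invertible_def by blast
    have add': "Idt C S \<star> (h + k) \<cdot> f' = (Idt C S \<star> h \<cdot> f') + (Idt C S \<star> k \<cdot> f')"
      if "h \<in> Hom C Y Y" "k \<in> Hom C Y Y" for h k
      using TensMor_add_right[OF SO SO o(2,2) Idt_in_Hom[OF SO] that]
        Cmp_add_left[OF ZO SY SY f'] TensMor_in_Hom[OF SO SO o(2,2) Idt_in_Hom[OF SO]] that by simp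
    obtain T \<kappa> \<rho> where T: "simple T" "\<kappa> \<in> Hom C T Y" "\<rho> \<in> Hom C Y T" "\<rho> \<cdot> \<kappa> = Idt C T"
      "Idt C S \<star> (\<kappa> \<cdot> \<rho>) \<cdot> f' \<noteq> 0"
    proof (rule simple_summand[OF o(2), of "\<lambda>h. Idt C S \<star> h \<cdot> f'"])
      show "Idt C S \<star> Idt C Y \<cdot> f' \<noteq> 0"
        using TensMor_Idt[OF SO o(2)] Idt_Cmp[OF ZO SY f'] f'0 by simp
    qed (use add' in auto)
    note TO = simple_Ob[OF T(1)]
    have ST: "S \<boxtimes> T \<in> Ob C" using SO TO by simp
    have pT: "Idt C S \<star> \<rho> \<in> Hom C (S \<boxtimes> Y) (S \<boxtimes> T)"
      using TensMor_in_Hom[OF SO SO o(2) TO Idt_in_Hom[OF SO] T(3)] .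
    have iT: "Idt C S \<star> \<kappa> \<in> Hom C (S \<boxtimes> T) (S \<boxtimes> Y)"
      using TensMor_in_Hom[OF SO SO TO o(2) Idt_in_Hom[OF SO] T(2)] .
    have "Idt C S \<star> (\<kappa> \<cdot> \<rho>) = (Idt C S \<star> \<kappa>) \<cdot> (Idt C S \<star> \<rho>)"
      using TensMor_Cmp[OF SO SO SO o(2) TO o(2) Idt_in_Hom[OF SO] Idt_in_Hom[OF SO] T(3,2)]
        Idt_Cmp[OF SO SO Idt_in_Hom[OF SO]] by simp
    then have "(Idt C S \<star> \<kappa>) \<cdot> (Idt C S \<star> \<rho> \<cdot> f') \<noteq> 0"
      using T(5) Cmp_assoc[OF ZO SY ST SY f' pT iT] by simp
    then have f''0: "Idt C S \<star> \<rho> \<cdot> f' \<noteq> 0" using Cmp_zero_right[OF ZO ST SY iT] by auto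
    have f'': "Idt C S \<star> \<rho> \<cdot> f' \<in> Hom C Z (S \<boxtimes> T)" using Cmp_in_Hom[OF ZO SY ST f' pT] .
    have "\<kappa> \<noteq> 0"
      using T(4) simple_Idt_nonzero[OF T(1)] Cmp_zero_right[OF TO o(2) TO T(3)] by auto
    then have Tinv: "invertible T" using Y T(1,2) unfolding all_summands_invertible_def by blast
    have inv: "invertible (S \<boxtimes> T)" using invertible_tens[OF Sinv Tinv] .
    have "isomorphic Z (S \<boxtimes> T)"
      using schur[OF Z invertible_simple[OF inv] f'' f''0] unfolding isomorphic_def by blast
    then show ?thesis using invertible_iso[OF inv ZO] isomorphic_sym ZO ST by blast
  qed
  then show ?thesis using o unfolding all_summands_invertible_def by blast
qed

lemma all_summands_invertible_Dual:
  assumes X: "all_summands_invertible X"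
  shows "all_summands_invertible (Dual C X)"
proof -
  let ?D = "Dual C X" let ?I = "Unit C"
  have o: "X \<in> Ob C" "?D \<in> Ob C" using X unfolding all_summands_invertible_def by auto
  have "invertible Z" if Z: "simple Z" and f: "f \<in> Hom C Z ?D" "f \<noteq> 0" for Z f
  proof -
    note ZO = simple_Ob[OF Z]
    have ZX: "Z \<boxtimes> X \<in> Ob C" using ZO o by simp
    define u where "u = Ev C X \<cdot> (f \<star> Idt C X)"
    have e: "Ev C X \<in> Hom C (?D \<boxtimes> X) ?I" using left_dual[OF o(1)] unfolding is_left_dual_def by blast
    have fX: "f \<star> Idt C X \<in> Hom C (Z \<boxtimes> X) (?D \<boxtimes> X)"
      using TensMor_in_Hom[OF ZO o(2,1,1) f(1) Idt_in_Hom[OF o(1)]] .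
    have u: "u \<in> Hom C (Z \<boxtimes> X) ?I" unfolding u_def using Cmp_in_Hom[OF ZX _ _ fX e] o by simp
    have u_eq: "hm (Z \<boxtimes> X) ?I u = ev X \<bullet> (hm Z ?D f \<lhd> X)"
      unfolding u_def using o ZO f by (intro hm_eqI) (simp_all add: the_mo the_mo_ev_cv)
    have "scl 0 (hm Z ?D f) \<noteq> hm Z ?D f" using zero_hm_iff[OF ZO o(2) f(1)] f(2) by simp
    then have "scl 0 (hm (Z \<boxtimes> X) ?I u) \<noteq> hm (Z \<boxtimes> X) ?I u"
      unfolding u_eq using f o ZO by (intro pairing_nonzero[OF dual_pair[OF o(1)], of _ Z]) simp_all
    then have u0: "u \<noteq> 0" using zero_hm_iff[OF ZX Unit_in_Ob u] by blast
    have add: "u \<cdot> (Idt C Z \<star> (h + k)) = (u \<cdot> (Idt C Z \<star> h)) + (u \<cdot> (Idt C Z \<star> k))"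
      if "h \<in> Hom C X X" "k \<in> Hom C X X" for h k
      using TensMor_add_right[OF ZO ZO o(1,1) Idt_in_Hom[OF ZO] that]
        Cmp_add_right[OF ZX ZX Unit_in_Ob _ _ u] TensMor_in_Hom[OF ZO ZO o(1,1) Idt_in_Hom[OF ZO]] that by simp
    obtain S \<iota> \<pi> where S: "simple S" "\<iota> \<in> Hom C S X" "\<pi> \<in> Hom C X S" "\<pi> \<cdot> \<iota> = Idt C S"
      "u \<cdot> (Idt C Z \<star> (\<iota> \<cdot> \<pi>)) \<noteq> 0"
    proof (rule simple_summand[OF o(1), of "\<lambda>h. u \<cdot> (Idt C Z \<star> h)"])
      show "u \<cdot> (Idt C Z \<star> Idt C X) \<noteq> 0"
        using TensMor_Idt[OF ZO o(1)] Cmp_Idt[OF ZX Unit_in_Ob u] u0 by simp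
    qed (use add in auto)
    note SO = simple_Ob[OF S(1)]
    have ZS: "Z \<boxtimes> S \<in> Ob C" using ZO SO by simp
    have zi: "Idt C Z \<star> \<iota> \<in> Hom C (Z \<boxtimes> S) (Z \<boxtimes> X)"
      using TensMor_in_Hom[OF ZO ZO SO o(1) Idt_in_Hom[OF ZO] S(2)] .
    have zp: "Idt C Z \<star> \<pi> \<in> Hom C (Z \<boxtimes> X) (Z \<boxtimes> S)"
      using TensMor_in_Hom[OF ZO ZO o(1) SO Idt_in_Hom[OF ZO] S(3)] .
    have "Idt C Z \<star> (\<iota> \<cdot> \<pi>) = (Idt C Z \<star> \<iota>) \<cdot> (Idt C Z \<star> \<pi>)"
      using TensMor_Cmp[OF ZO ZO ZO o(1) SO o(1) Idt_in_Hom[OF ZO] Idt_in_Hom[OF ZO] S(3,2)]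
        Idt_Cmp[OF ZO ZO Idt_in_Hom[OF ZO]] by simp
    then have "(u \<cdot> (Idt C Z \<star> \<iota>)) \<cdot> (Idt C Z \<star> \<pi>) \<noteq> 0"
      using S(5) Cmp_assoc[OF ZX ZS ZX Unit_in_Ob zp zi u] by simp
    then have v0: "u \<cdot> (Idt C Z \<star> \<iota>) \<noteq> 0" using Cmp_zero_left[OF ZX ZS Unit_in_Ob zp] by auto
    have v: "u \<cdot> (Idt C Z \<star> \<iota>) \<in> Hom C (Z \<boxtimes> S) ?I" using Cmp_in_Hom[OF ZS ZX Unit_in_Ob zi u] .
    have "\<iota> \<noteq> 0"
      using S(4) simple_Idt_nonzero[OF S(1)] Cmp_zero_right[OF SO o(1) SO S(3)] by auto
    then have Sinv: "invertible S" using X S(1,2) unfolding all_summands_invertible_def by blast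
    have "simple (Z \<boxtimes> S)"
      using simple_iso[OF invertible_tens_simple[OF Sinv Z] ZS isomorphic_braid[OF ZO SO]] .
    then have i: "isomorphic (Z \<boxtimes> S) ?I"
      using schur[OF _ simple_Unit v v0] unfolding isomorphic_def by blast
    have "isomorphic (S \<boxtimes> Z) ?I"
      using isomorphic_trans[OF isomorphic_braid[OF SO ZO] i] SO ZO by simp
    then show ?thesis unfolding invertible_def using i SO ZO by blast
  qed
  then show ?thesis using o unfolding all_summands_invertible_def by blast
qed

lemma fusion_subcategory_all_summands_invertible: "fusion_subcategory {X. all_summands_invertible X}"
  unfolding fusion_subcategory_def
proof (intro conjI ballI allI impI; (unfold mem_Collect_eq)?)
  show "{X. all_summands_invertible X} \<subseteq> Ob C" unfolding all_summands_invertible_def by blast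
  show "all_summands_invertible (Unit C)"
    unfolding all_summands_invertible_def
    by (metis Unit_in_Ob invertible_Unit invertible_iso isomorphic_def isomorphic_sym schur simple_Ob simple_Unit)
next
  fix X Y i assume "all_summands_invertible X" and Y: "Y \<in> Ob C" and i: "is_mono Y X i"
  then have X: "X \<in> Ob C" and inv: "\<And>Z f. simple Z \<Longrightarrow> f \<in> Hom C Z X \<Longrightarrow> f \<noteq> 0 \<Longrightarrow> invertible Z"
    unfolding all_summands_invertible_def by blast+
  have iH: "i \<in> Hom C Y X" using i unfolding is_mono_def by blast
  have "invertible Z" if Z: "simple Z" and f: "f \<in> Hom C Z Y" "f \<noteq> 0" for Z f
  proof (rule inv[OF Z])
    note ZO = simple_Ob[OF Z]
    show "i \<cdot> f \<in> Hom C Z X" using Cmp_in_Hom[OF ZO Y X f(1) iH] .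
    show "i \<cdot> f \<noteq> 0"
    proof
      assume "i \<cdot> f = 0"
      then have "i \<cdot> f = i \<cdot> 0" using Cmp_zero_right[OF ZO Y X iH] by simp
      then show False using i ZO f zero_in_Hom[OF ZO Y] unfolding is_mono_def by blast
    qed
  qed
  then show "all_summands_invertible Y" using Y unfolding all_summands_invertible_def by blast
next
  fix X Y Z assume X: "all_summands_invertible X" and Y: "all_summands_invertible Y"
    and Z: "Z \<in> Ob C" and ds: "is_direct_sum Z [X, Y]"
  have o: "X \<in> Ob C" "Y \<in> Ob C" using X Y unfolding all_summands_invertible_def by auto
  obtain \<iota> \<pi> where "\<forall>k<length [X, Y]. \<iota> k \<in> Hom C ([X, Y] ! k) Z \<and> \<pi> k \<in> Hom C Z ([X, Y] ! k)"
    "(\<Sum>k<length [X, Y]. \<iota> k \<cdot> \<pi> k) = Idt C Z"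
    using ds unfolding is_direct_sum_def by blast
  then have ip: "\<iota> 0 \<in> Hom C X Z" "\<pi> 0 \<in> Hom C Z X" "\<iota> 1 \<in> Hom C Y Z" "\<pi> 1 \<in> Hom C Z Y"
    "(\<iota> 0 \<cdot> \<pi> 0) + (\<iota> 1 \<cdot> \<pi> 1) = Idt C Z"
    by (auto simp: less_Suc_eq numeral_2_eq_2)
  have "invertible W" if W: "simple W" and f: "f \<in> Hom C W Z" "f \<noteq> 0" for W f
  proof -
    note WO = simple_Ob[OF W]
    have "f = ((\<iota> 0 \<cdot> \<pi> 0) + (\<iota> 1 \<cdot> \<pi> 1)) \<cdot> f" using ip(5) Idt_Cmp[OF WO Z f(1)] by simp
    also have "\<dots> = (\<iota> 0 \<cdot> (\<pi> 0 \<cdot> f)) + (\<iota> 1 \<cdot> (\<pi> 1 \<cdot> f))"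
      using Cmp_add_left[OF WO Z Z f(1) Cmp_in_Hom[OF Z o(1) Z ip(2,1)] Cmp_in_Hom[OF Z o(2) Z ip(4,3)]]
        Cmp_assoc[OF WO Z o(1) Z f(1) ip(2,1)] Cmp_assoc[OF WO Z o(2) Z f(1) ip(4,3)] by simp
    finally have "\<pi> 0 \<cdot> f \<noteq> 0 \<or> \<pi> 1 \<cdot> f \<noteq> 0"
      using f(2) Cmp_zero_right[OF WO o(1) Z ip(1)] Cmp_zero_right[OF WO o(2) Z ip(3)] by auto
    then show ?thesis
      using X Y W Cmp_in_Hom[OF WO Z o(1) f(1) ip(2)] Cmp_in_Hom[OF WO Z o(2) f(1) ip(4)]
      unfolding all_summands_invertible_def by blast
  qed
  then show "all_summands_invertible Z" using Z unfolding all_summands_invertible_def by blast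
qed (auto intro: all_summands_invertible_tens all_summands_invertible_Dual)

lemma simple_in_pointed_part_iff: "X \<in> pointed_part \<and> simple X \<longleftrightarrow> invertible X"
proof
  assume X: "X \<in> pointed_part \<and> simple X"
  have "all_summands_invertible Y" if Y: "simple Y" "invertible Y" for Y
    unfolding all_summands_invertible_def
    using simple_Ob[OF Y(1)] schur[OF _ Y(1)] invertible_iso[OF Y(2)] isomorphic_sym simple_Ob
    by (metis isomorphic_def)
  then have "pointed_part \<subseteq> {X. all_summands_invertible X}"
    unfolding pointed_part_def generated_subcategory_def
    using fusion_subcategory_all_summands_invertible by blast
  then show "invertible X"
    using X Idt_in_Hom[OF simple_Ob] simple_Idt_nonzero unfolding all_summands_invertible_def by blast
next
  assume "invertible X"
  then show "X \<in> pointed_part \<and> simple X"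
    using invertible_simple unfolding pointed_part_def generated_subcategory_def by blast
qed

definition br where "br X Y = hm (X \<boxtimes> Y) (Y \<boxtimes> X) (Braid C X Y)"

lemma br_simps [simp]:
  "dm (br X Y) = X \<boxtimes> Y" "cd (br X Y) = Y \<boxtimes> X" "X \<in> Ob C \<Longrightarrow> Y \<in> Ob C \<Longrightarrow> arr (br X Y)"
  using Braid_iso unfolding br_def is_iso_def by auto

lemma the_mo_br: "the (mo (br X Y)) = Braid C X Y"
  by (simp add: br_def)

lemma br_nat: "\<lbrakk>arr f; arr g; cd f = X'; cd g = Y'; dm f = X; dm g = Y\<rbrakk>
    \<Longrightarrow> br X' Y' \<bullet> tens f g = tens g f \<bullet> br X Y"
  using br_simps(3)[of X Y] br_simps(3)[of X' Y'] Braid_natural[of X X' Y Y']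
  by (auto elim!: arrE simp: br_def hm_simps)

lemma br_hexagon:
  assumes "X \<in> Ob C" "Y \<in> Ob C" "Z \<in> Ob C"
  shows "aa Y Z X \<bullet> br X (Y \<boxtimes> Z) \<bullet> aa X Y Z = (Y \<rhd> br X Z) \<bullet> aa Y X Z \<bullet> (br X Y \<lhd> Z)" (is "?L = ?R")
proof -
  have "hm (X \<boxtimes> Y \<boxtimes> Z) (Y \<boxtimes> (Z \<boxtimes> X)) (the (mo ?L)) = ?L"
    "hm (X \<boxtimes> Y \<boxtimes> Z) (Y \<boxtimes> (Z \<boxtimes> X)) (the (mo ?R)) = ?R"
    using assms by (auto intro: hm_eqI)
  moreover have "the (mo ?L) = the (mo ?R)"
    using assms hexagon[of X Y Z] by (simp add: the_mo the_mo_br)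
  ultimately show ?thesis by metis
qed

lemma br_hexagon_inv:
  assumes "X \<in> Ob C" "Y \<in> Ob C" "Z \<in> Ob C"
  shows "ai Z X Y \<bullet> br (X \<boxtimes> Y) Z \<bullet> ai X Y Z = (br X Z \<lhd> Y) \<bullet> ai X Z Y \<bullet> (X \<rhd> br Y Z)" (is "?L = ?R")
proof -
  have "hm (X \<boxtimes> (Y \<boxtimes> Z)) (Z \<boxtimes> X \<boxtimes> Y) (the (mo ?L)) = ?L"
    "hm (X \<boxtimes> (Y \<boxtimes> Z)) (Z \<boxtimes> X \<boxtimes> Y) (the (mo ?R)) = ?R"
    using assms by (auto intro: hm_eqI)
  moreover have "the (mo ?L) = the (mo ?R)"
    using assms hexagon_inv[of X Y Z] by (simp add: the_mo the_mo_br)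
  ultimately show ?thesis by metis
qed

definition monodromy :: "'o \<Rightarrow> 'o \<Rightarrow> complex \<Rightarrow> bool" where
  "monodromy X Y z \<longleftrightarrow> X \<in> Ob C \<and> Y \<in> Ob C \<and> br Y X \<bullet> br X Y = scl z (ide (X \<boxtimes> Y))"

lemma br_invertible:
  assumes "X \<in> Ob C" "Y \<in> Ob C"
  obtains g where "arr g" "dm g = Y \<boxtimes> X" "cd g = X \<boxtimes> Y" "g \<bullet> br X Y = ide (X \<boxtimes> Y)" "br X Y \<bullet> g = ide (Y \<boxtimes> X)"
proof -
  obtain h where "h \<in> Hom C (Y \<boxtimes> X) (X \<boxtimes> Y)" "h \<cdot> Braid C X Y = Idt C (X \<boxtimes> Y)" "Braid C X Y \<cdot> h = Idt C (Y \<boxtimes> X)"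
    using Braid_iso[OF assms] unfolding is_iso_def by blast
  then show thesis
    using that[of "hm (Y \<boxtimes> X) (X \<boxtimes> Y) h"] br_simps(3)[OF assms] assms by (simp add: br_def cmp_hm ide_hm)
qed

lemma monodromy_sym:
  assumes "monodromy X Y z"
  shows "monodromy Y X z"
proof -
  have o: "X \<in> Ob C" "Y \<in> Ob C" and m: "br Y X \<bullet> br X Y = scl z (ide (X \<boxtimes> Y))"
    using assms unfolding monodromy_def by auto
  obtain g where g: "arr g" "dm g = Y \<boxtimes> X" "cd g = X \<boxtimes> Y" "br X Y \<bullet> g = ide (Y \<boxtimes> X)"
    using br_invertible[OF o] by metis
  have "br X Y \<bullet> br Y X = br X Y \<bullet> (br Y X \<bullet> br X Y) \<bullet> g" using o g by simp
  also have "\<dots> = scl z (ide (Y \<boxtimes> X))" unfolding m using o g by simp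
  finally show ?thesis using o unfolding monodromy_def by simp
qed

lemma monodromy_tens:
  assumes "monodromy X Y z" "monodromy X Z w"
  shows "monodromy X (Y \<boxtimes> Z) (z * w)"
proof -
  have o: "X \<in> Ob C" "Y \<in> Ob C" "Z \<in> Ob C" and m: "br Y X \<bullet> br X Y = scl z (ide (X \<boxtimes> Y))"
    "br Z X \<bullet> br X Z = scl w (ide (X \<boxtimes> Z))"
    using assms unfolding monodromy_def by auto
  have b1: "br X (Y \<boxtimes> Z) = ai Y Z X \<bullet> (Y \<rhd> br X Z) \<bullet> aa Y X Z \<bullet> (br X Y \<lhd> Z) \<bullet> ai X Y Z"
  proof -
    have "br X (Y \<boxtimes> Z) = ai Y Z X \<bullet> (aa Y Z X \<bullet> br X (Y \<boxtimes> Z) \<bullet> aa X Y Z) \<bullet> ai X Y Z"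
      using o by (simp add: struct_inv cmp_pre[OF struct_inv(1)])
    then show ?thesis unfolding br_hexagon[OF o] by simp
  qed
  have b2: "br (Y \<boxtimes> Z) X = aa X Y Z \<bullet> (br Y X \<lhd> Z) \<bullet> ai Y X Z \<bullet> (Y \<rhd> br Z X) \<bullet> aa Y Z X"
  proof -
    have "br (Y \<boxtimes> Z) X = aa X Y Z \<bullet> (ai X Y Z \<bullet> br (Y \<boxtimes> Z) X \<bullet> ai Y Z X) \<bullet> aa Y Z X"
      using o by (simp add: struct_inv cmp_pre[OF struct_inv(2)])
    then show ?thesis unfolding br_hexagon_inv[OF o(2,3,1)] by simp
  qed
  have m1: "(br Y X \<lhd> Z) \<bullet> (br X Y \<lhd> Z) = scl z (ide (X \<boxtimes> Y \<boxtimes> Z))"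
    using o m(1) by (simp flip: rw_cmp)
  have m2: "(Y \<rhd> br Z X) \<bullet> (Y \<rhd> br X Z) = scl w (ide (Y \<boxtimes> (X \<boxtimes> Z)))"
    using o m(2) by (simp flip: lw_cmp)
  have "br (Y \<boxtimes> Z) X \<bullet> br X (Y \<boxtimes> Z) = scl (w * z) (ide (X \<boxtimes> (Y \<boxtimes> Z)))"
    unfolding b1 b2 using o
    by (simp add: cmp_pre[OF struct_inv(2)] cmp_pre[OF m2] cmp_pre[OF struct_inv(1)] cmp_pre[OF m1] struct_inv)
  then show ?thesis using o unfolding monodromy_def by (simp add: mult.commute)
qed

lemma monodromy_nat:
  assumes g: "arr g" "dm g = Y" "cd g = Y'" and X: "X \<in> Ob C"
  shows "br Y' X \<bullet> br X Y' \<bullet> (X \<rhd> g) = (X \<rhd> g) \<bullet> br Y X \<bullet> br X Y"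
proof -
  have "br X Y' \<bullet> (X \<rhd> g) = (g \<lhd> X) \<bullet> br X Y" "br Y' X \<bullet> (g \<lhd> X) = (X \<rhd> g) \<bullet> br Y X"
    using g X by (auto intro!: br_nat)
  then show ?thesis by (metis cmp_assoc)
qed

lemma scl_eq_imp_eq:
  assumes "scl z a = scl w a" "arr a" "scl 0 a \<noteq> a"
  shows "z = w"
proof -
  obtain X Y f where f: "a = hm X Y f" "X \<in> Ob C" "Y \<in> Ob C" "f \<in> Hom C X Y" using assms(2) by (rule arrE)
  then have "f \<noteq> 0" using assms(3) zero_hm_iff by blast
  then show ?thesis using assms(1) f by (simp add: scl_hm)
qed

lemma monodromy_unique:
  assumes "invertible X" "simple Y" "monodromy X Y z" "monodromy X Y w"
  shows "z = w"
  using assms simple_ide_nonzero[OF invertible_tens_simple[OF assms(1,2)]]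
  by (intro scl_eq_imp_eq[of z "ide (X \<boxtimes> Y)"]) (auto simp: monodromy_def)

lemma monodromy_ex:
  assumes X: "invertible X" and Y: "simple Y"
  shows "\<exists>z. monodromy X Y z"
  using End_simple_arrow[OF invertible_tens_simple[OF X Y], of "br Y X \<bullet> br X Y"]
    invertible_Ob[OF X] simple_Ob[OF Y] unfolding monodromy_def by simp

lemma monodromy_nonzero:
  assumes X: "invertible X" and Y: "simple Y" and m: "monodromy X Y z"
  shows "z \<noteq> 0"
proof
  assume "z = 0"
  have o: "X \<in> Ob C" "Y \<in> Ob C" and eq: "br Y X \<bullet> br X Y = scl 0 (ide (X \<boxtimes> Y))"
    using m \<open>z = 0\<close> unfolding monodromy_def by auto
  obtain g where g: "g \<bullet> br X Y = ide (X \<boxtimes> Y)" "arr g" "dm g = Y \<boxtimes> X"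
    using br_invertible[OF o] by metis
  obtain h where h: "h \<bullet> br Y X = ide (Y \<boxtimes> X)" "arr h" "dm h = X \<boxtimes> Y" "cd h = Y \<boxtimes> X"
    using br_invertible[OF o(2,1)] by metis
  have "ide (X \<boxtimes> Y) = g \<bullet> (h \<bullet> br Y X) \<bullet> br X Y" unfolding h(1) using g o by simp
  also have "\<dots> = g \<bullet> h \<bullet> (br Y X \<bullet> br X Y)" by simp
  finally have id: "ide (X \<boxtimes> Y) = scl 0 (g \<bullet> h \<bullet> ide (X \<boxtimes> Y))" unfolding eq by simp
  have "scl 0 (ide (X \<boxtimes> Y)) = ide (X \<boxtimes> Y)"
    by (subst (1 2) id) (simp only: scl_scl mult_zero_left)
  then show False using simple_ide_nonzero[OF invertible_tens_simple[OF X Y]] by simp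
qed

lemma monodromy_iso:
  assumes m: "monodromy X Y z" and Y': "Y' \<in> Ob C" and i: "isomorphic Y Y'"
  shows "monodromy X Y' z"
proof -
  have o: "X \<in> Ob C" "Y \<in> Ob C" and eq: "br Y X \<bullet> br X Y = scl z (ide (X \<boxtimes> Y))"
    using m unfolding monodromy_def by auto
  obtain f g where f: "arr f" "dm f = Y" "cd f = Y'" "arr g" "dm g = Y'" "cd g = Y"
    "g \<bullet> f = ide Y" "f \<bullet> g = ide Y'" using isomorphicE[OF i o(2) Y'] .
  have fg: "(X \<rhd> f) \<bullet> (X \<rhd> g) = ide (X \<boxtimes> Y')" using f o Y' by (simp flip: lw_cmp)
  have "br Y' X \<bullet> br X Y' = br Y' X \<bullet> br X Y' \<bullet> (X \<rhd> f) \<bullet> (X \<rhd> g)"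
    using o Y' by (simp add: fg)
  also have "\<dots> = ((X \<rhd> f) \<bullet> br Y X \<bullet> br X Y) \<bullet> (X \<rhd> g)"
    using cmp_pre3[OF monodromy_nat[OF f(1-3) o(1)]] by simp
  also have "\<dots> = scl z (ide (X \<boxtimes> Y'))"
    unfolding eq using f o fg by simp
  finally show ?thesis using o Y' unfolding monodromy_def by simp
qed

lemma monodromy_summand:
  assumes X: "invertible X" and Y: "monodromy X Y z" and W: "monodromy X W w"
    and f: "f \<in> Hom C W Y" "f \<noteq> 0"
  shows "w = z"
proof -
  have o: "X \<in> Ob C" "Y \<in> Ob C" "W \<in> Ob C" and eq: "br Y X \<bullet> br X Y = scl z (ide (X \<boxtimes> Y))"
    "br W X \<bullet> br X W = scl w (ide (X \<boxtimes> W))"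
    using Y W unfolding monodromy_def by auto
  let ?f = "hm W Y f"
  have af: "arr ?f" using f o by simp
  have "(br Y X \<bullet> br X Y) \<bullet> (X \<rhd> ?f) = (X \<rhd> ?f) \<bullet> br W X \<bullet> br X W"
    using monodromy_nat[OF af _ _ o(1), of W Y] by simp
  then have "scl z (X \<rhd> ?f) = scl w (X \<rhd> ?f)"
    unfolding eq using o af by simp
  then show ?thesis
    using scl_eq_imp_eq[of z "X \<rhd> ?f" w] lw_nonzero[OF X af] f o af by (simp add: zero_hm_iff)
qed

lemma monodromy_Unit:
  assumes Y: "simple Y" and m: "monodromy (Unit C) Y z"
  shows "z = 1"
proof -
  have YO: "Y \<in> Ob C" using simple_Ob[OF Y] .
  have "monodromy Y (Unit C \<boxtimes> Unit C) (z * z)" using monodromy_tens monodromy_sym[OF m] by blast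
  then have "monodromy Y (Unit C) (z * z)"
    by (rule monodromy_iso) (simp_all add: isomorphic_unit)
  then have "z * z = z" using monodromy_unique[OF invertible_Unit Y] m monodromy_sym by blast
  then show ?thesis using monodromy_nonzero[OF invertible_Unit Y m] by simp
qed

lemma transparent_invertible:
  assumes X: "invertible X" and triv: "\<And>Y. simple Y \<Longrightarrow> monodromy X Y 1"
  shows "isomorphic X (Unit C)"
proof -
  note XO = invertible_Ob[OF X] and Xs = invertible_simple[OF X]
  have "Braid C Y X \<cdot> Braid C X Y = Idt C (X \<boxtimes> Y)" if Y: "Y \<in> Ob C" for Y
  proof (rule ccontr)
    assume ne: "Braid C Y X \<cdot> Braid C X Y \<noteq> Idt C (X \<boxtimes> Y)"
    have XY: "X \<boxtimes> Y \<in> Ob C" using XO Y by simp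
    let ?b = "Braid C Y X \<cdot> Braid C X Y"
    have b: "?b \<in> Hom C (X \<boxtimes> Y) (X \<boxtimes> Y)"
      using Braid_iso[OF XO Y] Braid_iso[OF Y XO] Cmp_in_Hom[of "X \<boxtimes> Y" "Y \<boxtimes> X" "X \<boxtimes> Y"] XO Y
      unfolding is_iso_def by auto
    have H: "Idt C X \<star> h \<in> Hom C (X \<boxtimes> Y) (X \<boxtimes> Y)" if "h \<in> Hom C Y Y" for h
      using TensMor_in_Hom[OF XO XO Y Y Idt_in_Hom[OF XO] that] .
    have add: "(?b \<cdot> (Idt C X \<star> (h + k))) - (Idt C X \<star> (h + k)) =
        ((?b \<cdot> (Idt C X \<star> h)) - (Idt C X \<star> h)) + ((?b \<cdot> (Idt C X \<star> k)) - (Idt C X \<star> k))"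
      if "h \<in> Hom C Y Y" "k \<in> Hom C Y Y" for h k
      using TensMor_add_right[OF XO XO Y Y Idt_in_Hom[OF XO] that]
        Cmp_add_right[OF XY XY XY H[OF that(1)] H[OF that(2)] b] by simp
    have "(?b \<cdot> (Idt C X \<star> Idt C Y)) - (Idt C X \<star> Idt C Y) \<noteq> 0"
      using TensMor_Idt[OF XO Y] Cmp_Idt[OF XY XY b] ne by simp
    then obtain S \<iota> \<pi> where S: "simple S" "\<iota> \<in> Hom C S Y" "\<pi> \<in> Hom C Y S"
      "(?b \<cdot> (Idt C X \<star> (\<iota> \<cdot> \<pi>))) - (Idt C X \<star> (\<iota> \<cdot> \<pi>)) \<noteq> 0"
      using simple_summand[OF Y, of "\<lambda>h. (?b \<cdot> (Idt C X \<star> h)) - (Idt C X \<star> h)"] add by metis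
    note SO = simple_Ob[OF S(1)]
    let ?i = "hm S Y \<iota>" and ?p = "hm Y S \<pi>"
    have ip: "arr ?i" "arr ?p" using S SO Y by simp_all
    have "br S X \<bullet> br X S = ide (X \<boxtimes> S)"
      using triv[OF S(1)] XO SO unfolding monodromy_def by simp
    then have n: "br Y X \<bullet> br X Y \<bullet> (X \<rhd> ?i) = X \<rhd> ?i"
      using monodromy_nat[OF ip(1) _ _ XO, of S Y] XO ip by simp
    have "br Y X \<bullet> br X Y \<bullet> (X \<rhd> ?i) \<bullet> (X \<rhd> ?p) = (X \<rhd> ?i) \<bullet> (X \<rhd> ?p)"
      using cmp_pre3[OF n] by simp
    then have n2: "(br Y X \<bullet> br X Y) \<bullet> (X \<rhd> (?i \<bullet> ?p)) = X \<rhd> (?i \<bullet> ?p)"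
      using ip XO by (simp add: lw_cmp)
    have ipm: "X \<rhd> (?i \<bullet> ?p) = hm (X \<boxtimes> Y) (X \<boxtimes> Y) (Idt C X \<star> (\<iota> \<cdot> \<pi>))"
      using S SO Y XO Cmp_in_Hom[OF Y SO Y S(3,2)] by (simp add: hm_simps)
    have bm: "br Y X \<bullet> br X Y = hm (X \<boxtimes> Y) (X \<boxtimes> Y) ?b"
      using XO Y by (intro hm_eqI[symmetric]) (simp_all add: the_mo the_mo_br)
    have "?b \<cdot> (Idt C X \<star> (\<iota> \<cdot> \<pi>)) = Idt C X \<star> (\<iota> \<cdot> \<pi>)"
      using n2 XY b H[OF Cmp_in_Hom[OF Y SO Y S(3,2)]] unfolding ipm bm by (simp add: cmp_hm)
    then show False using S(4) by simp
  qed
  then obtain n where ds: "is_direct_sum X (replicate n (Unit C))" using nondegenerate[OF XO] by blast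
  obtain \<iota> \<pi> where ip: "\<forall>k<n. \<iota> k \<in> Hom C (Unit C) X \<and> \<pi> k \<in> Hom C X (Unit C)"
    "\<forall>k<n. \<forall>l<n. \<pi> k \<cdot> \<iota> l = (if k = l then Idt C (Unit C) else 0)" "(\<Sum>k<n. \<iota> k \<cdot> \<pi> k) = Idt C X"
    using ds unfolding is_direct_sum_def by (auto cong: if_cong)
  have "n \<noteq> 0"
  proof
    assume "n = 0"
    then show False using ip(3) simple_Idt_nonzero[OF Xs] by simp
  qed
  then have i0: "\<iota> 0 \<in> Hom C (Unit C) X" "\<pi> 0 \<in> Hom C X (Unit C)" "\<pi> 0 \<cdot> \<iota> 0 = Idt C (Unit C)"
    using ip(1,2) by auto
  have "\<iota> 0 \<noteq> 0"
    using i0 Idt_Unit_nonzero Cmp_zero_right[OF Unit_in_Ob XO Unit_in_Ob i0(2)] by auto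
  then have "isomorphic (Unit C) X"
    using schur[OF simple_Unit Xs i0(1)] unfolding isomorphic_def by blast
  then show ?thesis using isomorphic_sym XO by simp
qed

end

section \<open>Characters of the group of invertible objects and Galois orbits\<close>

context modular_tensor_category
begin

lemma iso_class_eq_iff:
  assumes "X \<in> Ob C" "Y \<in> Ob C"
  shows "iso_class X = iso_class Y \<longleftrightarrow> isomorphic X Y"
proof
  assume "iso_class X = iso_class Y"
  then show "isomorphic X Y"
    using isomorphic_refl[OF assms(2)] assms(2) unfolding iso_class_def by blast
next
  assume i: "isomorphic X Y"
  show "iso_class X = iso_class Y"
    unfolding iso_class_def
    using isomorphic_trans[OF i _ assms] isomorphic_trans[OF isomorphic_sym[OF i assms] _ assms(2,1)] by blast
qed

lemma rep_iso_class:
  assumes X: "X \<in> Ob C"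
  shows "rep (iso_class X) \<in> Ob C" "isomorphic X (rep (iso_class X))"
proof -
  have "X \<in> iso_class X" using X isomorphic_refl unfolding iso_class_def by blast
  then have "rep (iso_class X) \<in> iso_class X" unfolding rep_def by (rule someI)
  then show "rep (iso_class X) \<in> Ob C" "isomorphic X (rep (iso_class X))"
    unfolding iso_class_def by blast+
qed

definition invertible_classes :: "'o set set" where
  "invertible_classes = {iso_class X | X. invertible X}"

lemma simple_classes_in_pointed_part: "simple_classes_in pointed_part = invertible_classes"
  unfolding simple_classes_in_def invertible_classes_def using simple_in_pointed_part_iff by blast

lemma rep_simple_class:
  assumes "B \<in> simple_classes"
  shows "simple (rep B)" "rep B \<in> Ob C" "iso_class (rep B) = B"
proof -
  obtain X where X: "B = iso_class X" "simple X"
    using assms unfolding simple_classes_def simple_classes_in_def by blast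
  note XO = simple_Ob[OF X(2)] and r = rep_iso_class[OF simple_Ob[OF X(2)]]
  show "rep B \<in> Ob C" using r X by simp
  show "simple (rep B)" using simple_iso[OF X(2) r(1)] isomorphic_sym[OF r(2) XO r(1)] X by simp
  show "iso_class (rep B) = B" using iso_class_eq_iff[OF XO r(1)] r(2) X by simp
qed

lemma iso_class_simple: "simple X \<Longrightarrow> iso_class X \<in> simple_classes"
  using simple_Ob unfolding simple_classes_def simple_classes_in_def by blast

lemma invertible_classes_subset: "invertible_classes \<subseteq> simple_classes"
  unfolding invertible_classes_def using iso_class_simple invertible_simple by blast

lemma rep_invertible_class:
  assumes "A \<in> invertible_classes"
  shows "invertible (rep A)"
proof -
  obtain X where "A = iso_class X" "invertible X" using assms unfolding invertible_classes_def by blast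
  then show ?thesis using invertible_iso rep_iso_class invertible_Ob by metis
qed

lemma unit_class_invertible: "unit_class \<in> invertible_classes"
  unfolding unit_class_def invertible_classes_def using invertible_Unit by blast

text \<open>Off the invertible classes the value is \<open>1\<close>, so that these functions form a group under
  pointwise multiplication.\<close>

definition central_character :: "'o set \<Rightarrow> 'o set \<Rightarrow> complex" where
  "central_character B A =
     (if A \<in> invertible_classes then SOME z. monodromy (rep A) (rep B) z else 1)"

lemma monodromy_central_character:
  assumes A: "A \<in> invertible_classes" and B: "B \<in> simple_classes"
  shows "monodromy (rep A) (rep B) (central_character B A)"
  unfolding central_character_def using A
  by (simp add: someI_ex[OF monodromy_ex[OF rep_invertible_class[OF A] rep_simple_class(1)[OF B]]])

lemma central_character_eqI:
  assumes A: "A \<in> invertible_classes" and B: "B \<in> simple_classes" and m: "monodromy (rep A) (rep B) z"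
  shows "central_character B A = z"
  using monodromy_unique[OF rep_invertible_class[OF A] rep_simple_class(1)[OF B]
      monodromy_central_character[OF A B] m] .

lemma central_character_nonzero:
  assumes B: "B \<in> simple_classes"
  shows "central_character B A \<noteq> 0"
proof (cases "A \<in> invertible_classes")
  case True
  show ?thesis
    using monodromy_nonzero[OF rep_invertible_class[OF True] rep_simple_class(1)[OF B]
        monodromy_central_character[OF True B]] .
qed (simp add: central_character_def)

lemma monodromy_rep_unit:
  assumes X: "X \<in> Ob C" and m: "monodromy X (Unit C) z"
  shows "monodromy X (rep unit_class) z"
  using monodromy_iso[OF m] rep_iso_class[OF Unit_in_Ob] unfolding unit_class_def by simp

lemma central_character_unit_class:
  assumes B: "B \<in> simple_classes"
  shows "central_character B unit_class = 1"
proof -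
  note r = rep_simple_class[OF B]
  obtain z where z: "monodromy (Unit C) (rep B) z" using monodromy_ex[OF invertible_Unit r(1)] by blast
  then have "monodromy (Unit C) (rep B) 1" using monodromy_Unit[OF r(1)] by metis
  then have "monodromy (rep unit_class) (rep B) 1"
    using monodromy_sym monodromy_rep_unit r(2) by blast
  then show ?thesis using central_character_eqI[OF unit_class_invertible B] by blast
qed

lemma central_character_of_unit_class: "central_character unit_class = 1"
proof
  fix A
  have u: "unit_class \<in> simple_classes" using unit_class_invertible invertible_classes_subset by blast
  show "central_character unit_class A = 1 A"
  proof (cases "A \<in> invertible_classes")
    case True
    note r = rep_invertible_class[OF True]
    obtain z where z: "monodromy (rep A) (Unit C) z" using monodromy_ex[OF r simple_Unit] by blast
    have "z = 1" using monodromy_Unit[OF invertible_simple[OF r] monodromy_sym[OF z]] .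
    then have "monodromy (rep A) (rep unit_class) 1"
      using monodromy_rep_unit[OF invertible_Ob[OF r]] z by blast
    then show ?thesis using central_character_eqI[OF True u] by simp
  qed (simp add: central_character_def)
qed

lemma central_character_mult:
  assumes B: "B \<in> simple_classes" "B' \<in> simple_classes"
  shows "\<exists>B''\<in>simple_classes. central_character B'' = central_character B * central_character B'"
proof -
  let ?Y = "rep B" and ?Z = "rep B'"
  note r = rep_simple_class[OF B(1)] and r' = rep_simple_class[OF B(2)]
  have YZ: "?Y \<boxtimes> ?Z \<in> Ob C" using r r' by simp
  have "Idt C (?Y \<boxtimes> ?Z) \<noteq> 0"
  proof
    assume "Idt C (?Y \<boxtimes> ?Z) = 0"
    then have "cat_dim (?Y \<boxtimes> ?Z) = 0"
      using qtrace_Scl[OF YZ, of 0] qtrace_Scl[OF YZ, of 1] by simp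
    then show False
      using cat_dim_tens[OF r(2) r'(2)] cat_dim_simple_nonzero[OF r(1)] cat_dim_simple_nonzero[OF r'(1)] by simp
  qed
  then obtain S \<iota> \<pi> where S: "simple S" "\<iota> \<in> Hom C S (?Y \<boxtimes> ?Z)" "\<pi> \<in> Hom C (?Y \<boxtimes> ?Z) S" "\<pi> \<cdot> \<iota> = Idt C S"
    using simple_summand[OF YZ, of "\<lambda>h. h"] by metis
  note SO = simple_Ob[OF S(1)]
  have i0: "\<iota> \<noteq> 0" using S simple_Idt_nonzero[OF S(1)] Cmp_zero_right[OF SO YZ SO S(3)] by auto
  have cl: "iso_class S \<in> simple_classes" using iso_class_simple[OF S(1)] .
  have "central_character (iso_class S) A = (central_character B * central_character B') A" for A
  proof (cases "A \<in> invertible_classes")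
    case True
    note i = rep_invertible_class[OF True]
    have m: "monodromy (rep A) (?Y \<boxtimes> ?Z) (central_character B A * central_character B' A)"
      using monodromy_tens monodromy_central_character[OF True] B by blast
    obtain w where w: "monodromy (rep A) S w" using monodromy_ex[OF i S(1)] by blast
    have "w = central_character B A * central_character B' A"
      using monodromy_summand[OF i m w S(2) i0] .
    moreover have "monodromy (rep A) (rep (iso_class S)) w"
      using monodromy_iso[OF w] rep_iso_class[OF SO] by blast
    ultimately show ?thesis using central_character_eqI[OF True cl] by simp
  qed (simp add: central_character_def)
  then show ?thesis using cl by (intro bexI[of _ "iso_class S"] ext)
qed

definition class_tens :: "'o set \<Rightarrow> 'o set \<Rightarrow> 'o set" where
  "class_tens A A' = iso_class (rep A \<boxtimes> rep A')"

lemma class_tens_closed: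
  "A \<in> invertible_classes \<Longrightarrow> A' \<in> invertible_classes \<Longrightarrow> class_tens A A' \<in> invertible_classes"
  using invertible_tens rep_invertible_class unfolding class_tens_def invertible_classes_def by blast

lemma class_tens_inj:
  assumes A: "A \<in> invertible_classes"
  shows "inj_on (class_tens A) invertible_classes"
proof (rule inj_onI)
  fix B D assume B: "B \<in> invertible_classes" and D: "D \<in> invertible_classes"
    and eq: "class_tens A B = class_tens A D"
  let ?X = "rep A"
  obtain X' where X': "invertible X'" "isomorphic (X' \<boxtimes> ?X) (Unit C)"
    using rep_invertible_class[OF A] by (rule invertibleE)
  note o = invertible_Ob[OF rep_invertible_class[OF A]] invertible_Ob[OF X'(1)]
    invertible_Ob[OF rep_invertible_class[OF B]] invertible_Ob[OF rep_invertible_class[OF D]]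
  have "isomorphic (?X \<boxtimes> rep B) (?X \<boxtimes> rep D)"
    using eq iso_class_eq_iff o unfolding class_tens_def by simp
  then have "isomorphic (X' \<boxtimes> (?X \<boxtimes> rep B)) (X' \<boxtimes> (?X \<boxtimes> rep D))"
    by (rule isomorphic_lw) (use o in simp_all)
  then have "isomorphic (X' \<boxtimes> (?X \<boxtimes> rep B)) (rep D)"
    by (rule isomorphic_trans[OF _ isomorphic_cancel[OF o(2,1,4) X'(2)]]) (use o in simp_all)
  moreover have "isomorphic (rep B) (X' \<boxtimes> (?X \<boxtimes> rep B))"
    using isomorphic_sym[OF isomorphic_cancel[OF o(2,1,3) X'(2)]] o by simp
  ultimately have "isomorphic (rep B) (rep D)"
    using isomorphic_trans o by (metis TensOb_in_Ob)
  then show "B = D"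
    using iso_class_eq_iff[OF o(3,4)] rep_simple_class(3) B D invertible_classes_subset
    by (metis subsetD)
qed

lemma central_character_class_tens:
  assumes B: "B \<in> simple_classes" and A: "A \<in> invertible_classes" "A' \<in> invertible_classes"
  shows "central_character B (class_tens A A') = central_character B A * central_character B A'"
proof -
  have o: "rep A \<boxtimes> rep A' \<in> Ob C" using A rep_invertible_class invertible_Ob by simp
  have "monodromy (rep B) (rep A \<boxtimes> rep A') (central_character B A * central_character B A')"
    using monodromy_tens monodromy_sym monodromy_central_character[OF _ B] A by blast
  then have "monodromy (rep B) (rep (class_tens A A')) (central_character B A * central_character B A')"
    using monodromy_iso rep_iso_class[OF o] unfolding class_tens_def by blast
  then show ?thesis
    using central_character_eqI[OF class_tens_closed[OF A] B] monodromy_sym by blast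
qed

lemma central_character_separates:
  assumes A: "A \<in> invertible_classes" and triv: "\<And>B. B \<in> simple_classes \<Longrightarrow> central_character B A = 1"
  shows "A = unit_class"
proof -
  note i = rep_invertible_class[OF A]
  have "monodromy (rep A) Y 1" if Y: "simple Y" for Y
  proof -
    note YO = simple_Ob[OF Y] and cl = iso_class_simple[OF Y]
    have "monodromy (rep A) (rep (iso_class Y)) 1"
      using monodromy_central_character[OF A cl] triv[OF cl] by simp
    then show ?thesis
      using monodromy_iso[OF _ YO] isomorphic_sym rep_iso_class[OF YO] YO by blast
  qed
  then have "isomorphic (rep A) (Unit C)" using transparent_invertible[OF i] by blast
  then have "iso_class (rep A) = unit_class"
    unfolding unit_class_def using iso_class_eq_iff invertible_Ob[OF i] by simp
  then show ?thesis using rep_simple_class(3) A invertible_classes_subset by blast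
qed

lemma finite_classes: "finite invertible_classes" "finite (central_character ` simple_classes)"
  using finite_simple_classes finite_subset[OF invertible_classes_subset] by blast+

lemma central_characters_group:
  defines "X \<equiv> central_character ` simple_classes"
  shows "\<forall>x\<in>X. \<forall>y\<in>X. x * y \<in> X" "1 \<in> X" "\<forall>x\<in>X. \<forall>y\<in>X. \<forall>z\<in>X. x * y = x * z \<longrightarrow> y = z"
proof -
  show "\<forall>x\<in>X. \<forall>y\<in>X. x * y \<in> X"
  proof (intro ballI)
    fix x y assume "x \<in> X" "y \<in> X"
    then obtain B B' where "B \<in> simple_classes" "B' \<in> simple_classes"
      "x = central_character B" "y = central_character B'"
      unfolding X_def by blast
    then show "x * y \<in> X" using central_character_mult unfolding X_def by (metis imageI)
  qed
  show "1 \<in> X"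
    unfolding X_def using central_character_of_unit_class unit_class_invertible invertible_classes_subset
    by (metis imageI subsetD)
  have "y = z" if "x \<in> X" "x * y = x * z" for x y z
  proof
    fix A
    have "x A \<noteq> 0" using that(1) central_character_nonzero unfolding X_def by auto
    moreover have "x A * y A = x A * z A" using that(2) by (metis times_fun_apply)
    ultimately show "y A = z A" by simp
  qed
  then show "\<forall>x\<in>X. \<forall>y\<in>X. \<forall>z\<in>X. x * y = x * z \<longrightarrow> y = z" by blast
qed

lemma card_central_characters:
  "card (central_character ` simple_classes) = card invertible_classes"
proof (rule card_eq_of_nondegenerate_pairing[where op = class_tens and e = unit_class])
  let ?X = "central_character ` simple_classes"
  show "finite invertible_classes" "finite ?X" by (fact finite_classes)+
  show "1 \<in> ?X" by (fact central_characters_group)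
  show "x * y \<in> ?X" if "x \<in> ?X" "y \<in> ?X" for x y
    by (rule central_characters_group(1)[rule_format, OF that])
  show "\<forall>x\<in>?X. \<forall>y\<in>?X. \<forall>z\<in>?X. x * y = x * z \<longrightarrow> y = z" by (fact central_characters_group)
  show "x (class_tens A A') = x A * x A'"
    if "x \<in> ?X" "A \<in> invertible_classes" "A' \<in> invertible_classes" for x A A'
    using central_character_class_tens that by blast
  show "x A = 1" if "x \<in> ?X" "A \<notin> invertible_classes" for x A
    using that by (auto simp: central_character_def)
  show "x unit_class = 1" if "x \<in> ?X" for x
    using that central_character_unit_class by blast
  show "A = unit_class" if "A \<in> invertible_classes" "\<And>x. x \<in> ?X \<Longrightarrow> x A = 1" for A
    using central_character_separates that by blast
qed (fact class_tens_closed class_tens_inj unit_class_invertible)+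

lemma s_mat_invertible:
  assumes A: "A \<in> invertible_classes" and B: "B \<in> simple_classes"
  shows "s_mat A B = central_character B A * (cat_dim (rep A) * cat_dim (rep B))"
proof -
  note o = invertible_Ob[OF rep_invertible_class[OF A]] rep_simple_class(2)[OF B]
  have o2: "rep A \<boxtimes> rep B \<in> Ob C" using o by simp
  have "br (rep B) (rep A) \<bullet> br (rep A) (rep B) = scl (central_character B A) (ide (rep A \<boxtimes> rep B))"
    using monodromy_central_character[OF A B] unfolding monodromy_def by blast
  then have "the (mo (br (rep B) (rep A) \<bullet> br (rep A) (rep B))) =
      the (mo (scl (central_character B A) (ide (rep A \<boxtimes> rep B))))" by simp
  then have "Braid C (rep B) (rep A) \<cdot> Braid C (rep A) (rep B) =
      Scl C (central_character B A) (Idt C (rep A \<boxtimes> rep B))"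
    using o by (simp add: the_mo the_mo_br)
  then show ?thesis
    unfolding s_mat_def using qtrace_Scl[OF o2] cat_dim_tens[OF o] by simp
qed

lemma s_mat_ratio:
  assumes A: "A \<in> invertible_classes" and B: "B \<in> simple_classes"
  shows "s_mat A B / s_mat unit_class B = central_character B A * cat_dim (rep A)"
proof -
  have "cat_dim (rep unit_class) = 1"
    using cat_dim_iso[OF Unit_in_Ob] rep_iso_class[OF Unit_in_Ob] cat_dim_Unit unfolding unit_class_def by metis
  then have "s_mat unit_class B = cat_dim (rep B)"
    using s_mat_invertible[OF unit_class_invertible B] central_character_unit_class[OF B] by simp
  then show ?thesis
    using s_mat_invertible[OF A B] cat_dim_simple_nonzero[OF rep_simple_class(1)[OF B]] by simp
qed

lemma galois_central_character_power:
  assumes \<sigma>: "\<sigma> \<in> gal_Qbar" and \<pi>: "is_galois_perm \<sigma> \<pi>" and B: "B \<in> simple_classes"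
  shows "\<exists>k::nat. central_character (\<pi> B) = central_character B ^ k"
proof -
  have \<pi>B: "\<pi> B \<in> simple_classes"
    using \<pi> B permutes_in_image unfolding is_galois_perm_def by metis
  obtain n where n: "n > 0" "central_character B ^ n = 1"
    using finite_cancel_power_eq_1[OF finite_classes(2) central_characters_group] B by blast
  have pow: "(x ^ k) A = x A ^ k" for x :: "'o set \<Rightarrow> complex" and k :: nat and A
    by (induction k) simp_all
  obtain k where k: "\<And>z. z ^ (2 * n) = 1 \<Longrightarrow> \<sigma> z = z ^ k"
    using gal_Qbar_root_of_unity[OF \<sigma>, of "2 * n"] n by auto
  have "(-1 :: complex) \<in> \<rat>" by simp
  then have m1: "\<sigma> (- 1) = - 1" "\<sigma> 1 = 1" using \<sigma> unfolding gal_Qbar_def by auto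
  have "central_character (\<pi> B) A = (central_character B ^ k) A" for A
  proof (cases "A \<in> invertible_classes")
    case True
    let ?d = "cat_dim (rep A)"
    have d: "?d = 1 \<or> ?d = - 1"
      using cat_dim_invertible[OF rep_invertible_class[OF True]] by (simp add: square_eq_1_iff)
    have dk: "?d ^ k = ?d"
      using d m1 k[of ?d] by (auto simp: power_mult)
    have "central_character B A ^ n = 1" using n(2) pow by (metis one_fun_apply)
    moreover have "(central_character B A * ?d) ^ (2 * n) = (central_character B A ^ n)\<^sup>2 * (?d\<^sup>2) ^ n"
      by (simp add: power_mult_distrib mult.commute flip: power_mult)
    moreover have "?d\<^sup>2 = 1" using d by auto
    ultimately have "(central_character B A * ?d) ^ (2 * n) = 1" by simp
    then have "\<sigma> (central_character B A * ?d) = central_character B A ^ k * ?d"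
      using k dk by (simp add: power_mult_distrib)
    moreover have "\<sigma> (s_mat A B / s_mat unit_class B) = s_mat A (\<pi> B) / s_mat unit_class (\<pi> B)"
      using \<pi> True invertible_classes_subset B unfolding is_galois_perm_def by blast
    ultimately have "central_character (\<pi> B) A * ?d = central_character B A ^ k * ?d"
      by (auto simp: s_mat_ratio[OF True] B \<pi>B)
    then show ?thesis using d pow by auto
  qed (simp add: pow central_character_def)
  then show ?thesis by blast
qed

lemma self_in_galois_orbit:
  assumes "B \<in> simple_classes"
  shows "B \<in> galois_orbit B"
proof -
  have "(\<lambda>z. z) \<in> gal_Qbar" unfolding gal_Qbar_def by (simp add: bij_betw_def)
  moreover have "is_galois_perm (\<lambda>z. z) id" unfolding is_galois_perm_def by (simp add: permutes_id)
  ultimately show ?thesis unfolding galois_orbit_def by (metis (mono_tags, lifting) CollectI id_apply)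
qed

lemma card_Orb_ge: "card Orb \<ge> 1 + size (prime_factorization (card invertible_classes))"
proof -
  let ?n = "size (prime_factorization (card invertible_classes))"
  obtain xs where xs: "\<And>i. i \<le> ?n \<Longrightarrow> xs i \<in> central_character ` simple_classes"
    "\<And>i j k. j \<le> ?n \<Longrightarrow> i < j \<Longrightarrow> xs j \<noteq> xs i ^ (k::nat)"
    using long_sequence_avoiding_powers[OF finite_classes(2) central_characters_group]
    unfolding card_central_characters by metis
  have "\<forall>i\<in>{..?n}. \<exists>B. B \<in> simple_classes \<and> xs i = central_character B" using xs(1) by blast
  then obtain B where B: "\<And>i. i \<le> ?n \<Longrightarrow> B i \<in> simple_classes \<and> xs i = central_character (B i)"
    by (metis atMost_iff)
  have ne: "galois_orbit (B i) \<noteq> galois_orbit (B j)" if ij: "i < j" "j \<le> ?n" for i j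
  proof
    assume eq: "galois_orbit (B i) = galois_orbit (B j)"
    have "B j \<in> galois_orbit (B i)" unfolding eq using B[OF ij(2)] self_in_galois_orbit by blast
    then obtain \<sigma> \<pi> where \<sigma>: "\<sigma> \<in> gal_Qbar" "is_galois_perm \<sigma> \<pi>" "B j = \<pi> (B i)"
      unfolding galois_orbit_def by blast
    have "B i \<in> simple_classes" using B[of i] ij by simp
    from galois_central_character_power[OF \<sigma>(1,2) this] obtain k :: nat
      where "central_character (\<pi> (B i)) = central_character (B i) ^ k" by blast
    then have "xs j = xs i ^ k" using B[of i] B[of j] ij \<sigma>(3) by simp
    then show False using xs(2)[OF ij(2,1)] by blast
  qed
  have inj: "inj_on (\<lambda>i. galois_orbit (B i)) {..?n}"
  proof (rule inj_onI)
    fix i j assume "i \<in> {..?n}" "j \<in> {..?n}" "galois_orbit (B i) = galois_orbit (B j)"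
    then show "i = j" using ne[of i j] ne[of j i] by (metis atMost_iff nat_neq_iff)
  qed
  have sub: "(\<lambda>i. galois_orbit (B i)) ` {..?n} \<subseteq> Orb" unfolding Orb_def using B by auto
  have "card {..?n} = card ((\<lambda>i. galois_orbit (B i)) ` {..?n})" using card_image[OF inj] by simp
  also have "\<dots> \<le> card Orb"
    by (rule card_mono[OF _ sub]) (simp add: Orb_def finite_simple_classes)
  finally show ?thesis by simp
qed

end

theorem theorem4p1p9:
  fixes C :: "('o, 'm::ab_group_add, 'z) modular_cat_scheme"
    and J :: "'j set" and p a :: "'j \<Rightarrow> nat"
  assumes "modular_tensor_category C"
    and "finite J"
    and "\<And>j. j \<in> J \<Longrightarrow> prime (p j)"
    and "inj_on p J"
    and "\<And>j. j \<in> J \<Longrightarrow> a j \<ge> 1"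
    and "modular_tensor_category.global_dim C (fusion_category.pointed_part C) =
      of_nat (fusion_category.rank_of C (fusion_category.pointed_part C))"
    and "fusion_category.rank_of C (fusion_category.pointed_part C) = (\<Prod>j\<in>J. p j ^ a j)"
  shows "card (modular_tensor_category.Orb C) \<ge> 1 + (\<Sum>j\<in>J. a j)"
proof -
  interpret modular_tensor_category C by fact
  have "card invertible_classes = (\<Prod>j\<in>J. p j ^ a j)"
    using assms(7) unfolding rank_of_def simple_classes_in_pointed_part .
  then show ?thesis
    using card_Orb_ge size_prime_factorization_prod_power[OF assms(2,3), where a = a] by simp
qed

end
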